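(* Let $c$ be the all-different constraint on $n$ variables $v_1,\dots,v_n$ with domain $[1,d]$. Unit-propagation on the program consisting, for each $v\in\{v_1,\dots,v_n\}$ and each interval $[l,u]\subseteq[1,d]$, of the rules $$r(v,l,u)\leftarrow \mathit{not}\,r(v,1,l-1),\ \mathit{not}\,r(v,u+1,d),$$ $$\bot\leftarrow r(v,l,u),\ \mathit{not}\,r(v,l-1,u)\quad(l>1),\qquad \bot\leftarrow r(v,l,u),\ \mathit{not}\,r(v,l,u+1)\quad(u<d),$$ and, for each interval $[l,u]\subseteq[1,d]$, of the rule $$violate(c)\leftarrow (u-l+2)\,\{r(v_1,l,u),\dots,r(v_n,l,u)\},$$ with $c$ required to hold, enforces range consistency on $c$, in $\mathcal{O}(nd^3)$ total time down any branch of the search tree.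
   Context: Constraints. Variables have domain $[1,d]=\{1,\dots,d\}$. The all-different constraint on $v_1,\dots,v_n$ requires these variables to take pairwise different values. Given current domains $D(v)\subseteq[1,d]$, a bound support for $v_i=a$ is an allowed tuple with $i$-th entry $a$ and, for every $j\neq i$, $j$-th entry in the interval $[\min D(v_j),\max D(v_j)]$. A constraint is range consistent iff for every variable $v_i$ in its scope and every $a\in D(v_i)$ there is a bound support for $v_i=a$. Enforcing range consistency means replacing the domains by the largest subdomains for which $c$ is range consistent; failure means that some domain becomes empty. Logic programs and unit-propagation. A rule $h\leftarrow a_1,\dots,a_m,\mathit{not}\,a_{m+1},\dots,\mathit{not}\,a_k$ has head $h$ and body the set of literals on its right; $\bot$ is the always-false atom. A cardinality body $k\{\ell_1,\dots,\ell_m\}$ holds iff at least $k$ of the literals $\ell_j$ hold. Unit-propagation works on partial truth assignments to atoms and rule bodies, using the nogoods (forbidden sets of truth-value assignments) expressing that: a body is true iff its literals are all true (for a cardinality body: iff at least $k$ of its literals are true; semantically one nogood per relevant subset of literals, but an implementation may realise the same inferences by other means such as counters); a true body makes its head true; an atom is true only if the body of some rule having it in its head is true; $\bot$ is false. Whenever all but one element of a nogood hold, the complement of the remaining element is added; a conflict occurs if all elements of some nogood hold. The atoms $r(v,l,u)$, $1\le l\le u\le d$, mean $v\in[l,u]$; literals $\mathit{not}\,r(v,1,0)$ and $\mathit{not}\,r(v,d+1,d)$ for empty ranges are taken as true (omitted). The program also contains the reification rules $sat(c)\leftarrow\mathit{not}\,violate(c)$ and $violate(c)\leftarrow\mathit{not}\,sat(c)$.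 Enforcing a consistency by unit-propagation. Given nonempty initial domains $D(v)\subseteq[1,d]$, start from the assignment in which $violate(c)$ is false and $r(v,i,i)$ is false for all $i\notin D(v)$, and run unit-propagation to fixpoint. That unit-propagation enforces range consistency means: for all such initial domains, a conflict occurs iff enforcing range consistency fails, and otherwise, for every $v$, the set of $i$ with $r(v,i,i)$ not false at the fixpoint equals the domain of $v$ obtained by enforcing range consistency. Search tree branch. A branch is a sequence of decisions, each assigning a truth value to an unassigned atom, with unit-propagation run to fixpoint after each decision, until a conflict occurs or everything is assigned. "In $\mathcal{O}(f)$ down any branch" means that unit-propagation can be implemented so that its total running time over any whole branch is $\mathcal{O}(f)$. *)

theory Defs
  imports Main
begin

section \<open>Range consistency\<close>

text \<open>The variables are \<open>v\<^sub>1, \<dots>, v\<^sub>n\<close>, written as the indices \<open>1, \<dots>, n\<close>. A constraint is its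
  set of allowed tuples; only the entries at \<open>1, \<dots>, n\<close> of a tuple or of a domain family matter.\<close>

type_synonym doms = "nat \<Rightarrow> nat set"
type_synonym tuple = "nat \<Rightarrow> nat"

definition all_different :: "nat \<Rightarrow> nat \<Rightarrow> tuple set" where
  "all_different n d = {\<tau>. (\<forall>v\<in>{1..n}. \<tau> v \<in> {1..d}) \<and> inj_on \<tau> {1..n}}"

text \<open>The case distinction is needed because \<^term>\<open>Min {}\<close> and \<^term>\<open>Max {}\<close> are unspecified: an
  empty domain supports nothing.\<close>

definition hull :: "nat set \<Rightarrow> nat set" where
  "hull S = (if S = {} then {} else {Min S..Max S})"

definition bound_support :: "nat \<Rightarrow> tuple set \<Rightarrow> doms \<Rightarrow> nat \<Rightarrow> nat \<Rightarrow> tuple \<Rightarrow> bool" where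
  "bound_support n c D i a \<tau> \<longleftrightarrow>
     \<tau> \<in> c \<and> \<tau> i = a \<and> (\<forall>j\<in>{1..n}. j \<noteq> i \<longrightarrow> \<tau> j \<in> hull (D j))"

definition range_consistent :: "nat \<Rightarrow> tuple set \<Rightarrow> doms \<Rightarrow> bool" where
  "range_consistent n c D \<longleftrightarrow> (\<forall>i\<in>{1..n}. \<forall>a\<in>D i. \<exists>\<tau>. bound_support n c D i a \<tau>)"

definition subdomains :: "nat \<Rightarrow> doms \<Rightarrow> doms \<Rightarrow> bool" where
  "subdomains n E D \<longleftrightarrow> (\<forall>v\<in>{1..n}. E v \<subseteq> D v)"

text \<open>\<open>E\<close> is the result of enforcing range consistency of \<open>c\<close> on \<open>D\<close>.\<close>

definition enforced_rc :: "nat \<Rightarrow> tuple set \<Rightarrow> doms \<Rightarrow> doms \<Rightarrow> bool" where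
  "enforced_rc n c D E \<longleftrightarrow>
     subdomains n E D \<and> range_consistent n c E \<and>
     (\<forall>E'. subdomains n E' D \<and> range_consistent n c E' \<longrightarrow> subdomains n E' E)"

definition initial_doms :: "nat \<Rightarrow> nat \<Rightarrow> doms \<Rightarrow> bool" where
  "initial_doms n d D \<longleftrightarrow> (\<forall>v\<in>{1..n}. D v \<noteq> {} \<and> D v \<subseteq> {1..d})"


section \<open>Logic programs and unit-propagation\<close>

text \<open>\<^term>\<open>R v l u\<close> stands for \<open>r(v,l,u)\<close>. There is a single constraint \<open>c\<close>, so \<open>sat(c)\<close> and
  \<open>violate(c)\<close> are constants.\<close>

datatype atom = R nat nat nat | Sat | Violate | Bot

datatype lit = Pos atom | Neg atom

datatype body = Conj "lit set" | Card nat "lit set"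

type_synonym rule = "atom \<times> body"

text \<open>Truth values are assigned to atoms and to rule bodies. An assignment is the set of pairs
  (object, truth value) that hold; a nogood is a forbidden set of such pairs.\<close>

datatype obj = At atom | Bd body

type_synonym slit = "obj \<times> bool"

fun compl :: "slit \<Rightarrow> slit" where
  "compl (x, b) = (x, \<not> b)"

fun slit :: "lit \<Rightarrow> slit" where
  "slit (Pos a) = (At a, True)"
| "slit (Neg a) = (At a, False)"

text \<open>For a cardinality body over \<open>m\<close> literals, at least \<open>k\<close> are true unless \<open>m + 1 - k\<close> of them are
  false. If \<open>k > m\<close> this (truncated) number is \<open>0\<close> and the body is simply forbidden to be true.\<close>

fun body_nogoods :: "body \<Rightarrow> slit set set" where
  "body_nogoods (Conj L) =
     {insert (Bd (Conj L), False) (slit ` L)} \<union>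
     {{(Bd (Conj L), True), compl (slit \<l>)} | \<l>. \<l> \<in> L}"
| "body_nogoods (Card k L) =
     {insert (Bd (Card k L), False) (slit ` S) | S. S \<subseteq> L \<and> card S = k} \<union>
     {insert (Bd (Card k L), True) (compl ` slit ` S) | S. S \<subseteq> L \<and> card S = card L + 1 - k}"

fun lit_atom :: "lit \<Rightarrow> atom" where
  "lit_atom (Pos a) = a"
| "lit_atom (Neg a) = a"

fun body_lits :: "body \<Rightarrow> lit set" where
  "body_lits (Conj L) = L"
| "body_lits (Card k L) = L"

definition atoms_of :: "rule set \<Rightarrow> atom set" where
  "atoms_of P = fst ` P \<union> (\<Union>\<rho>\<in>P. lit_atom ` body_lits (snd \<rho>))"

definition nogoods :: "rule set \<Rightarrow> slit set set" where
  "nogoods P =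
     (\<Union>\<rho>\<in>P. body_nogoods (snd \<rho>)) \<union>
     {{(Bd \<beta>, True), (At h, False)} | h \<beta>. (h, \<beta>) \<in> P} \<union>
     {insert (At a, True) {(Bd \<beta>, False) | \<beta>. (a, \<beta>) \<in> P} | a. a \<in> atoms_of P} \<union>
     {{(At Bot, True)}}"

text \<open>The fixpoint of unit-propagation from \<open>A\<close>. The saturation does not stop at a conflict; this
  is harmless, since nothing but the presence of the conflict is used in that case, and a
  propagation order without conflict ends in exactly this set.\<close>

inductive_set unit_prop :: "slit set set \<Rightarrow> slit set \<Rightarrow> slit set" for N A where
  start: "\<sigma> \<in> A \<Longrightarrow> \<sigma> \<in> unit_prop N A"
| unit: "\<nu> \<in> N \<Longrightarrow> \<delta> \<in> \<nu> \<Longrightarrow> (\<And>\<sigma>. \<sigma> \<in> \<nu> - {\<delta>} \<Longrightarrow> \<sigma> \<in> unit_prop N A) \<Longrightarrow>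
    compl \<delta> \<in> unit_prop N A"

definition conflict :: "slit set set \<Rightarrow> slit set \<Rightarrow> bool" where
  "conflict N A \<longleftrightarrow> (\<exists>\<nu>\<in>N. \<nu> \<subseteq> A)"

definition initial_assignment :: "nat \<Rightarrow> nat \<Rightarrow> doms \<Rightarrow> slit set" where
  "initial_assignment n d D =
     insert (At Violate, False) {(At (R v i i), False) | v i. v \<in> {1..n} \<and> i \<in> {1..d} - D v}"

definition up_enforces_range_consistency :: "nat \<Rightarrow> nat \<Rightarrow> tuple set \<Rightarrow> rule set \<Rightarrow> bool" where
  "up_enforces_range_consistency n d c P \<longleftrightarrow>
     (\<forall>D. initial_doms n d D \<longrightarrow>
       (let A = unit_prop (nogoods P) (initial_assignment n d D) in
        \<exists>E. enforced_rc n c D E \<and>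
          (conflict (nogoods P) A \<longleftrightarrow> (\<exists>v\<in>{1..n}. E v = {})) \<and>
          (\<not> conflict (nogoods P) A \<longrightarrow>
            (\<forall>v\<in>{1..n}. {i \<in> {1..d}. (At (R v i i), False) \<notin> A} = E v))))"


section \<open>The program for the all-different constraint\<close>

definition range_body :: "nat \<Rightarrow> nat \<Rightarrow> nat \<Rightarrow> nat \<Rightarrow> body" where
  "range_body d v l u =
     Conj ((if 1 < l then {Neg (R v 1 (l - 1))} else {}) \<union>
           (if u < d then {Neg (R v (u + 1) d)} else {}))"

definition left_body :: "nat \<Rightarrow> nat \<Rightarrow> nat \<Rightarrow> body" where
  "left_body v l u = Conj {Pos (R v l u), Neg (R v (l - 1) u)}"

definition right_body :: "nat \<Rightarrow> nat \<Rightarrow> nat \<Rightarrow> body" where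
  "right_body v l u = Conj {Pos (R v l u), Neg (R v l (u + 1))}"

definition hall_body :: "nat \<Rightarrow> nat \<Rightarrow> nat \<Rightarrow> body" where
  "hall_body n l u = Card (u - l + 2) {Pos (R v l u) | v. v \<in> {1..n}}"

definition all_different_prog :: "nat \<Rightarrow> nat \<Rightarrow> rule set" where
  "all_different_prog n d =
     {(R v l u, range_body d v l u) | v l u. v \<in> {1..n} \<and> 1 \<le> l \<and> l \<le> u \<and> u \<le> d} \<union>
     {(Bot, left_body v l u) | v l u. v \<in> {1..n} \<and> 1 < l \<and> l \<le> u \<and> u \<le> d} \<union>
     {(Bot, right_body v l u) | v l u. v \<in> {1..n} \<and> 1 \<le> l \<and> l \<le> u \<and> u < d} \<union>
     {(Violate, hall_body n l u) | l u. 1 \<le> l \<and> l \<le> u \<and> u \<le> d} \<union>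
     {(Sat, Conj {Neg Violate}), (Violate, Conj {Neg Sat})}"


section \<open>Branches of the search tree\<close>

text \<open>\<^term>\<open>branch P A0 ds A\<close>: starting from \<open>A0\<close> and taking the decisions \<open>ds\<close> in order, each
  followed by unit-propagation, leads to \<open>A\<close>. Initial segments of a branch are included.\<close>

type_synonym decision = "atom \<times> bool"

inductive branch :: "rule set \<Rightarrow> slit set \<Rightarrow> decision list \<Rightarrow> slit set \<Rightarrow> bool" for P A0 where
  root: "branch P A0 [] (unit_prop (nogoods P) A0)"
| decide: "branch P A0 ds A \<Longrightarrow> \<not> conflict (nogoods P) A \<Longrightarrow> a \<in> atoms_of P \<Longrightarrow>
    (At a, True) \<notin> A \<Longrightarrow> (At a, False) \<notin> A \<Longrightarrow>
    branch P A0 (ds @ [(a, b)]) (unit_prop (nogoods P) (insert (At a, b) A))"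


section \<open>A machine model with running time\<close>

text \<open>A structured random access machine: cells hold natural numbers and are addressed by lists of
  numbers, so \<open>[k, i, j]\<close> is the entry \<open>(i, j)\<close> of the array number \<open>k\<close> and \<open>[k]\<close> is a scalar.
  Every evaluated node of a program costs one unit of time; in particular an access costs one
  more than the evaluation of its indices, whose number is fixed by the program text. Successor
  and predecessor are the only arithmetic operations, so no number exceeds the largest input or
  program constant by more than the running time: unit cost hides no computation on large
  numbers.\<close>

type_synonym store = "nat list \<Rightarrow> nat"

datatype exp = Const nat | Cell "exp list" | Succ exp | Pred exp

datatype bexp = Eq exp exp | Less exp exp | Not bexp | And bexp bexp

datatype com = Skip | Assign "exp list" exp | Seq com com | If bexp com com | While bexp com

fun eval :: "exp \<Rightarrow> store \<Rightarrow> nat" where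
  "eval (Const k) s = k"
| "eval (Cell es) s = s (map (\<lambda>e. eval e s) es)"
| "eval (Succ e) s = eval e s + 1"
| "eval (Pred e) s = eval e s - 1"

fun ecost :: "exp \<Rightarrow> nat" where
  "ecost (Const k) = 1"
| "ecost (Cell es) = 1 + sum_list (map ecost es)"
| "ecost (Succ e) = 1 + ecost e"
| "ecost (Pred e) = 1 + ecost e"

fun beval :: "bexp \<Rightarrow> store \<Rightarrow> bool" where
  "beval (Eq e e') s \<longleftrightarrow> eval e s = eval e' s"
| "beval (Less e e') s \<longleftrightarrow> eval e s < eval e' s"
| "beval (Not b) s \<longleftrightarrow> \<not> beval b s"
| "beval (And b b') s \<longleftrightarrow> beval b s \<and> beval b' s"

fun bcost :: "bexp \<Rightarrow> nat" where
  "bcost (Eq e e') = 1 + ecost e + ecost e'"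
| "bcost (Less e e') = 1 + ecost e + ecost e'"
| "bcost (Not b) = 1 + bcost b"
| "bcost (And b b') = 1 + bcost b + bcost b'"

text \<open>\<^term>\<open>exec p s t s'\<close>: started in \<open>s\<close>, the program \<open>p\<close> terminates in \<open>s'\<close> after time \<open>t\<close>.\<close>

inductive exec :: "com \<Rightarrow> store \<Rightarrow> nat \<Rightarrow> store \<Rightarrow> bool" where
  skip: "exec Skip s 1 s"
| assign: "exec (Assign es e) s (1 + sum_list (map ecost es) + ecost e)
     (s(map (\<lambda>e. eval e s) es := eval e s))"
| seq: "exec p s t s' \<Longrightarrow> exec q s' t' s'' \<Longrightarrow> exec (Seq p q) s (1 + t + t') s''"
| if_true: "beval b s \<Longrightarrow> exec p s t s' \<Longrightarrow> exec (If b p q) s (1 + bcost b + t) s'"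
| if_false: "\<not> beval b s \<Longrightarrow> exec q s t s' \<Longrightarrow> exec (If b p q) s (1 + bcost b + t) s'"
| while_true: "beval b s \<Longrightarrow> exec p s t s' \<Longrightarrow> exec (While b p) s' t' s'' \<Longrightarrow>
    exec (While b p) s (1 + bcost b + t + t') s''"
| while_false: "\<not> beval b s \<Longrightarrow> exec (While b p) s (1 + bcost b) s"

lemma exec_deterministic:
  "exec p s t s' \<Longrightarrow> exec p s t' s'' \<Longrightarrow> t = t' \<and> s' = s''"
proof (induction arbitrary: t' s'' rule: exec.induct)
  case (skip s)
  then show ?case by (auto elim: exec.cases)
next
  case (assign es e s)
  then show ?case by (auto elim: exec.cases)
next
  case (seq p s t s' q t' s'')
  from seq.prems seq.IH show ?case by (cases rule: exec.cases) blast+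
next
  case (if_true b s p t s' q)
  from if_true.prems if_true.IH if_true.hyps show ?case by (cases rule: exec.cases) blast+
next
  case (if_false b s q t s' p)
  from if_false.prems if_false.IH if_false.hyps show ?case by (cases rule: exec.cases) blast+
next
  case (while_true b s p t s' t' s'')
  from while_true.prems while_true.IH while_true.hyps show ?case by (cases rule: exec.cases) blast+
next
  case (while_false b s p)
  from while_false.prems while_false.hyps show ?case by (cases rule: exec.cases) blast+
qed


section \<open>Implementing unit-propagation along a branch\<close>

text \<open>The interface between the search and the propagator. Cells used:
  \<^item> \<open>[0]\<close>, \<open>[1]\<close>: the inputs \<open>n\<close> and \<open>d\<close>; \<open>[8, v, i]\<close>: is \<open>i\<close> in the initial domain of \<open>v\<close>
    (\<open>1\<close> or \<open>0\<close>);
  \<^item> \<open>[2]\<close>: conflict flag, an output;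
  \<^item> \<open>[3]\<close> to \<open>[6]\<close>: code of the atom just decided, \<open>[7]\<close>: its truth value;
  \<^item> \<open>[9, \<dots>]\<close> to \<open>[15]\<close>: the truth values of all atoms and all rule bodies, an output.
  Truth values are coded as \<open>0\<close> (unassigned), \<open>1\<close> (true), \<open>2\<close> (false). All other cells are free for
  the program to use.\<close>

definition input_store :: "nat \<Rightarrow> nat \<Rightarrow> doms \<Rightarrow> store" where
  "input_store n d D a =
     (if a = [0] then n
      else if a = [1] then d
      else if \<exists>v\<in>{1..n}. \<exists>i\<in>D v. a = [8, v, i] then 1
      else 0)"

fun atom_code :: "atom \<Rightarrow> nat \<times> nat \<times> nat \<times> nat" where
  "atom_code (R v l u) = (0, v, l, u)"
| "atom_code Sat = (1, 0, 0, 0)"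
| "atom_code Violate = (2, 0, 0, 0)"
| "atom_code Bot = (3, 0, 0, 0)"

fun post_decision :: "decision \<Rightarrow> store \<Rightarrow> store" where
  "post_decision (a, b) s =
     (case atom_code a of (k, v, l, u) \<Rightarrow>
       s([3] := k, [4] := v, [5] := l, [6] := u, [7] := (if b then 1 else 2)))"

definition truth_code :: "slit set \<Rightarrow> obj \<Rightarrow> nat" where
  "truth_code A x = (if (x, True) \<in> A then 1 else if (x, False) \<in> A then 2 else 0)"

definition all_different_cells :: "nat \<Rightarrow> nat \<Rightarrow> (nat list \<times> obj) set" where
  "all_different_cells n d =
     {([9, k, v, l, u], At a) | k v l u a.
        a \<in> insert Bot (atoms_of (all_different_prog n d)) \<and> atom_code a = (k, v, l, u)} \<union>
     {([10, v, l, u], Bd (range_body d v l u)) | v l u.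
        v \<in> {1..n} \<and> 1 \<le> l \<and> l \<le> u \<and> u \<le> d} \<union>
     {([11, v, l, u], Bd (left_body v l u)) | v l u. v \<in> {1..n} \<and> 1 < l \<and> l \<le> u \<and> u \<le> d} \<union>
     {([12, v, l, u], Bd (right_body v l u)) | v l u. v \<in> {1..n} \<and> 1 \<le> l \<and> l \<le> u \<and> u < d} \<union>
     {([13, l, u], Bd (hall_body n l u)) | l u. 1 \<le> l \<and> l \<le> u \<and> u \<le> d} \<union>
     {([14], Bd (Conj {Neg Violate})), ([15], Bd (Conj {Neg Sat}))}"

text \<open>The store displays the assignment \<open>A\<close> reached by unit-propagation.\<close>

definition displays :: "nat \<Rightarrow> nat \<Rightarrow> slit set \<Rightarrow> store \<Rightarrow> bool" where
  "displays n d A s \<longleftrightarrow>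
     (if conflict (nogoods (all_different_prog n d)) A then s [2] = 1
      else s [2] = 0 \<and> (\<forall>(a, x)\<in>all_different_cells n d. s a = truth_code A x))"

text \<open>\<^term>\<open>run init step s0 ds s t\<close>: the propagator, consisting of a program \<open>init\<close> for the root and
  a program \<open>step\<close> run after each decision, ends in \<open>s\<close> after the decisions \<open>ds\<close>, with total running
  time \<open>t\<close>. The store persists between the calls, and a call cannot see later decisions.\<close>

inductive run :: "com \<Rightarrow> com \<Rightarrow> store \<Rightarrow> decision list \<Rightarrow> store \<Rightarrow> nat \<Rightarrow> bool" for init step s0 where
  root: "exec init s0 t s \<Longrightarrow> run init step s0 [] s t"
| decide: "run init step s0 ds s t \<Longrightarrow> exec step (post_decision x s) t' s' \<Longrightarrow>
    run init step s0 (ds @ [x]) s' (t + t')"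

text \<open>One implementation and one constant serve all \<open>n\<close>, \<open>d\<close>, initial domains and branches.\<close>

definition all_different_up_time :: "(nat \<Rightarrow> nat \<Rightarrow> nat) \<Rightarrow> bool" where
  "all_different_up_time f \<longleftrightarrow>
     (\<exists>init step C. \<forall>n d D ds A.
        1 \<le> n \<and> 1 \<le> d \<and> initial_doms n d D \<and>
        branch (all_different_prog n d) (initial_assignment n d D) ds A \<longrightarrow>
        (\<exists>s t. run init step (input_store n d D) ds s t \<and> displays n d A s \<and> t \<le> C * f n d))"

end

theory Submission
  imports Defs
begin

text \<open>On a conflict-free branch the bodies of the Hall rules and of the two \<open>\<bottom>\<close>-rules are false,
  so unit-propagation amounts to inference on three-valued range atoms: three local rules per
  variable, and one rule per interval that excludes it for every further variable once it is filled.
  The values left by a conflict-free fixpoint are range consistent by Hall's theorem for intervals,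
  and a range consistent family of nonempty domains yields a valuation closed under the inferences.

  For the time bound, a queue holds the assigned atoms whose consequences are still to be drawn.
  Visiting one of them re-examines \<open>O(d)\<close> neighbouring ranges and one interval. Each visit lowers the
  potential, which is the number of unassigned atoms plus the length of the queue, and which is at
  most \<open>nd\<^sup>2\<close> at the root.\<close>

section \<open>Fixpoints of unit-propagation\<close>

text \<open>The bridge between assignments and valuations is used in both directions. The readout of
  a closed valuation is consistent and closed under every nogood, hence contains the least fixpoint
  above any start that it contains; the values shown by a conflict-free fixpoint are closed. The
  same pair of facts serves the filtering result and the implementation, which therefore only has to
  stop at a closed valuation that lies below every closed valuation extending its start, whatever
  the order of its visits.

  Two obstacles shape the details. Bodies are shared: the empty conjunction is the body of
  \<open>r(v,1,d)\<close> for every \<open>v\<close>, so reading the value of a body off a range is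
  well defined only because these full ranges are always true. And a visit counts the variables
  whose range is true, which takes time linear in \<open>n\<close> rather than in \<open>d\<close>.
  This fits into \<open>O(d)\<close> because for \<open>d < n\<close> the interval
  \<open>[1,d]\<close> already causes a conflict at the root, where a single comparison detects it.
  Decisions need no separate count: each of them uses up potential itself.\<close>

definition consistent :: "slit set \<Rightarrow> bool" where
  "consistent A \<longleftrightarrow> (\<forall>x. (x, True) \<in> A \<longrightarrow> (x, False) \<notin> A)"

definition unit_closed :: "slit set \<Rightarrow> slit set \<Rightarrow> bool" where
  "unit_closed B \<nu> \<longleftrightarrow> (\<forall>\<delta>\<in>\<nu>. \<nu> - {\<delta>} \<subseteq> B \<longrightarrow> compl \<delta> \<in> B)"

lemma compl_compl [simp]: "compl (compl \<delta>) = \<delta>"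
  by (cases \<delta>) simp

lemma consistent_compl: "consistent A \<Longrightarrow> \<delta> \<in> A \<Longrightarrow> compl \<delta> \<notin> A"
  by (cases \<delta>; cases "snd \<delta>") (auto simp: consistent_def)

lemma start_subset_unit_prop: "A \<subseteq> unit_prop N A"
  by (auto intro: unit_prop.start)

lemma unit_closed_unit_prop: "\<nu> \<in> N \<Longrightarrow> unit_closed (unit_prop N A) \<nu>"
  by (auto simp: unit_closed_def intro!: unit_prop.unit)

lemma unit_prop_least:
  assumes "A \<subseteq> B" and "\<And>\<nu>. \<nu> \<in> N \<Longrightarrow> unit_closed B \<nu>"
  shows "unit_prop N A \<subseteq> B"
proof
  fix \<sigma> assume "\<sigma> \<in> unit_prop N A"
  then show "\<sigma> \<in> B"
  proof induction
    case (unit \<nu> \<delta>)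
    then have "\<nu> - {\<delta>} \<subseteq> B" by blast
    with unit.hyps assms(2) show ?case by (auto simp: unit_closed_def)
  qed (use assms(1) in blast)
qed

text \<open>A literal derived by \<open>unit\<close> while its complement is present would complete
  the nogood it was derived from, which is a conflict. So both members of a complementary pair would
  have to come from the start assignment.\<close>

lemma consistent_unit_prop:
  assumes "consistent A" and "\<not> conflict N (unit_prop N A)"
  shows "consistent (unit_prop N A)"
proof -
  let ?U = "unit_prop N A"
  have start: "\<sigma> \<in> A" if "\<sigma> \<in> ?U" "compl \<sigma> \<in> ?U" for \<sigma>
    using that(1)
  proof cases
    case (unit \<nu> \<delta>)
    then have "\<nu> \<subseteq> ?U" using that(2) by auto
    then show ?thesis using unit assms(2) by (auto simp: conflict_def)
  qed
  show ?thesis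
    unfolding consistent_def
  proof (intro allI impI notI)
    fix x assume "(x, True) \<in> ?U" "(x, False) \<in> ?U"
    then show False
      using start[of "(x, True)"] start[of "(x, False)"] assms(1) by (auto simp: consistent_def)
  qed
qed

text \<open>In a nogood with a falsified element \<open>\<delta>\<close>, only
  \<open>\<delta>\<close> itself can be the single missing element, and its complement is already
  present. This disposes of every nogood that contains the complement of a constant literal.\<close>

lemma unit_closed_satisfied:
  assumes "consistent B" and "\<delta> \<in> \<nu>" and "compl \<delta> \<in> B"
  shows "unit_closed B \<nu>"
  unfolding unit_closed_def
proof (intro ballI impI)
  fix \<delta>' assume "\<delta>' \<in> \<nu>" "\<nu> - {\<delta>'} \<subseteq> B"
  moreover have "\<delta> \<notin> B" using consistent_compl[OF assms(1), of \<delta>] assms(3) by blast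
  ultimately have "\<delta>' = \<delta>" using assms(2) by blast
  with assms(3) show "compl \<delta>' \<in> B" by simp
qed

text \<open>A nogood contained in \<open>B\<close> has, by closedness, the complement of each of its
  elements in \<open>B\<close> as well; being nonempty, it has such an element.\<close>

lemma no_conflict_if_unit_closed:
  assumes "consistent B" and "U \<subseteq> B" and "\<And>\<nu>. \<nu> \<in> N \<Longrightarrow> unit_closed B \<nu> \<and> \<nu> \<noteq> {}"
  shows "\<not> conflict N U"
proof
  assume "conflict N U"
  then obtain \<nu> where \<nu>: "\<nu> \<in> N" "\<nu> \<subseteq> U" by (auto simp: conflict_def)
  then obtain \<delta> where "\<delta> \<in> \<nu>" using assms(3) by blast
  with \<nu> have "compl \<delta> \<in> B" "\<delta> \<in> B"
    using assms(2) assms(3)[of \<nu>] unfolding unit_closed_def by blast+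
  then show False
    using consistent_compl[OF assms(1)] by blast
qed


section \<open>Unit-propagation on the program as inference on ranges\<close>

type_synonym range = "nat \<times> nat \<times> nat"

type_synonym fact = "range \<times> nat"

type_synonym valuation = "range \<Rightarrow> nat"

definition ranges :: "nat \<Rightarrow> nat \<Rightarrow> range set" where
  "ranges n d = {(v, l, u). v \<in> {1..n} \<and> 1 \<le> l \<and> l \<le> u \<and> u \<le> d}"

text \<open>The border gives a truth value to the ranges just outside the triangle \<open>1 \<le> l \<le> u \<le> d\<close>, so
  that rules with omitted literals need no separate treatment.\<close>

definition border :: "nat \<Rightarrow> nat \<Rightarrow> valuation" where
  "border n d = (\<lambda>(v, l, u).
     if v \<notin> {1..n} then 0
     else if (l, u) = (1, 0) \<or> (l, u) = (d + 1, d) then 2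
     else if l = 0 \<and> u \<in> {1..d} \<or> l \<in> {1..d} \<and> u = d + 1 then 1
     else 0)"

datatype pos = Self | Below | Above | Left | Right

text \<open>\<open>Below\<close> and \<open>Above\<close> are the two ranges whose negations form
  the body of \<open>r(v,l,u)\<close>. \<open>Left\<close> and \<open>Right\<close> are the ranges
  enlarged by one value, from the two \<open>\<bottom>\<close>-rules. At the edges of the triangle
  these places fall on the border.\<close>

fun place :: "nat \<Rightarrow> nat \<Rightarrow> nat \<Rightarrow> pos \<Rightarrow> nat \<times> nat" where
  "place d l u Self = (l, u)"
| "place d l u Below = (1, l - 1)"
| "place d l u Above = (u + 1, d)"
| "place d l u Left = (l - 1, u)"
| "place d l u Right = (l, u + 1)"

text \<open>Five nogoods, each read in every direction, with the body of \<open>r(v,l,u)\<close>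
  identified with the atom and the false bodies of the \<open>\<bottom>\<close>-rules dropped. One
  of them has three elements (\<open>Self\<close>, \<open>Below\<close> and \<open>Above\<close> all
  false) and gives three clauses; the other four have two elements and give two clauses
  each.\<close>

definition clauses :: "((pos \<times> nat) list \<times> pos \<times> nat) list" where
  "clauses =
     [([(Self, 2), (Below, 2)], Above, 1), ([(Self, 2), (Above, 2)], Below, 1),
      ([(Below, 2), (Above, 2)], Self, 1),
      ([(Self, 1)], Below, 2), ([(Below, 1)], Self, 2),
      ([(Self, 1)], Above, 2), ([(Above, 1)], Self, 2),
      ([(Self, 1)], Left, 1), ([(Left, 2)], Self, 2),
      ([(Self, 1)], Right, 1), ([(Right, 2)], Self, 2)]"

definition locate :: "nat \<Rightarrow> range \<Rightarrow> pos \<times> nat \<Rightarrow> fact" where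
  "locate d = (\<lambda>(v, l, u) (p, b). ((v, place d l u p), b))"

definition range_inferences :: "nat \<Rightarrow> nat \<Rightarrow> (fact set \<times> fact) set" where
  "range_inferences n d =
     {(locate d r ` set as, locate d r c) | r as c. r \<in> ranges n d \<and> (as, c) \<in> set clauses}"

text \<open>A nogood of the Hall body mentions \<open>u - l + 2\<close> atoms. With the body false,
  the last of them is forced to be false as soon as the others, as many as the interval has values,
  are true.\<close>

definition hall_inferences :: "nat \<Rightarrow> nat \<Rightarrow> (fact set \<times> fact) set" where
  "hall_inferences n d =
     {((\<lambda>v. ((v, l, u), 1)) ` S, ((w, l, u), 2)) | l u S w.
        1 \<le> l \<and> l \<le> u \<and> u \<le> d \<and> S \<subseteq> {1..n} \<and> card S = u - l + 1 \<and> w \<in> {1..n} - S}"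

definition inferences :: "nat \<Rightarrow> nat \<Rightarrow> (fact set \<times> fact) set" where
  "inferences n d = range_inferences n d \<union> hall_inferences n d"

lemma inferences_cases:
  assumes "(X, c) \<in> inferences n d"
  obtains (range) v l u as a where "(v, l, u) \<in> ranges n d" "(as, a) \<in> set clauses"
      "X = locate d (v, l, u) ` set as" "c = locate d (v, l, u) a"
    | (hall) l u S w where "X = (\<lambda>v. ((v, l, u), 1)) ` S" "c = ((w, l, u), 2)"
      "1 \<le> l" "l \<le> u" "u \<le> d" "S \<subseteq> {1..n}" "card S = u - l + 1" "w \<in> {1..n} - S"
proof (cases "(X, c) \<in> range_inferences n d")
  case True
  then obtain r as a where "X = locate d r ` set as" "c = locate d r a" "r \<in> ranges n d"
    "(as, a) \<in> set clauses"
    unfolding range_inferences_def by blast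
  then show thesis using range by (cases r) blast
next
  case False
  with assms have "(X, c) \<in> hall_inferences n d" by (simp add: inferences_def)
  then show thesis using hall unfolding hall_inferences_def by blast
qed

section \<open>Valuations closed under the inferences and the assignments they stand for\<close>

definition holds :: "valuation \<Rightarrow> fact \<Rightarrow> bool" where
  "holds T f \<longleftrightarrow> T (fst f) = snd f"

definition closed_under :: "(fact set \<times> fact) set \<Rightarrow> valuation \<Rightarrow> bool" where
  "closed_under J T \<longleftrightarrow> (\<forall>(X, c)\<in>J. (\<forall>f\<in>X. holds T f) \<longrightarrow> holds T c)"

definition bordered :: "nat \<Rightarrow> nat \<Rightarrow> valuation \<Rightarrow> bool" where
  "bordered n d T \<longleftrightarrow> (\<forall>r. r \<notin> ranges n d \<longrightarrow> T r = border n d r)"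

definition code :: "bool \<Rightarrow> nat" where
  "code b = (if b then 1 else 2)"

lemma code_simps [simp]: "code True = 1" "code False = 2"
  by (auto simp: code_def)

lemma code_inject [simp]: "code b = code b' \<longleftrightarrow> b = b'"
  by (auto simp: code_def)

text \<open>The literals that follow from the falsity of \<open>\<bottom>\<close> and
  \<open>violate(c)\<close> alone. They stay the same along every conflict-free branch, which leaves
  only the range atoms and their bodies to be tracked.\<close>

definition constants :: "nat \<Rightarrow> nat \<Rightarrow> slit set" where
  "constants n d =
     {(At Bot, False), (At Violate, False), (At Sat, True),
      (Bd (Conj {Neg Violate}), True), (Bd (Conj {Neg Sat}), False)} \<union>
     {(Bd (left_body v l u), False) | v l u. v \<in> {1..n} \<and> 1 < l \<and> l \<le> u \<and> u \<le> d} \<union>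
     {(Bd (right_body v l u), False) | v l u. v \<in> {1..n} \<and> 1 \<le> l \<and> l \<le> u \<and> u < d} \<union>
     {(Bd (hall_body n l u), False) | l u. 1 \<le> l \<and> l \<le> u \<and> u \<le> d}"

text \<open>Atom and body receive the same value: \<open>r(v,l,u)\<close> is the head of exactly one
  rule, so the head nogood and the support nogood make the two equivalent.\<close>

definition readout :: "nat \<Rightarrow> nat \<Rightarrow> valuation \<Rightarrow> slit set" where
  "readout n d T =
     {(At (R v l u), b) | v l u b. (v, l, u) \<in> ranges n d \<and> T (v, l, u) = code b} \<union>
     {(Bd (range_body d v l u), b) | v l u b. (v, l, u) \<in> ranges n d \<and> T (v, l, u) = code b} \<union>
     constants n d"

text \<open>Every literal in the body reveals the variable and one end of the range, and an omitted
  literal reveals that the end lies on the edge. Only when both literals are omitted is the variable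
  lost: all full ranges share the empty conjunction.\<close>

lemma range_body_eq_iff:
  assumes "1 \<le> l" "l \<le> u" "u \<le> d" "1 \<le> l'" "l' \<le> u'" "u' \<le> d"
  shows "range_body d v l u = range_body d v' l' u' \<longleftrightarrow>
    (v, l, u) = (v', l', u') \<or> l = 1 \<and> u = d \<and> l' = 1 \<and> u' = d"
  using assms unfolding range_body_def
  by (cases "1 < l"; cases "u < d"; cases "1 < l'"; cases "u' < d")
    (auto simp: doubleton_eq_iff)

lemma range_body_other:
  "range_body d v l u \<noteq> left_body v' l' u'" "range_body d v l u \<noteq> right_body v' l' u'"
  "range_body d v l u \<noteq> hall_body n l' u'"
  "range_body d v l u \<noteq> Conj {Neg Violate}" "range_body d v l u \<noteq> Conj {Neg Sat}"
  "left_body v' l' u' \<noteq> Conj {Neg Violate}" "right_body v' l' u' \<noteq> Conj {Neg Violate}"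
  "hall_body n l' u' \<noteq> Conj {Neg Violate}"
  unfolding range_body_def left_body_def right_body_def hall_body_def
  by (auto simp: doubleton_eq_iff split: if_splits)

text \<open>Opposite values for one body could only come from two different ranges with the same
  body. These are full ranges, which by assumption all have value 1.\<close>

lemma consistent_readout:
  assumes "\<And>v. v \<in> {1..n} \<Longrightarrow> T (v, 1, d) = 1"
  shows "consistent (readout n d T)"
proof -
  have False if "(v, l, u) \<in> ranges n d" "T (v, l, u) = 1" "(v', l', u') \<in> ranges n d"
    "T (v', l', u') = 2" "range_body d v l u = range_body d v' l' u'" for v l u v' l' u'
    using that assms[of v] assms[of v'] range_body_eq_iff[of l u d l' u' v v']
    by (auto simp: ranges_def)
  then show ?thesis
    unfolding consistent_def readout_def constants_def
    by (auto simp: range_body_other range_body_other[symmetric])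
qed

lemma closed_underD:
  "closed_under J T \<Longrightarrow> (X, c) \<in> J \<Longrightarrow> (\<And>f. f \<in> X \<Longrightarrow> holds T f) \<Longrightarrow> holds T c"
  by (auto simp: closed_under_def)

lemma closed_range:
  assumes "closed_under (inferences n d) T" and "(v, l, u) \<in> ranges n d"
  shows
    "T (v, l, u) = 2 \<Longrightarrow> T (v, 1, l - 1) = 2 \<Longrightarrow> T (v, u + 1, d) = 1"
    "T (v, l, u) = 2 \<Longrightarrow> T (v, u + 1, d) = 2 \<Longrightarrow> T (v, 1, l - 1) = 1"
    "T (v, 1, l - 1) = 2 \<Longrightarrow> T (v, u + 1, d) = 2 \<Longrightarrow> T (v, l, u) = 1"
    "T (v, l, u) = 1 \<Longrightarrow> T (v, 1, l - 1) = 2" "T (v, 1, l - 1) = 1 \<Longrightarrow> T (v, l, u) = 2"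
    "T (v, l, u) = 1 \<Longrightarrow> T (v, u + 1, d) = 2" "T (v, u + 1, d) = 1 \<Longrightarrow> T (v, l, u) = 2"
    "T (v, l, u) = 1 \<Longrightarrow> T (v, l - 1, u) = 1" "T (v, l - 1, u) = 2 \<Longrightarrow> T (v, l, u) = 2"
    "T (v, l, u) = 1 \<Longrightarrow> T (v, l, u + 1) = 1" "T (v, l, u + 1) = 2 \<Longrightarrow> T (v, l, u) = 2"
proof -
  have inf: "holds T (locate d (v, l, u) c)"
    if "(as, c) \<in> set clauses" "\<forall>a\<in>set as. holds T (locate d (v, l, u) a)" for as c
    using assms that unfolding closed_under_def inferences_def range_inferences_def by blast
  note rl = inf[unfolded clauses_def]
  note defs = holds_def locate_def
  show "T (v, l, u) = 2 \<Longrightarrow> T (v, 1, l - 1) = 2 \<Longrightarrow> T (v, u + 1, d) = 1"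
    using rl[of "[(Self, 2), (Below, 2)]" "(Above, 1)"] by (simp add: defs)
  show "T (v, l, u) = 2 \<Longrightarrow> T (v, u + 1, d) = 2 \<Longrightarrow> T (v, 1, l - 1) = 1"
    using rl[of "[(Self, 2), (Above, 2)]" "(Below, 1)"] by (simp add: defs)
  show "T (v, 1, l - 1) = 2 \<Longrightarrow> T (v, u + 1, d) = 2 \<Longrightarrow> T (v, l, u) = 1"
    using rl[of "[(Below, 2), (Above, 2)]" "(Self, 1)"] by (simp add: defs)
  show "T (v, l, u) = 1 \<Longrightarrow> T (v, 1, l - 1) = 2"
    using rl[of "[(Self, 1)]" "(Below, 2)"] by (simp add: defs)
  show "T (v, 1, l - 1) = 1 \<Longrightarrow> T (v, l, u) = 2"
    using rl[of "[(Below, 1)]" "(Self, 2)"] by (simp add: defs)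
  show "T (v, l, u) = 1 \<Longrightarrow> T (v, u + 1, d) = 2"
    using rl[of "[(Self, 1)]" "(Above, 2)"] by (simp add: defs)
  show "T (v, u + 1, d) = 1 \<Longrightarrow> T (v, l, u) = 2"
    using rl[of "[(Above, 1)]" "(Self, 2)"] by (simp add: defs)
  show "T (v, l, u) = 1 \<Longrightarrow> T (v, l - 1, u) = 1"
    using rl[of "[(Self, 1)]" "(Left, 1)"] by (simp add: defs)
  show "T (v, l - 1, u) = 2 \<Longrightarrow> T (v, l, u) = 2"
    using rl[of "[(Left, 2)]" "(Self, 2)"] by (simp add: defs)
  show "T (v, l, u) = 1 \<Longrightarrow> T (v, l, u + 1) = 1"
    using rl[of "[(Self, 1)]" "(Right, 1)"] by (simp add: defs)
  show "T (v, l, u + 1) = 2 \<Longrightarrow> T (v, l, u) = 2"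
    using rl[of "[(Right, 2)]" "(Self, 2)"] by (simp add: defs)
qed

lemma closed_hall:
  assumes "closed_under (inferences n d) T" and "1 \<le> l" "l \<le> u" "u \<le> d"
    and "S \<subseteq> {1..n}" "card S = u - l + 1" "w \<in> {1..n} - S" and "\<And>v. v \<in> S \<Longrightarrow> T (v, l, u) = 1"
  shows "T (w, l, u) = 2"
proof -
  have "((\<lambda>v. ((v, l, u), 1)) ` S, ((w, l, u), 2)) \<in> inferences n d"
    using assms(2-7) unfolding inferences_def hall_inferences_def by blast
  from closed_underD[OF assms(1) this] have "holds T ((w, l, u), 2)"
    by (metis (no_types, lifting) assms(8) fst_conv holds_def imageE snd_conv)
  then show ?thesis by (simp add: holds_def)
qed

lemma border_simps:
  assumes "v \<in> {1..n}" "1 \<le> d"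
  shows "border n d (v, 1, 0) = 2" "border n d (v, Suc 0, 0) = 2"
    "border n d (v, d + 1, d) = 2" "border n d (v, Suc d, d) = 2"
    "x \<in> {1..d} \<Longrightarrow> border n d (v, 0, x) = 1" "x \<in> {1..d} \<Longrightarrow> border n d (v, x, d + 1) = 1"
    "x \<in> {1..d} \<Longrightarrow> border n d (v, x, Suc d) = 1"
  using assms by (auto simp: border_def)

lemma bordered_simps:
  assumes "bordered n d T" "v \<in> {1..n}" "1 \<le> d"
  shows "T (v, 1, 0) = 2" "T (v, Suc 0, 0) = 2" "T (v, d + 1, d) = 2" "T (v, Suc d, d) = 2"
    "x \<in> {1..d} \<Longrightarrow> T (v, 0, x) = 1" "x \<in> {1..d} \<Longrightarrow> T (v, x, d + 1) = 1"
    "x \<in> {1..d} \<Longrightarrow> T (v, x, Suc d) = 1"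
  using assms border_simps[OF assms(2,3)] by (auto simp: bordered_def ranges_def)

text \<open>The places below and above \<open>[1,d]\<close> are empty ranges, which the border makes
  false, so the clause from \<open>Below\<close> and \<open>Above\<close> to \<open>Self\<close>
  applies. In the program this is the rule with the empty body.\<close>

lemma closed_full_range:
  assumes "closed_under (inferences n d) T" "bordered n d T" "v \<in> {1..n}" "1 \<le> d"
  shows "T (v, 1, d) = 1"
proof -
  have "(v, 1, d) \<in> ranges n d" using assms by (auto simp: ranges_def)
  from closed_range(3)[OF assms(1) this] show ?thesis
    using bordered_simps[OF assms(2-4)] by simp
qed

section \<open>Closed valuations give assignments closed under all nogoods\<close>

lemma nogoods_cases:
  assumes "\<nu> \<in> nogoods P"
  obtains (body) h \<beta> where "(h, \<beta>) \<in> P" "\<nu> \<in> body_nogoods \<beta>"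
  | (head) h \<beta> where "(h, \<beta>) \<in> P" "\<nu> = {(Bd \<beta>, True), (At h, False)}"
  | (support) a where "a \<in> atoms_of P" "\<nu> = insert (At a, True) {(Bd \<beta>, False) | \<beta>. (a, \<beta>) \<in> P}"
  | (bot) "\<nu> = {(At Bot, True)}"
  using assms unfolding nogoods_def by fastforce

lemma prog_cases:
  assumes "(h, \<beta>) \<in> all_different_prog n d"
  obtains (range) v l u where "(v, l, u) \<in> ranges n d" "h = R v l u" "\<beta> = range_body d v l u"
  | (left) v l u where "(v, l, u) \<in> ranges n d" "1 < l" "h = Bot" "\<beta> = left_body v l u"
  | (right) v l u where "(v, l, u) \<in> ranges n d" "u < d" "h = Bot" "\<beta> = right_body v l u"
  | (hall) l u where "1 \<le> l" "l \<le> u" "u \<le> d" "h = Violate" "\<beta> = hall_body n l u"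
  | (sat) "h = Sat" "\<beta> = Conj {Neg Violate}"
  | (violate) "h = Violate" "\<beta> = Conj {Neg Sat}"
  using assms unfolding all_different_prog_def
proof (elim UnE)
  assume "(h, \<beta>) \<in> {(R v l u, range_body d v l u) | v l u. v \<in> {1..n} \<and> 1 \<le> l \<and> l \<le> u \<and> u \<le> d}"
  then show thesis using range unfolding ranges_def by blast
next
  assume "(h, \<beta>) \<in> {(Bot, left_body v l u) | v l u. v \<in> {1..n} \<and> 1 < l \<and> l \<le> u \<and> u \<le> d}"
  then obtain v l u where "h = Bot" "\<beta> = left_body v l u" "v \<in> {1..n}" "1 < l" "l \<le> u" "u \<le> d"
    by blast
  then show thesis using left[of v l u] by (simp add: ranges_def)
next
  assume "(h, \<beta>) \<in> {(Bot, right_body v l u) | v l u. v \<in> {1..n} \<and> 1 \<le> l \<and> l \<le> u \<and> u < d}"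
  then obtain v l u where "h = Bot" "\<beta> = right_body v l u" "v \<in> {1..n}" "1 \<le> l" "l \<le> u" "u < d"
    by blast
  then show thesis using right[of v l u] by (simp add: ranges_def)
next
  assume "(h, \<beta>) \<in> {(Violate, hall_body n l u) | l u. 1 \<le> l \<and> l \<le> u \<and> u \<le> d}"
  then show thesis using hall by blast
next
  assume "(h, \<beta>) \<in> {(Sat, Conj {Neg Violate}), (Violate, Conj {Neg Sat})}"
  then show thesis using sat violate by blast
qed

lemma atoms_of_prog:
  assumes "a \<in> atoms_of (all_different_prog n d)"
  obtains v l u where "(v, l, u) \<in> ranges n d" "a = R v l u" | "a = Sat" | "a = Violate" | "a = Bot"
proof -
  from assms obtain h \<beta> where \<rho>: "(h, \<beta>) \<in> all_different_prog n d"
    "a = h \<or> a \<in> lit_atom ` body_lits \<beta>"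
    unfolding atoms_of_def by fastforce
  from \<rho>(1) have "a \<in> {R v l u | v l u. (v, l, u) \<in> ranges n d} \<union> {Sat, Violate, Bot}"
  proof (cases rule: prog_cases)
    case (range v l u)
    with \<rho>(2) show ?thesis by (auto simp: range_body_def ranges_def split: if_splits)
  next
    case (left v l u)
    with \<rho>(2) show ?thesis by (auto simp: left_body_def ranges_def)
  next
    case (right v l u)
    with \<rho>(2) show ?thesis by (auto simp: right_body_def ranges_def)
  next
    case (hall l u)
    with \<rho>(2) show ?thesis by (auto simp: hall_body_def ranges_def)
  qed (use \<rho>(2) in auto)
  then show thesis using that by blast
qed

lemma prog_range_iff:
  "(R v l u, \<beta>) \<in> all_different_prog n d \<longleftrightarrow> (v, l, u) \<in> ranges n d \<and> \<beta> = range_body d v l u"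
proof
  assume "(R v l u, \<beta>) \<in> all_different_prog n d"
  then show "(v, l, u) \<in> ranges n d \<and> \<beta> = range_body d v l u" by (cases rule: prog_cases) auto
next
  assume "(v, l, u) \<in> ranges n d \<and> \<beta> = range_body d v l u"
  then show "(R v l u, \<beta>) \<in> all_different_prog n d"
    unfolding all_different_prog_def ranges_def by blast
qed

lemma ranges_in_atoms_of: "(v, l, u) \<in> ranges n d \<Longrightarrow> R v l u \<in> atoms_of (all_different_prog n d)"
  using prog_range_iff[of v l u "range_body d v l u" n d] unfolding atoms_of_def
  by (metis UnI1 fst_conv image_eqI)

lemma hall_literals: "{Pos (R v l u) | v. v \<in> {1..n}} = (\<lambda>v. Pos (R v l u)) ` {1..n}"
  by auto

lemma card_hall_literals: "card ((\<lambda>v. Pos (R v l u)) ` S) = card S"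
  by (intro card_image inj_onI) simp

text \<open>For a range that touches an edge, the border value stands in for the omitted literal. In
  the first two facts the other neighbour must lie inside the triangle: otherwise a clause would
  force value 1 on an empty range, whose border value is 2.\<close>

lemma inferred_values:
  assumes "closed_under (inferences n d) T" "bordered n d T" "1 \<le> d" "(v, l, u) \<in> ranges n d"
  shows "T (v, l, u) = 2 \<Longrightarrow> l = 1 \<Longrightarrow> u < d \<and> T (v, u + 1, d) = 1"
    "T (v, l, u) = 2 \<Longrightarrow> u = d \<Longrightarrow> 1 < l \<and> T (v, 1, l - 1) = 1"
    "T (v, 1, l - 1) = 2 \<Longrightarrow> u = d \<Longrightarrow> T (v, l, u) = 1"
    "T (v, u + 1, d) = 2 \<Longrightarrow> l = 1 \<Longrightarrow> T (v, l, u) = 1"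
    "l = 1 \<Longrightarrow> u = d \<Longrightarrow> T (v, l, u) = 1"
proof -
  have v: "v \<in> {1..n}" and lu: "1 \<le> l" "l \<le> u" "u \<le> d" using assms(4) by (auto simp: ranges_def)
  note b = bordered_simps[OF assms(2) v assms(3)]
  note c = closed_range[OF assms(1,4)]
  show "T (v, l, u) = 2 \<Longrightarrow> l = 1 \<Longrightarrow> u < d \<and> T (v, u + 1, d) = 1"
    using c(1) b lu by (cases "u = d") auto
  show "T (v, l, u) = 2 \<Longrightarrow> u = d \<Longrightarrow> 1 < l \<and> T (v, 1, l - 1) = 1"
    using c(2) b lu by (cases "l = 1") auto
  show "T (v, 1, l - 1) = 2 \<Longrightarrow> u = d \<Longrightarrow> T (v, l, u) = 1" using c(3) b by auto
  show "T (v, u + 1, d) = 2 \<Longrightarrow> l = 1 \<Longrightarrow> T (v, l, u) = 1" using c(3) b by auto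
  show "l = 1 \<Longrightarrow> u = d \<Longrightarrow> T (v, l, u) = 1" using c(3) b by auto
qed

lemma readout_range [simp]:
  "(At (R v l u), b) \<in> readout n d T \<longleftrightarrow> (v, l, u) \<in> ranges n d \<and> T (v, l, u) = code b"
  unfolding readout_def constants_def by auto

lemma readout_range_body:
  assumes "\<And>v. v \<in> {1..n} \<Longrightarrow> T (v, 1, d) = 1" and "(v, l, u) \<in> ranges n d"
  shows "(Bd (range_body d v l u), b) \<in> readout n d T \<longleftrightarrow> T (v, l, u) = code b"
proof
  assume "(Bd (range_body d v l u), b) \<in> readout n d T"
  then obtain v' l' u' where "(v', l', u') \<in> ranges n d" "T (v', l', u') = code b"
    "range_body d v l u = range_body d v' l' u'"
    unfolding readout_def constants_def by (auto simp: range_body_other)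
  then show "T (v, l, u) = code b"
    using assms assms(1)[of v'] range_body_eq_iff[of l u d l' u' v v'] by (auto simp: ranges_def)
qed (use assms(2) in \<open>auto simp: readout_def\<close>)

lemma unit_closed_iff:
  "unit_closed B \<nu> \<longleftrightarrow> (\<forall>\<delta>\<in>\<nu>. (\<forall>\<sigma>\<in>\<nu>. \<sigma> \<noteq> \<delta> \<longrightarrow> \<sigma> \<in> B) \<longrightarrow> compl \<delta> \<in> B)"
  unfolding unit_closed_def by blast

lemma unit_closed_pair:
  assumes "x \<noteq> y" and "x \<in> B \<Longrightarrow> compl y \<in> B" and "y \<in> B \<Longrightarrow> compl x \<in> B"
  shows "unit_closed B {x, y}"
  using assms by (auto simp: unit_closed_iff)

lemma unit_closed_triple:
  assumes "x \<noteq> y" "x \<noteq> z" "y \<noteq> z" and "x \<in> B \<Longrightarrow> y \<in> B \<Longrightarrow> compl z \<in> B"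
    and "x \<in> B \<Longrightarrow> z \<in> B \<Longrightarrow> compl y \<in> B" and "y \<in> B \<Longrightarrow> z \<in> B \<Longrightarrow> compl x \<in> B"
  shows "unit_closed B {x, y, z}"
  using assms by (auto simp: unit_closed_iff)

text \<open>Nogoods that contain the complement of a constant are satisfied outright. In each of the
  others a unit step amounts, once constants are removed and bodies of ranges are identified with
  their atoms, to one of the inferences.\<close>

lemma unit_closed_readout:
  assumes cl: "closed_under (inferences n d) T" and bd: "bordered n d T" and "1 \<le> n" "1 \<le> d"
    and \<nu>: "\<nu> \<in> nogoods (all_different_prog n d)"
  shows "unit_closed (readout n d T) \<nu> \<and> \<nu> \<noteq> {}"
proof -
  let ?B = "readout n d T"
  have full: "T (v, 1, d) = 1" if "v \<in> {1..n}" for v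
    using closed_full_range[OF cl bd that \<open>1 \<le> d\<close>] .
  then have con: "consistent ?B" by (rule consistent_readout)
  have rbody: "(Bd (range_body d v l u), b) \<in> ?B \<longleftrightarrow> T (v, l, u) = code b"
    if "(v, l, u) \<in> ranges n d" for v l u b
    using full that by (rule readout_range_body)
  have const: "\<sigma> \<in> constants n d \<Longrightarrow> \<sigma> \<in> ?B" for \<sigma> by (simp add: readout_def)
  have satisfied: "unit_closed ?B \<nu> \<and> \<nu> \<noteq> {}" if "\<delta> \<in> \<nu>" "compl \<delta> \<in> constants n d" for \<delta>
    using unit_closed_satisfied[OF con that(1) const[OF that(2)]] that(1) by auto
  from \<nu> show ?thesis
  proof (cases rule: nogoods_cases)
    case (body h \<beta>)
    from body(1) show ?thesis
    proof (cases rule: prog_cases)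
      case (range v l u)
      note c = closed_range[OF cl range(1)] inferred_values[OF cl bd \<open>1 \<le> d\<close> range(1)]
      have r: "(v, 1, l - 1) \<in> ranges n d" if "1 < l" using range(1) that by (auto simp: ranges_def)
      have r': "(v, u + 1, d) \<in> ranges n d" if "u < d" using range(1) that by (auto simp: ranges_def)
      have lu: "l = 1 \<or> 1 < l" "u = d \<or> u < d" using range(1) by (auto simp: ranges_def)
      note rb = rbody[OF range(1)]
      have "\<exists>L. range_body d v l u = Conj L" by (simp add: range_body_def)
      then obtain L where L: "range_body d v l u = Conj L" by blast
      have L': "L = (if 1 < l then {Neg (R v 1 (l - 1))} else {}) \<union>
           (if u < d then {Neg (R v (u + 1) d)} else {})"
        using L by (simp add: range_body_def)
      have rbL: "(Bd (Conj L), b) \<in> ?B \<longleftrightarrow> T (v, l, u) = code b" for b using rb L by simp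
      \<comment> \<open>The body has no, one or two literals, depending on which edges the range
        touches; the nogood accordingly has one, two or three elements.\<close>
      have "unit_closed ?B (insert (Bd (Conj L), False) (slit ` L))"
        using lu
      proof (elim disjE)
        assume lu: "l = 1" "u = d"
        have "L = {}" using lu L' by simp
        moreover have "(Bd (Conj L), True) \<in> ?B" using lu c(16) by (simp add: rbL)
        ultimately show ?thesis by (simp add: unit_closed_iff)
      next
        assume lu: "l = 1" "u < d"
        then have "slit ` L = {(At (R v (u + 1) d), False)}" using L' by simp
        moreover have "unit_closed ?B {(Bd (Conj L), False), (At (R v (u + 1) d), False)}"
          by (rule unit_closed_pair) (simp, use lu c(12) r' in \<open>simp add: rbL\<close>, use lu c(15) in \<open>simp add: rbL\<close>)
        ultimately show ?thesis by simp
      next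
        assume lu: "1 < l" "u = d"
        then have "slit ` L = {(At (R v 1 (l - 1)), False)}" using L' by simp
        moreover have "unit_closed ?B {(Bd (Conj L), False), (At (R v 1 (l - 1)), False)}"
          by (rule unit_closed_pair) (simp, use lu c(13) r in \<open>simp add: rbL\<close>, use lu c(14) in \<open>simp add: rbL\<close>)
        ultimately show ?thesis by simp
      next
        assume lu: "1 < l" "u < d"
        then have "slit ` L = {(At (R v 1 (l - 1)), False), (At (R v (u + 1) d), False)}"
          using L' by auto
        moreover have "unit_closed ?B
            {(Bd (Conj L), False), (At (R v 1 (l - 1)), False), (At (R v (u + 1) d), False)}"
          using range(1)
          by (intro unit_closed_triple) (simp, simp, force simp: ranges_def,
            use lu c(1) r' in \<open>simp add: rbL\<close>, use lu c(2) r in \<open>simp add: rbL\<close>, use c(3) in \<open>simp add: rbL\<close>)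
        ultimately show ?thesis by simp
      qed
      moreover have "unit_closed ?B {(Bd (Conj L), True), compl (slit \<l>)}" if "\<l> \<in> L" for \<l>
      proof -
        from that L' consider "1 < l" "\<l> = Neg (R v 1 (l - 1))" | "u < d" "\<l> = Neg (R v (u + 1) d)"
          by (auto split: if_splits)
        then show ?thesis
        proof cases
          case 1
          have "unit_closed ?B {(Bd (Conj L), True), (At (R v 1 (l - 1)), True)}"
            by (rule unit_closed_pair) (simp, use 1(1) c(4) r in \<open>simp add: rbL\<close>, use c(5) in \<open>simp add: rbL\<close>)
          with 1 show ?thesis by simp
        next
          case 2
          have "unit_closed ?B {(Bd (Conj L), True), (At (R v (u + 1) d), True)}"
            by (rule unit_closed_pair) (simp, use 2(1) c(6) r' in \<open>simp add: rbL\<close>, use c(7) in \<open>simp add: rbL\<close>)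
          with 2 show ?thesis by simp
        qed
      qed
      ultimately show ?thesis using body(2) unfolding range(3) L by auto
    next
      case (left v l u)
      have r: "(v, l - 1, u) \<in> ranges n d" using left by (auto simp: ranges_def)
      have "(Bd (left_body v l u), False) \<in> constants n d"
        using left by (auto simp: constants_def ranges_def)
      then have s: ?thesis if "(Bd (left_body v l u), True) \<in> \<nu>" using satisfied[OF that] by simp
      have B: "(Bd (left_body v l u), True) \<notin> ?B"
        using con const[OF \<open>(Bd (left_body v l u), False) \<in> constants n d\<close>] by (auto simp: consistent_def)
      have "unit_closed ?B
        {(Bd (left_body v l u), False), (At (R v l u), True), (At (R v (l - 1) u), False)}"
        by (intro unit_closed_triple)
          (use left(1,2) in \<open>simp, simp, force simp: ranges_def\<close>,
            use closed_range(8)[OF cl left(1)] r in simp, use closed_range(9)[OF cl left(1)] left(1) in simp, use closed_range(8)[OF cl left(1)] in simp)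
      then show ?thesis using body(2) s unfolding left(4) by (auto simp: left_body_def)
    next
      case (right v l u)
      have r: "(v, l, u + 1) \<in> ranges n d" using right by (auto simp: ranges_def)
      have "(Bd (right_body v l u), False) \<in> constants n d"
        using right by (auto simp: constants_def ranges_def)
      then have s: ?thesis if "(Bd (right_body v l u), True) \<in> \<nu>" using satisfied[OF that] by simp
      have B: "(Bd (right_body v l u), True) \<notin> ?B"
        using con const[OF \<open>(Bd (right_body v l u), False) \<in> constants n d\<close>] by (auto simp: consistent_def)
      have "unit_closed ?B
        {(Bd (right_body v l u), False), (At (R v l u), True), (At (R v l (u + 1)), False)}"
        by (intro unit_closed_triple)
          (use right(1,2) in \<open>simp, simp, force simp: ranges_def\<close>,
            use closed_range(10)[OF cl right(1)] r in simp, use closed_range(11)[OF cl right(1)] right(1) in simp, use closed_range(10)[OF cl right(1)] in simp)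
      then show ?thesis using body(2) s unfolding right(4) by (auto simp: right_body_def)
    next
      case (hall l u)
      have "(Bd (hall_body n l u), False) \<in> constants n d"
        using hall by (auto simp: constants_def)
      then have s: ?thesis if "(Bd (hall_body n l u), True) \<in> \<nu>" using satisfied[OF that] by simp
      \<comment> \<open>Leaving out \<open>w\<close>, the one atom not known to be true, turns the
        \<open>u - l + 2\<close> variables of the nogood into the \<open>u - l + 1\<close>
        antecedents of a Hall inference.\<close>
      have key: "T (w, l, u) = 2"
        if "S \<subseteq> {1..n}" "card S = u - l + 2" "w \<in> S" "\<And>v. v \<in> S \<Longrightarrow> v \<noteq> w \<Longrightarrow> T (v, l, u) = 1" for S w
      proof (rule closed_hall[OF cl hall(1-3), of "S - {w}"])
        show "card (S - {w}) = u - l + 1" using that(2,3) by simp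
      qed (use that in auto)
      have "unit_closed ?B (insert (Bd (hall_body n l u), False) (slit ` S))"
        if S: "S \<subseteq> {Pos (R v l u) | v. v \<in> {1..n}}" "card S = u - l + 2" for S
      proof -
        obtain S' where S': "S' \<subseteq> {1..n}" "S = (\<lambda>v. Pos (R v l u)) ` S'"
          using S(1) unfolding hall_literals by (rule subset_imageE)
        have card: "card S' = u - l + 2" using S(2) S'(2) card_hall_literals by simp
        have "S' \<noteq> {}" using card by auto
        then obtain w0 where w0: "w0 \<in> S'" by blast
        show ?thesis
          unfolding unit_closed_def
        proof (intro ballI impI)
          fix \<delta> assume \<delta>: "\<delta> \<in> insert (Bd (hall_body n l u), False) (slit ` S)"
            "insert (Bd (hall_body n l u), False) (slit ` S) - {\<delta>} \<subseteq> ?B"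
          have true: "T (v, l, u) = 1" if "v \<in> S'" "(At (R v l u), True) \<noteq> \<delta>" for v
          proof -
            have "(At (R v l u), True) \<in> slit ` S" using that(1) unfolding S'(2) image_image by simp
            then have "(At (R v l u), True) \<in> ?B" using \<delta>(2) that(2) by blast
            then show ?thesis by simp
          qed
          show "compl \<delta> \<in> ?B"
          proof (cases "\<delta> = (Bd (hall_body n l u), False)")
            \<comment> \<open>The body literal cannot be the missing element: all
              \<open>u - l + 2\<close> atoms would be true, and a Hall inference would make one of
              them false as well.\<close>
            case True
            then have "T (v, l, u) = 1" if "v \<in> S'" for v using true[OF that] by simp
            with key[OF S'(1) card w0] w0 show ?thesis by fastforce
          next
            case False
            then obtain w where w: "w \<in> S'" "\<delta> = (At (R w l u), True)" using \<delta>(1) S'(2) by auto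
            then have "T (v, l, u) = 1" if "v \<in> S'" "v \<noteq> w" for v using true[OF that(1)] that(2) by simp
            from key[OF S'(1) card w(1) this] show ?thesis
              using w hall S'(1) by (auto simp: ranges_def)
          qed
        qed
      qed
      then show ?thesis using body(2) s unfolding hall(5) by (auto simp: hall_body_def)
    next
      case sat
      with body(2) show ?thesis using satisfied[of "(Bd (Conj {Neg Violate}), False)"]
        satisfied[of "(At Violate, True)"] by (auto simp: constants_def)
    next
      case violate
      with body(2) show ?thesis using satisfied[of "(At Sat, False)"]
        satisfied[of "(Bd (Conj {Neg Sat}), True)"] by (auto simp: constants_def)
    qed
  next
    case (head h \<beta>)
    from head(1) show ?thesis
    proof (cases rule: prog_cases)
      case (range v l u)
      have "unit_closed ?B \<nu>"
        unfolding head(2)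
        by (rule unit_closed_pair) (use range(1) rbody[OF range(1)] in \<open>simp_all add: range(2,3)\<close>)
      then show ?thesis using head(2) by simp
    next
      case (left v l u)
      then have "(Bd \<beta>, False) \<in> constants n d" by (auto simp: constants_def ranges_def)
      then show ?thesis using head(2) satisfied[of "(Bd \<beta>, True)"] by simp
    next
      case (right v l u)
      then have "(Bd \<beta>, False) \<in> constants n d" by (auto simp: constants_def ranges_def)
      then show ?thesis using head(2) satisfied[of "(Bd \<beta>, True)"] by simp
    next
      case (hall l u)
      then have "(Bd \<beta>, False) \<in> constants n d" by (auto simp: constants_def)
      then show ?thesis using head(2) satisfied[of "(Bd \<beta>, True)"] by simp
    next
      case sat
      have "(At Sat, True) \<in> constants n d" by (simp add: constants_def)
      then show ?thesis using head(2) sat satisfied[of "(At Sat, False)"] by simp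
    next
      case violate
      then have "(Bd \<beta>, False) \<in> constants n d" by (simp add: constants_def)
      then show ?thesis using head(2) satisfied[of "(Bd \<beta>, True)"] by simp
    qed
  next
    case (support a)
    from support(1) show ?thesis
    proof (cases rule: atoms_of_prog)
      case (1 v l u)
      then have eq: "\<nu> = {(At a, True), (Bd (range_body d v l u), False)}"
        using support(2) by (simp add: prog_range_iff)
      have "unit_closed ?B \<nu>"
        unfolding eq by (rule unit_closed_pair) (use 1(1) rbody[OF 1(1)] in \<open>simp_all add: 1(2)\<close>)
      then show ?thesis using eq by simp
    next
      case 2
      have "(Sat, Conj {Neg Violate}) \<in> all_different_prog n d" by (simp add: all_different_prog_def)
      then have "(Bd (Conj {Neg Violate}), False) \<in> \<nu>" using 2 support(2) by blast
      then show ?thesis using satisfied by (simp add: constants_def)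
    next
      case 3
      then have "(At a, False) \<in> constants n d" by (simp add: constants_def)
      then show ?thesis using support(2) satisfied[of "(At a, True)"] by simp
    next
      case 4
      then have "(At a, False) \<in> constants n d" by (simp add: constants_def)
      then show ?thesis using support(2) satisfied[of "(At a, True)"] by simp
    qed
  next
    case bot
    have "(At Bot, False) \<in> constants n d" by (simp add: constants_def)
    then show ?thesis using bot satisfied[of "(At Bot, True)"] by simp
  qed
qed

text \<open>The fixpoint is the least set that contains the start and is closed under the nogoods,
  and the readout is such a set. Since the readout is also consistent, no nogood fits inside
  it.\<close>

lemma unit_prop_subset_readout:
  assumes "closed_under (inferences n d) T" "bordered n d T" "1 \<le> n" "1 \<le> d" and "A \<subseteq> readout n d T"
  defines "N \<equiv> nogoods (all_different_prog n d)"
  shows "unit_prop N A \<subseteq> readout n d T" "\<not> conflict N (unit_prop N A)"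
proof -
  note uc = unit_closed_readout[OF assms(1-4), folded N_def]
  show sub: "unit_prop N A \<subseteq> readout n d T"
    by (rule unit_prop_least[OF assms(5)]) (use uc in blast)
  have "consistent (readout n d T)"
    using closed_full_range[OF assms(1,2)] assms(4) by (intro consistent_readout)
  then show "\<not> conflict N (unit_prop N A)"
    using uc by (rule no_conflict_if_unit_closed[OF _ sub])
qed

section \<open>Conflict-free fixpoints give closed valuations\<close>

lemma nogood_body: "(h, \<beta>) \<in> P \<Longrightarrow> \<nu> \<in> body_nogoods \<beta> \<Longrightarrow> \<nu> \<in> nogoods P"
  unfolding nogoods_def by force

lemma nogood_head: "(h, \<beta>) \<in> P \<Longrightarrow> {(Bd \<beta>, True), (At h, False)} \<in> nogoods P"
  unfolding nogoods_def by blast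

lemma nogood_support:
  "a \<in> atoms_of P \<Longrightarrow> insert (At a, True) {(Bd \<beta>, False) | \<beta>. (a, \<beta>) \<in> P} \<in> nogoods P"
  unfolding nogoods_def by blast

lemma nogood_bot: "{(At Bot, True)} \<in> nogoods P"
  unfolding nogoods_def by blast

lemma prog_intros:
  "(v, l, u) \<in> ranges n d \<Longrightarrow> (R v l u, range_body d v l u) \<in> all_different_prog n d"
  "(v, l, u) \<in> ranges n d \<Longrightarrow> 1 < l \<Longrightarrow> (Bot, left_body v l u) \<in> all_different_prog n d"
  "(v, l, u) \<in> ranges n d \<Longrightarrow> u < d \<Longrightarrow> (Bot, right_body v l u) \<in> all_different_prog n d"
  "1 \<le> l \<Longrightarrow> l \<le> u \<Longrightarrow> u \<le> d \<Longrightarrow> (Violate, hall_body n l u) \<in> all_different_prog n d"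
  "(Sat, Conj {Neg Violate}) \<in> all_different_prog n d"
  "(Violate, Conj {Neg Sat}) \<in> all_different_prog n d"
       apply (simp add: prog_range_iff)
      apply (force simp: all_different_prog_def ranges_def)
     apply (force simp: all_different_prog_def ranges_def)
    apply (unfold all_different_prog_def, blast)
   apply blast
  apply blast
  done

definition shown :: "nat \<Rightarrow> nat \<Rightarrow> slit set \<Rightarrow> valuation" where
  "shown n d A = (\<lambda>(v, l, u).
     if (v, l, u) \<in> ranges n d then truth_code A (At (R v l u)) else border n d (v, l, u))"

lemma bordered_shown: "bordered n d (shown n d A)"
  by (simp add: bordered_def shown_def split: prod.split)

lemma constants_bodies:
  "(v, l, u) \<in> ranges n d \<Longrightarrow> 1 < l \<Longrightarrow> (Bd (left_body v l u), False) \<in> constants n d"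
  "(v, l, u) \<in> ranges n d \<Longrightarrow> u < d \<Longrightarrow> (Bd (right_body v l u), False) \<in> constants n d"
  "1 \<le> l \<Longrightarrow> l \<le> u \<Longrightarrow> u \<le> d \<Longrightarrow> (Bd (hall_body n l u), False) \<in> constants n d"
  unfolding constants_def ranges_def by blast+

text \<open>\<open>A\<close> is the initial assignment at the root and the previous fixpoint with a
  decided literal later on. Hence only its consistency is assumed, together with what is known of
  the fixpoint itself.\<close>

locale conflict_free_fixpoint =
  fixes n d :: nat and N U A
  defines "N \<equiv> nogoods (all_different_prog n d)" and "U \<equiv> unit_prop N A"
  assumes d: "1 \<le> d"
    and start_consistent: "consistent A"
    and not_violate: "(At Violate, False) \<in> U"
    and no_conflict: "\<not> conflict N U"
begin

lemma step: "\<nu> \<in> N \<Longrightarrow> \<delta> \<in> \<nu> \<Longrightarrow> \<nu> - {\<delta>} \<subseteq> U \<Longrightarrow> compl \<delta> \<in> U"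
  using unit_closed_unit_prop[of \<nu> N A] unfolding U_def unit_closed_def by blast

lemma program_nogoods:
  "(h, \<beta>) \<in> all_different_prog n d \<Longrightarrow> {(Bd \<beta>, True), (At h, False)} \<in> N"
  "(h, \<beta>) \<in> all_different_prog n d \<Longrightarrow> \<nu> \<in> body_nogoods \<beta> \<Longrightarrow> \<nu> \<in> N"
  "{(At Bot, True)} \<in> N"
  unfolding N_def by (simp_all add: nogood_head nogood_body nogood_bot)

lemma step_single: "{x} \<in> N \<Longrightarrow> compl x \<in> U"
  by (rule step) auto

lemma step_pair: "{x, y} \<in> N \<Longrightarrow> x \<in> U \<Longrightarrow> compl y \<in> U" "{x, y} \<in> N \<Longrightarrow> y \<in> U \<Longrightarrow> compl x \<in> U"
  by (rule step[of "{x, y}"]; auto)+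

lemma step_triple:
  "{x, y, z} \<in> N \<Longrightarrow> x \<in> U \<Longrightarrow> y \<in> U \<Longrightarrow> compl z \<in> U"
  "{x, y, z} \<in> N \<Longrightarrow> x \<in> U \<Longrightarrow> z \<in> U \<Longrightarrow> compl y \<in> U"
  "{x, y, z} \<in> N \<Longrightarrow> y \<in> U \<Longrightarrow> z \<in> U \<Longrightarrow> compl x \<in> U"
  by (rule step[of "{x, y, z}"]; auto)+

lemma consistent: "consistent U"
  using consistent_unit_prop[OF start_consistent] no_conflict unfolding U_def by blast

text \<open>A rule with a false head has a false body. This settles all rules with head
  \<open>\<bottom>\<close> or \<open>violate(c)\<close>, while the falsity of
  \<open>violate(c)\<close> makes the body of \<open>sat(c)\<close> and then \<open>sat(c)\<close>
  true.\<close>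

lemma constants_derived: "constants n d \<subseteq> U"
proof -
  have bot: "(At Bot, False) \<in> U" using step_single[OF program_nogoods(3)] by simp
  have head: "(Bd \<beta>, False) \<in> U" if "(h, \<beta>) \<in> all_different_prog n d" "(At h, False) \<in> U" for h \<beta>
    using step_pair(2)[OF program_nogoods(1)[OF that(1)] that(2)] by simp
  have nv: "(Bd (Conj {Neg Violate}), True) \<in> U"
  proof -
    have "{(Bd (Conj {Neg Violate}), False), (At Violate, False)} \<in> N"
      by (rule program_nogoods(2)[OF prog_intros(5)]) simp
    from step_pair(2)[OF this not_violate] show ?thesis by simp
  qed
  have sat: "(At Sat, True) \<in> U"
    using step_pair(1)[OF program_nogoods(1)[OF prog_intros(5)] nv] by simp
  have ns: "(Bd (Conj {Neg Sat}), False) \<in> U"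
    using head[OF prog_intros(6) not_violate] .
  have left: "(Bd (left_body v l u), False) \<in> U" if "v \<in> {1..n}" "1 < l" "l \<le> u" "u \<le> d" for v l u
    using head[OF prog_intros(2) bot] that by (simp add: ranges_def)
  have right: "(Bd (right_body v l u), False) \<in> U" if "v \<in> {1..n}" "1 \<le> l" "l \<le> u" "u < d" for v l u
    using head[OF prog_intros(3) bot] that by (simp add: ranges_def)
  have hall: "(Bd (hall_body n l u), False) \<in> U" if "1 \<le> l" "l \<le> u" "u \<le> d" for l u
    using head[OF prog_intros(4)[OF that] not_violate] .
  show ?thesis
    unfolding constants_def using bot not_violate nv sat ns left right hall by blast
qed

text \<open>Since the atom has a single rule, its support nogood is a pair, like the head nogood;
  the two pairs are the two halves of an equivalence.\<close>

lemma range_body_derived: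
  assumes "(v, l, u) \<in> ranges n d"
  shows "(Bd (range_body d v l u), b) \<in> U \<longleftrightarrow> (At (R v l u), b) \<in> U"
proof -
  have "insert (At (R v l u), True) {(Bd \<beta>, False) | \<beta>. (R v l u, \<beta>) \<in> all_different_prog n d} =
    {(At (R v l u), True), (Bd (range_body d v l u), False)}"
    using assms by (simp add: prog_range_iff)
  then have s: "{(At (R v l u), True), (Bd (range_body d v l u), False)} \<in> N"
    using nogood_support[OF ranges_in_atoms_of[OF assms]] by (simp add: N_def)
  note h = program_nogoods(1)[OF prog_intros(1)[OF assms]]
  show ?thesis
    using step_pair[OF s] step_pair[OF h] by (cases b) auto
qed

abbreviation "V \<equiv> shown n d U"

lemma shown_iff:
  assumes "(v, l, u) \<in> ranges n d"
  shows "V (v, l, u) = code b \<longleftrightarrow> (At (R v l u), b) \<in> U"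
  using assms consistent by (cases b) (auto simp: shown_def truth_code_def consistent_def)

text \<open>Translates border values back into omitted literals: a condition that the border
  satisfies becomes an implication from \<open>1 < l\<close> or \<open>u < d\<close>, one that it
  violates becomes a conjunction.\<close>

lemma shown_neighbours:
  assumes r: "(v, l, u) \<in> ranges n d"
  shows "V (v, 1, l - 1) = 2 \<longleftrightarrow> (1 < l \<longrightarrow> (At (R v 1 (l - 1)), False) \<in> U)"
    "V (v, 1, l - 1) = 1 \<longleftrightarrow> 1 < l \<and> (At (R v 1 (l - 1)), True) \<in> U"
    "V (v, u + 1, d) = 2 \<longleftrightarrow> (u < d \<longrightarrow> (At (R v (u + 1) d), False) \<in> U)"
    "V (v, u + 1, d) = 1 \<longleftrightarrow> u < d \<and> (At (R v (u + 1) d), True) \<in> U"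
    "V (v, l - 1, u) = 2 \<longleftrightarrow> 1 < l \<and> (At (R v (l - 1) u), False) \<in> U"
    "V (v, l - 1, u) = 1 \<longleftrightarrow> (1 < l \<longrightarrow> (At (R v (l - 1) u), True) \<in> U)"
    "V (v, l, u + 1) = 2 \<longleftrightarrow> u < d \<and> (At (R v l (u + 1)), False) \<in> U"
    "V (v, l, u + 1) = 1 \<longleftrightarrow> (u < d \<longrightarrow> (At (R v l (u + 1)), True) \<in> U)"
proof -
  have v: "v \<in> {1..n}" and lu: "1 \<le> l" "l \<le> u" "u \<le> d" using r by (auto simp: ranges_def)
  note b = bordered_simps[OF bordered_shown[of n d U] v d]
  have l: "1 < l \<or> l = 1" and u: "u < d \<or> u = d" using lu by auto
  have below: "(v, 1, l - 1) \<in> ranges n d" "(v, l - 1, u) \<in> ranges n d" if "1 < l"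
    using v lu that by (auto simp: ranges_def)
  have above: "(v, u + 1, d) \<in> ranges n d" "(v, l, u + 1) \<in> ranges n d" if "u < d"
    using v lu that by (auto simp: ranges_def)
  show "V (v, 1, l - 1) = 2 \<longleftrightarrow> (1 < l \<longrightarrow> (At (R v 1 (l - 1)), False) \<in> U)"
    "V (v, 1, l - 1) = 1 \<longleftrightarrow> 1 < l \<and> (At (R v 1 (l - 1)), True) \<in> U"
    "V (v, l - 1, u) = 2 \<longleftrightarrow> 1 < l \<and> (At (R v (l - 1) u), False) \<in> U"
    "V (v, l - 1, u) = 1 \<longleftrightarrow> (1 < l \<longrightarrow> (At (R v (l - 1) u), True) \<in> U)"
    using l b lu shown_iff[OF below(1), of True] shown_iff[OF below(1), of False]
      shown_iff[OF below(2), of True] shown_iff[OF below(2), of False] by auto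
  show "V (v, u + 1, d) = 2 \<longleftrightarrow> (u < d \<longrightarrow> (At (R v (u + 1) d), False) \<in> U)"
    "V (v, u + 1, d) = 1 \<longleftrightarrow> u < d \<and> (At (R v (u + 1) d), True) \<in> U"
    "V (v, l, u + 1) = 2 \<longleftrightarrow> u < d \<and> (At (R v l (u + 1)), False) \<in> U"
    "V (v, l, u + 1) = 1 \<longleftrightarrow> (u < d \<longrightarrow> (At (R v l (u + 1)), True) \<in> U)"
    using u b lu shown_iff[OF above(1), of True] shown_iff[OF above(1), of False]
      shown_iff[OF above(2), of True] shown_iff[OF above(2), of False] by auto
qed

lemma range_steps:
  assumes r: "(v, l, u) \<in> ranges n d"
  defines "s \<equiv> \<lambda>b. (At (R v l u), b)" and "p \<equiv> \<lambda>b. (At (R v 1 (l - 1)), b)"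
    and "q \<equiv> \<lambda>b. (At (R v (u + 1) d), b)"
  shows "s False \<in> U \<Longrightarrow> (1 < l \<longrightarrow> p False \<in> U) \<Longrightarrow> u < d \<and> q True \<in> U"
    "s False \<in> U \<Longrightarrow> (u < d \<longrightarrow> q False \<in> U) \<Longrightarrow> 1 < l \<and> p True \<in> U"
    "(1 < l \<longrightarrow> p False \<in> U) \<Longrightarrow> (u < d \<longrightarrow> q False \<in> U) \<Longrightarrow> s True \<in> U"
    "s True \<in> U \<Longrightarrow> (1 < l \<longrightarrow> p False \<in> U)" "1 < l \<and> p True \<in> U \<Longrightarrow> s False \<in> U"
    "s True \<in> U \<Longrightarrow> (u < d \<longrightarrow> q False \<in> U)" "u < d \<and> q True \<in> U \<Longrightarrow> s False \<in> U"
proof -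
  define \<beta> where "\<beta> = range_body d v l u"
  define L where "L = (if 1 < l then {Neg (R v 1 (l - 1))} else {}) \<union>
           (if u < d then {Neg (R v (u + 1) d)} else {})"
  have \<beta>: "\<beta> = Conj L" by (simp add: \<beta>_def L_def range_body_def)
  have body: "(Bd \<beta>, b) \<in> U \<longleftrightarrow> s b \<in> U" for b
    using range_body_derived[OF r] by (simp add: \<beta>_def s_def)
  have slits: "slit ` L = (if 1 < l then {p False} else {}) \<union> (if u < d then {q False} else {})"
    by (auto simp: L_def p_def q_def)
  have [simp]: "compl (p b) = p (\<not> b)" "compl (q b) = q (\<not> b)" for b by (simp_all add: p_def q_def)
  note ng = program_nogoods(2)[OF prog_intros(1)[OF r], folded \<beta>_def, unfolded \<beta> body_nogoods.simps]
  have all: "insert (Bd \<beta>, False) (slit ` L) \<in> N"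
    using ng by (simp add: \<beta>)
  have sub: "slit ` L \<subseteq> U" if "1 < l \<longrightarrow> p False \<in> U" "u < d \<longrightarrow> q False \<in> U"
    using that slits by (auto split: if_splits)
  show "s True \<in> U" if "1 < l \<longrightarrow> p False \<in> U" "u < d \<longrightarrow> q False \<in> U"
    using step[OF all, of "(Bd \<beta>, False)"] body[of True] sub[OF that] by auto
  \<comment> \<open>A false body with all its literals true would be a violated nogood. Hence some
    literal must remain undetermined by the assumptions below, which is where \<open>u < d\<close>
    and \<open>1 < l\<close> come from.\<close>
  have no: "\<not> (s False \<in> U \<and> slit ` L \<subseteq> U)"
  proof -
    have "\<not> insert (Bd \<beta>, False) (slit ` L) \<subseteq> U"
      using no_conflict all unfolding conflict_def by metis
    then show ?thesis using body[of False] by simp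
  qed
  show "u < d \<and> q True \<in> U" if "s False \<in> U" "1 < l \<longrightarrow> p False \<in> U"
  proof -
    have "u < d" using no sub that by blast
    moreover have "slit ` L \<subseteq> insert (q False) U"
      using that(2) unfolding slits by (cases "1 < l"; cases "u < d"; simp)
    then have "insert (Bd \<beta>, False) (slit ` L) - {q False} \<subseteq> U"
      using that(1) body[of False] by blast
    ultimately show ?thesis using step[OF all, of "q False"] slits by simp
  qed
  show "1 < l \<and> p True \<in> U" if "s False \<in> U" "u < d \<longrightarrow> q False \<in> U"
  proof -
    have "1 < l" using no sub that by blast
    moreover have "slit ` L \<subseteq> insert (p False) U"
      using that(2) unfolding slits by (cases "1 < l"; cases "u < d"; simp)
    then have "insert (Bd \<beta>, False) (slit ` L) - {p False} \<subseteq> U"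
      using that(1) body[of False] by blast
    ultimately show ?thesis using step[OF all, of "p False"] slits by simp
  qed
  have "{(Bd \<beta>, True), p True} \<in> N" if "1 < l"
  proof -
    have "Neg (R v 1 (l - 1)) \<in> L" using that by (simp add: L_def)
    then have "{(Bd \<beta>, True), compl (slit (Neg (R v 1 (l - 1))))} \<in> N" using ng unfolding \<beta> by blast
    then show ?thesis by (simp add: p_def)
  qed
  from step_pair[OF this] body[of True] body[of False]
  show "s True \<in> U \<Longrightarrow> (1 < l \<longrightarrow> p False \<in> U)" "1 < l \<and> p True \<in> U \<Longrightarrow> s False \<in> U" by auto
  have "{(Bd \<beta>, True), q True} \<in> N" if "u < d"
  proof -
    have "Neg (R v (u + 1) d) \<in> L" using that by (simp add: L_def)
    then have "{(Bd \<beta>, True), compl (slit (Neg (R v (u + 1) d)))} \<in> N" using ng unfolding \<beta> by blast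
    then show ?thesis by (simp add: q_def)
  qed
  from step_pair[OF this] body[of True] body[of False]
  show "s True \<in> U \<Longrightarrow> (u < d \<longrightarrow> q False \<in> U)" "u < d \<and> q True \<in> U \<Longrightarrow> s False \<in> U" by auto
qed

lemma bot_steps:
  assumes r: "(v, l, u) \<in> ranges n d"
  shows "(At (R v l u), True) \<in> U \<Longrightarrow> 1 < l \<longrightarrow> (At (R v (l - 1) u), True) \<in> U"
    "1 < l \<and> (At (R v (l - 1) u), False) \<in> U \<Longrightarrow> (At (R v l u), False) \<in> U"
    "(At (R v l u), True) \<in> U \<Longrightarrow> u < d \<longrightarrow> (At (R v l (u + 1)), True) \<in> U"
    "u < d \<and> (At (R v l (u + 1)), False) \<in> U \<Longrightarrow> (At (R v l u), False) \<in> U"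
proof -
  have left: "{(Bd (left_body v l u), False), (At (R v l u), True), (At (R v (l - 1) u), False)} \<in> N"
    "(Bd (left_body v l u), False) \<in> U" if "1 < l"
    using constants_derived constants_bodies(1)[OF r that]
    by (auto intro: program_nogoods(2)[OF prog_intros(2)[OF r that]] simp: left_body_def)
  have right: "{(Bd (right_body v l u), False), (At (R v l u), True), (At (R v l (u + 1)), False)} \<in> N"
    "(Bd (right_body v l u), False) \<in> U" if "u < d"
    using constants_derived constants_bodies(2)[OF r that]
    by (auto intro: program_nogoods(2)[OF prog_intros(3)[OF r that]] simp: right_body_def)
  show "1 < l \<longrightarrow> (At (R v (l - 1) u), True) \<in> U" if "(At (R v l u), True) \<in> U"
    using step_triple(1)[OF left that] by simp
  show "(At (R v l u), False) \<in> U" if "1 < l \<and> (At (R v (l - 1) u), False) \<in> U"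
    using step_triple(2)[OF left] that by simp
  show "u < d \<longrightarrow> (At (R v l (u + 1)), True) \<in> U" if "(At (R v l u), True) \<in> U"
    using step_triple(1)[OF right that] by simp
  show "(At (R v l u), False) \<in> U" if "u < d \<and> (At (R v l (u + 1)), False) \<in> U"
    using step_triple(2)[OF right] that by simp
qed

text \<open>In the nogood for \<open>insert w S\<close> the body literal is present because the Hall
  body is false, and the atoms of \<open>S\<close> are true; the atom of \<open>w\<close> is all
  that is missing.\<close>

lemma hall_step:
  assumes "1 \<le> l" "l \<le> u" "u \<le> d" "S \<subseteq> {1..n}" "card S = u - l + 1" "w \<in> {1..n} - S"
    and true: "\<And>v. v \<in> S \<Longrightarrow> (At (R v l u), True) \<in> U"
  shows "(At (R w l u), False) \<in> U"
proof -
  let ?S = "(\<lambda>v. Pos (R v l u)) ` insert w S"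
  let ?\<nu> = "insert (Bd (hall_body n l u), False) (slit ` ?S)"
  have "finite S" using assms(4) finite_subset by blast
  then have "card ?S = u - l + 2" using assms(5,6) unfolding card_hall_literals by simp
  moreover have "?S \<subseteq> {Pos (R v l u) | v. v \<in> {1..n}}" using assms(4,6) by blast
  ultimately have "?\<nu> \<in> body_nogoods (hall_body n l u)" unfolding hall_body_def by auto
  then have "?\<nu> \<in> N" by (rule program_nogoods(2)[OF prog_intros(4)[OF assms(1-3)]])
  moreover have "(Bd (hall_body n l u), False) \<in> U"
    using constants_derived constants_bodies(3)[OF assms(1-3)] by blast
  moreover have "slit ` ?S - {(At (R w l u), True)} \<subseteq> U" using true by auto
  ultimately have "compl (At (R w l u), True) \<in> U" by (intro step[of ?\<nu>]) auto
  then show ?thesis by simp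
qed

text \<open>Inside the triangle each inference is a unit step on a nogood whose constant element is
  already present. Where the conclusion would contradict the border, the absence of a conflict shows
  that the antecedents cannot hold.\<close>

lemma closed_shown: "closed_under (inferences n d) V"
proof -
  have range_case: "\<forall>(as, c)\<in>set clauses. (\<forall>a\<in>set as. holds V (locate d (v, l, u) a)) \<longrightarrow>
      holds V (locate d (v, l, u) c)" if r: "(v, l, u) \<in> ranges n d" for v l u
  proof -
    note i = shown_iff[OF r, of True] shown_iff[OF r, of False] shown_neighbours[OF r]
    have f: "V (v, l, u) = 2 \<Longrightarrow> V (v, 1, l - 1) = 2 \<Longrightarrow> V (v, u + 1, d) = 1"
      "V (v, l, u) = 2 \<Longrightarrow> V (v, u + 1, d) = 2 \<Longrightarrow> V (v, 1, l - 1) = 1"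
      "V (v, 1, l - 1) = 2 \<Longrightarrow> V (v, u + 1, d) = 2 \<Longrightarrow> V (v, l, u) = 1"
      "V (v, l, u) = 1 \<Longrightarrow> V (v, 1, l - 1) = 2" "V (v, 1, l - 1) = 1 \<Longrightarrow> V (v, l, u) = 2"
      "V (v, l, u) = 1 \<Longrightarrow> V (v, u + 1, d) = 2" "V (v, u + 1, d) = 1 \<Longrightarrow> V (v, l, u) = 2"
      using range_steps[OF r] unfolding i[unfolded code_simps] by blast+
    have g: "V (v, l, u) = 1 \<Longrightarrow> V (v, l - 1, u) = 1" "V (v, l - 1, u) = 2 \<Longrightarrow> V (v, l, u) = 2"
      "V (v, l, u) = 1 \<Longrightarrow> V (v, l, u + 1) = 1" "V (v, l, u + 1) = 2 \<Longrightarrow> V (v, l, u) = 2"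
      using bot_steps[OF r] unfolding i[unfolded code_simps] by blast+
    show ?thesis
      unfolding clauses_def list.set ball_simps case_prod_conv holds_def locate_def fst_conv snd_conv
        place.simps
      using f g by blast
  qed
  have hall_case: "holds V ((w, l, u), 2)"
    if "1 \<le> l" "l \<le> u" "u \<le> d" "S \<subseteq> {1..n}" "card S = u - l + 1" "w \<in> {1..n} - S"
      and h: "\<forall>f\<in>(\<lambda>v. ((v, l, u), 1)) ` S. holds V f" for l u S w
  proof -
    have r: "(v, l, u) \<in> ranges n d" if "v \<in> {1..n}" for v using that \<open>1 \<le> l\<close> \<open>l \<le> u\<close> \<open>u \<le> d\<close>
      by (simp add: ranges_def)
    have "(At (R v l u), True) \<in> U" if "v \<in> S" for v
    proof -
      have "V (v, l, u) = 1" using h that by (auto simp: holds_def)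
      then show ?thesis using shown_iff[OF r, of v True] that \<open>S \<subseteq> {1..n}\<close> by auto
    qed
    from hall_step[OF that(1-6) this] have "V (w, l, u) = code False"
      using shown_iff[OF r, of w False] that(6) by auto
    then show ?thesis by (simp add: holds_def)
  qed
  show ?thesis
    unfolding closed_under_def
  proof clarify
    fix X c assume inf: "(X, c) \<in> inferences n d" and X: "\<forall>f\<in>X. holds V f"
    from inf consider (range) v l u as a where "(v, l, u) \<in> ranges n d" "(as, a) \<in> set clauses"
      "X = locate d (v, l, u) ` set as" "c = locate d (v, l, u) a"
    | (hall) l u S w where "X = (\<lambda>v. ((v, l, u), 1)) ` S" "c = ((w, l, u), 2)"
      "1 \<le> l" "l \<le> u" "u \<le> d" "S \<subseteq> {1..n}" "card S = u - l + 1" "w \<in> {1..n} - S"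
      by (rule inferences_cases)
    then show "holds V c"
    proof cases
      case range
      then show ?thesis using range_case[OF range(1)] X by fast
    next
      case hall
      then show ?thesis using hall_case[OF hall(3-8)] X by blast
    qed
  qed
qed

text \<open>Together with the inclusion of the fixpoint in the readout of any closed valuation above
  its start, this determines a conflict-free fixpoint by its range values alone.\<close>

lemma readout_shown: "readout n d V \<subseteq> U"
proof
  fix \<sigma> assume "\<sigma> \<in> readout n d V"
  then consider (at) v l u b where "\<sigma> = (At (R v l u), b)" "(v, l, u) \<in> ranges n d" "V (v, l, u) = code b"
    | (bd) v l u b where "\<sigma> = (Bd (range_body d v l u), b)" "(v, l, u) \<in> ranges n d"
        "V (v, l, u) = code b"
    | (fixed) "\<sigma> \<in> constants n d"
    unfolding readout_def by blast
  then show "\<sigma> \<in> U"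
  proof cases
    case at
    then show ?thesis using shown_iff[OF at(2), of b] by simp
  next
    case bd
    then show ?thesis using shown_iff[OF bd(2), of b] range_body_derived[OF bd(2), of b] by simp
  next
    case fixed
    then show ?thesis using constants_derived by blast
  qed
qed

end

section \<open>Matching into intervals\<close>

text \<open>Greedy proof of Hall's theorem for intervals: the least left end \<open>x\<close> goes
  to the interval that starts at \<open>x\<close> and ends first, and every other left end is raised
  above \<open>x\<close>. The left ends change during the induction, so \<open>m\<close> is
  generalised while \<open>M\<close> is fixed.\<close>

lemma interval_matching:
  fixes m M :: "'a \<Rightarrow> nat"
  assumes "finite J" and "\<And>j. j \<in> J \<Longrightarrow> m j \<le> M j"
    and "\<And>l u. card {j \<in> J. l \<le> m j \<and> M j \<le> u} \<le> Suc u - l"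
  shows "\<exists>f. inj_on f J \<and> (\<forall>j\<in>J. m j \<le> f j \<and> f j \<le> M j)"
  using assms
proof (induction "card J" arbitrary: J m)
  case 0
  then show ?case by simp
next
  case (Suc k)
  note fin = Suc.prems(1) and mM = Suc.prems(2) and hall = Suc.prems(3)
  define x where "x = Min (m ` J)"
  have "J \<noteq> {}" using Suc.hyps(2) by auto
  then have "x \<in> m ` J" using fin by (simp add: x_def)
  then obtain i where i: "i \<in> J \<and> m i = x" by blast
  have x: "x \<le> m j" if "j \<in> J" for j using fin that by (simp add: x_def)
  obtain j0 where j0: "j0 \<in> J" "m j0 = x" and least: "\<And>j. j \<in> J \<Longrightarrow> m j = x \<Longrightarrow> M j0 \<le> M j"
    using ex_has_least_nat[of "\<lambda>j. j \<in> J \<and> m j = x", OF i, of M] by blast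
  define J' where "J' = J - {j0}"
  define m' where "m' j = max (m j) (x + 1)" for j
  have fin': "finite J'" using fin by (simp add: J'_def)
  \<comment> \<open>Raising the left end empties an interval only if it is the single point
    \<open>x\<close>. The chosen one is then also that point, and the two exceed the capacity of
    \<open>[x,x]\<close>.\<close>
  have "m' j \<le> M j" if "j \<in> J'" for j
  proof (rule ccontr)
    assume "\<not> m' j \<le> M j"
    moreover have j: "j \<in> J" "j \<noteq> j0" using that by (auto simp: J'_def)
    ultimately have "M j = x" "m j = x" using x[of j] mM[of j] by (auto simp: m'_def)
    moreover from this have "M j0 = x" using least[of j] j mM[of j0] j0 by simp
    ultimately have "{j0, j} \<subseteq> {j \<in> J. x \<le> m j \<and> M j \<le> x}" using j j0 by simp
    then have "card {j0, j} \<le> card {j \<in> J. x \<le> m j \<and> M j \<le> x}" using fin by (intro card_mono) auto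
    then show False using hall[of x x] j by simp
  qed
  moreover have "card {j \<in> J'. l \<le> m' j \<and> M j \<le> u} \<le> Suc u - l" for l u
  \<comment> \<open>All left ends are now at least \<open>x + 1\<close>, so for smaller
    \<open>l\<close> the bound for \<open>l = x + 1\<close> is the strongest. If \<open>j0\<close>
    ends by \<open>u\<close>, removing it lowers the count for \<open>[x,u]\<close> by one;
    otherwise, by the choice of \<open>j0\<close>, every interval ending by \<open>u\<close> starts
    after \<open>x\<close>. For larger \<open>l\<close> the raised ends make no difference.\<close>
  proof (cases "l \<le> x + 1")
    case True
    have "card {j \<in> J'. M j \<le> u} \<le> u - x"
    proof (cases "M j0 \<le> u")
      case le: True
      have "{j \<in> J. x \<le> m j \<and> M j \<le> u} = insert j0 {j \<in> J'. M j \<le> u}"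
        using x j0 le by (auto simp: J'_def)
      then have "card {j \<in> J. x \<le> m j \<and> M j \<le> u} = Suc (card {j \<in> J'. M j \<le> u})"
        using fin' by (simp add: J'_def)
      then show ?thesis using hall[of x u] by simp
    next
      case False
      have "x + 1 \<le> m j" if "j \<in> J'" "M j \<le> u" for j
        using x[of j] least[of j] that False by (fastforce simp: J'_def)
      then have "{j \<in> J'. M j \<le> u} \<subseteq> {j \<in> J. x + 1 \<le> m j \<and> M j \<le> u}" by (auto simp: J'_def)
      then have "card {j \<in> J'. M j \<le> u} \<le> card {j \<in> J. x + 1 \<le> m j \<and> M j \<le> u}"
        using fin by (intro card_mono) auto
      then show ?thesis using hall[of "x + 1" u] by simp
    qed
    moreover have "card {j \<in> J'. l \<le> m' j \<and> M j \<le> u} \<le> card {j \<in> J'. M j \<le> u}"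
      using fin' by (intro card_mono) auto
    ultimately show ?thesis using True by linarith
  next
    case False
    then have "{j \<in> J'. l \<le> m' j \<and> M j \<le> u} \<subseteq> {j \<in> J. l \<le> m j \<and> M j \<le> u}"
      by (auto simp: J'_def m'_def)
    then have "card {j \<in> J'. l \<le> m' j \<and> M j \<le> u} \<le> card {j \<in> J. l \<le> m j \<and> M j \<le> u}"
      using fin by (intro card_mono) auto
    then show ?thesis using hall[of l u] by simp
  qed
  moreover have "k = card J'" using Suc.hyps(2) j0(1) fin by (simp add: J'_def)
  ultimately obtain f where f: "inj_on f J'" "\<forall>j\<in>J'. m' j \<le> f j \<and> f j \<le> M j"
    using Suc.hyps(1)[of J' m'] fin' by blast
  \<comment> \<open>The value \<open>x\<close> is still free and can be given to
    \<open>j0\<close>.\<close>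
  have gt: "x < f j" if "j \<in> J'" for j using f(2) that by (fastforce simp: m'_def)
  have "inj_on (f(j0 := x)) (insert j0 J')"
    using f(1) gt by (fastforce simp: inj_on_def J'_def)
  moreover have "insert j0 J' = J" using j0 by (auto simp: J'_def)
  moreover have "\<forall>j\<in>J. m j \<le> (f(j0 := x)) j \<and> (f(j0 := x)) j \<le> M j"
    using f(2) j0 mM[of j0] by (auto simp: J'_def m'_def)
  ultimately show ?case by metis
qed


section \<open>Range consistency\<close>

lemma hull_mono: "finite T \<Longrightarrow> S \<subseteq> T \<Longrightarrow> hull S \<subseteq> hull T"
  by (auto simp: hull_def intro: Min.coboundedI Max.coboundedI order_trans[OF Min_antimono] order_trans[OF _ Max_mono])

lemma hull_subset_interval:
  assumes "S \<subseteq> {l..u}"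
  shows "hull S \<subseteq> {l..u}"
proof (cases "S = {}")
  case False
  have "finite S" using assms finite_subset by blast
  then have "Min S \<in> S" "Max S \<in> S" using False by simp_all
  then have "l \<le> Min S" "Max S \<le> u" using assms by auto
  then show ?thesis using False by (auto simp: hull_def)
qed (simp add: hull_def)

lemma bound_support_mono:
  assumes "bound_support n c D i a \<tau>" and "\<And>v. v \<in> {1..n} \<Longrightarrow> finite (D' v) \<and> D v \<subseteq> D' v"
  shows "bound_support n c D' i a \<tau>"
proof -
  have "hull (D v) \<subseteq> hull (D' v)" if "v \<in> {1..n}" for v using assms(2)[OF that] hull_mono by simp
  then show ?thesis using assms(1) unfolding bound_support_def by (meson subsetD)
qed

text \<open>The union of all range consistent subdomains is again range consistent, since enlarging
  domains only enlarges their hulls and so keeps every bound support.\<close>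

lemma enforced_rc_exists:
  assumes "\<And>v. v \<in> {1..n} \<Longrightarrow> finite (D v)"
  shows "\<exists>E. enforced_rc n c D E"
proof
  define F where "F = {E. subdomains n E D \<and> range_consistent n c E}"
  define E where "E v = (\<Union>E\<in>F. E v)" for v
  have sub: "subdomains n E D" unfolding subdomains_def E_def F_def by blast
  have "range_consistent n c E"
    unfolding range_consistent_def
  proof (intro ballI)
    fix i a assume i: "i \<in> {1..n}" and "a \<in> E i"
    then obtain E' where E': "E' \<in> F" "a \<in> E' i" by (auto simp: E_def)
    then obtain \<tau> where "bound_support n c E' i a \<tau>"
      using i unfolding F_def range_consistent_def by blast
    moreover have "finite (E v) \<and> E' v \<subseteq> E v" if "v \<in> {1..n}" for v
    proof
      show "finite (E v)" using sub assms[OF that] that unfolding subdomains_def by (blast intro: finite_subset)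
      show "E' v \<subseteq> E v" using E'(1) unfolding E_def by blast
    qed
    ultimately show "\<exists>\<tau>. bound_support n c E i a \<tau>" using bound_support_mono by blast
  qed
  moreover have "subdomains n E' E" if "E' \<in> F" for E'
    using that unfolding subdomains_def E_def by blast
  ultimately show "enforced_rc n c D E"
    using sub unfolding enforced_rc_def F_def by blast
qed

section \<open>From range consistent domains to closed valuations\<close>

definition valuation_of_doms :: "nat \<Rightarrow> nat \<Rightarrow> doms \<Rightarrow> valuation" where
  "valuation_of_doms n d E = (\<lambda>(v, l, u).
     if (v, l, u) \<in> ranges n d then
       if E v \<subseteq> {l..u} then 1 else if E v \<inter> {l..u} = {} then 2 else 0
     else border n d (v, l, u))"

lemma bordered_valuation_of_doms: "bordered n d (valuation_of_doms n d E)"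
  by (simp add: bordered_def valuation_of_doms_def split: prod.split)

text \<open>The local clauses are set algebra on the split of \<open>[1,d]\<close> into the values
  below, inside and above the interval. A Hall inference holds because a bound support for a value
  of \<open>w\<close> inside a filled interval would place \<open>u - l + 2\<close> variables
  injectively on \<open>u - l + 1\<close> values.\<close>

lemma closed_valuation_of_doms:
  assumes "1 \<le> d" and E: "\<And>v. v \<in> {1..n} \<Longrightarrow> E v \<noteq> {} \<and> E v \<subseteq> {1..d}"
    and rc: "range_consistent n (all_different n d) E"
  shows "closed_under (inferences n d) (valuation_of_doms n d E)"
  unfolding closed_under_def
proof clarify
  let ?T = "valuation_of_doms n d E"
  fix X c assume inf: "(X, c) \<in> inferences n d" and X: "\<forall>f\<in>X. holds ?T f"
  from inf show "holds ?T c"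
  proof (cases rule: inferences_cases)
    case (range v l u as a)
    then have v: "v \<in> {1..n}" and lu: "1 \<le> l" "l \<le> u" "u \<le> d" by (auto simp: ranges_def)
    note Ev = E[OF v] and b = bordered_simps[OF bordered_valuation_of_doms[of n d E] v \<open>1 \<le> d\<close>]
    have self: "?T (v, l, u) = 1 \<longleftrightarrow> E v \<subseteq> {l..u}" "?T (v, l, u) = 2 \<longleftrightarrow> E v \<inter> {l..u} = {}"
      using Ev v lu by (auto simp: valuation_of_doms_def ranges_def)
    have below: "?T (v, 1, l - 1) = 1 \<longleftrightarrow> E v \<subseteq> {1..l - 1}"
      "?T (v, 1, l - 1) = 2 \<longleftrightarrow> E v \<inter> {1..l - 1} = {}"
      using Ev v lu b by (cases "l = 1"; auto simp: valuation_of_doms_def ranges_def)+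
    have above: "?T (v, u + 1, d) = 1 \<longleftrightarrow> E v \<subseteq> {u + 1..d}"
      "?T (v, u + 1, d) = 2 \<longleftrightarrow> E v \<inter> {u + 1..d} = {}"
      using Ev v lu b by (cases "u = d"; auto simp: valuation_of_doms_def ranges_def)+
    have inner: "?T (v, x, y) = (if E v \<subseteq> {x..y} then 1 else if E v \<inter> {x..y} = {} then 2 else 0)"
      if "1 \<le> x" "x \<le> y" "y \<le> d" for x y
      using that v by (simp add: valuation_of_doms_def ranges_def)
    have sub: "{l..u} \<subseteq> {l - 1..u}" "{l..u} \<subseteq> {l..u + 1}" by auto
    have left: "(E v \<subseteq> {l..u} \<longrightarrow> ?T (v, l - 1, u) = 1) \<and>
      (?T (v, l - 1, u) = 2 \<longrightarrow> E v \<inter> {l..u} = {})"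
    proof (cases "l = 1")
      case True
      then show ?thesis using b(5)[of u] lu by simp
    next
      case False
      then have "1 \<le> l - 1" "l - 1 \<le> u" using lu by auto
      note val = inner[OF this lu(3)]
      show ?thesis
      proof (intro conjI impI)
        assume "E v \<subseteq> {l..u}"
        then have "E v \<subseteq> {l - 1..u}" using sub(1) by (rule subset_trans)
        then show "?T (v, l - 1, u) = 1" using val by simp
      next
        assume "?T (v, l - 1, u) = 2"
        then have "E v \<inter> {l - 1..u} = {}" unfolding val by (simp split: if_splits)
        then show "E v \<inter> {l..u} = {}" using sub(1) by blast
      qed
    qed
    have right: "(E v \<subseteq> {l..u} \<longrightarrow> ?T (v, l, u + 1) = 1) \<and>
      (?T (v, l, u + 1) = 2 \<longrightarrow> E v \<inter> {l..u} = {})"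
    proof (cases "u = d")
      case True
      then show ?thesis using b(6)[of l] lu by simp
    next
      case False
      then have "l \<le> u + 1" "u + 1 \<le> d" using lu by auto
      note val = inner[OF lu(1) this]
      show ?thesis
      proof (intro conjI impI)
        assume "E v \<subseteq> {l..u}"
        then have "E v \<subseteq> {l..u + 1}" using sub(2) by (rule subset_trans)
        then show "?T (v, l, u + 1) = 1" using val by simp
      next
        assume "?T (v, l, u + 1) = 2"
        then have "E v \<inter> {l..u + 1} = {}" unfolding val by (simp split: if_splits)
        then show "E v \<inter> {l..u} = {}" using sub(2) by blast
      qed
    qed
    have parts: "e \<in> {1..l - 1} \<or> e \<in> {l..u} \<or> e \<in> {u + 1..d}" if "e \<in> E v" for e
      using Ev that by force
    have disj: "{1..l - 1} \<inter> {l..u} = {}" "{1..l - 1} \<inter> {u + 1..d} = {}" "{l..u} \<inter> {u + 1..d} = {}"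
      using lu by auto
    have f: "?T (v, l, u) = 2 \<Longrightarrow> ?T (v, 1, l - 1) = 2 \<Longrightarrow> ?T (v, u + 1, d) = 1"
      "?T (v, l, u) = 2 \<Longrightarrow> ?T (v, u + 1, d) = 2 \<Longrightarrow> ?T (v, 1, l - 1) = 1"
      "?T (v, 1, l - 1) = 2 \<Longrightarrow> ?T (v, u + 1, d) = 2 \<Longrightarrow> ?T (v, l, u) = 1"
      "?T (v, l, u) = 1 \<Longrightarrow> ?T (v, 1, l - 1) = 2" "?T (v, 1, l - 1) = 1 \<Longrightarrow> ?T (v, l, u) = 2"
      "?T (v, l, u) = 1 \<Longrightarrow> ?T (v, u + 1, d) = 2" "?T (v, u + 1, d) = 1 \<Longrightarrow> ?T (v, l, u) = 2"
      unfolding self below above using parts disj by blast+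
    have g: "?T (v, l, u) = 1 \<Longrightarrow> ?T (v, l - 1, u) = 1" "?T (v, l - 1, u) = 2 \<Longrightarrow> ?T (v, l, u) = 2"
      "?T (v, l, u) = 1 \<Longrightarrow> ?T (v, l, u + 1) = 1" "?T (v, l, u + 1) = 2 \<Longrightarrow> ?T (v, l, u) = 2"
      using left right unfolding self by blast+
    have "\<forall>(as, c)\<in>set clauses. (\<forall>a\<in>set as. holds ?T (locate d (v, l, u) a)) \<longrightarrow>
      holds ?T (locate d (v, l, u) c)"
      unfolding clauses_def list.set ball_simps case_prod_conv holds_def locate_def fst_conv snd_conv
        place.simps
      using f g by blast
    then show ?thesis using range X by fast
  next
    case (hall l u S w)
    have val: "?T (v, l, u) = (if E v \<subseteq> {l..u} then 1 else if E v \<inter> {l..u} = {} then 2 else 0)"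
      if "v \<in> {1..n}" for v using that hall(3-5) by (simp add: valuation_of_doms_def ranges_def)
    have S: "E v \<subseteq> {l..u}" if "v \<in> S" for v
    proof -
      have "?T (v, l, u) = 1" using X that hall(1) by (auto simp: holds_def)
      moreover have "v \<in> {1..n}" using that hall(6) by blast
      ultimately show ?thesis using val[of v] by (simp split: if_splits)
    qed
    have "E w \<inter> {l..u} = {}"
    proof (rule ccontr)
      assume "E w \<inter> {l..u} \<noteq> {}"
      then obtain a where a: "a \<in> E w" "a \<in> {l..u}" by blast
      then obtain \<tau> where \<tau>: "bound_support n (all_different n d) E w a \<tau>"
        using rc hall(8) unfolding range_consistent_def by blast
      \<comment> \<open>A bound support may leave the domain of \<open>v\<close> but not its hull,
        and an interval that contains the domain contains the hull.\<close>
      have "\<tau> v \<in> {l..u}" if "v \<in> insert w S" for v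
      proof (cases "v = w")
        case False
        then have v: "v \<in> S" "v \<in> {1..n}" using that hall(6) by auto
        have "hull (E v) \<subseteq> {l..u}"
          using S[OF v(1)] by (rule hull_subset_interval)
        then show ?thesis using \<tau> v False unfolding bound_support_def by blast
      qed (use \<tau> a in \<open>auto simp: bound_support_def\<close>)
      then have "\<tau> ` insert w S \<subseteq> {l..u}" by blast
      then have "card (\<tau> ` insert w S) \<le> card {l..u}" by (rule card_mono[rotated]) simp
      moreover have "card (\<tau> ` insert w S) = card (insert w S)"
      proof (rule card_image, rule inj_on_subset)
        show "inj_on \<tau> {1..n}" using \<tau> by (simp add: bound_support_def all_different_def)
      qed (use hall(6,8) in blast)
      moreover have "card (insert w S) = u - l + 2"
        using hall(6-8) finite_subset[of S "{1..n}"] by simp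
      ultimately show False using hall(4) by simp
    qed
    moreover have "E w \<noteq> {}" using E[of w] hall(8) by simp
    ultimately have "?T (w, l, u) = 2" using val[of w] hall(8) by auto
    then show ?thesis using hall(2) by (simp add: holds_def)
  qed
qed

lemma initial_subset_readout:
  assumes "\<And>v. v \<in> {1..n} \<Longrightarrow> E v \<noteq> {} \<and> E v \<subseteq> D v"
  shows "initial_assignment n d D \<subseteq> readout n d (valuation_of_doms n d E)"
proof
  fix \<sigma> assume "\<sigma> \<in> initial_assignment n d D"
  then consider "\<sigma> = (At Violate, False)"
    | v i where "\<sigma> = (At (R v i i), False)" "v \<in> {1..n}" "i \<in> {1..d} - D v"
    by (auto simp: initial_assignment_def)
  then show "\<sigma> \<in> readout n d (valuation_of_doms n d E)"
  proof cases
    case 2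
    then have "i \<notin> E v" "E v \<noteq> {}" using assms[of v] by auto
    then show ?thesis using 2 by (auto simp: valuation_of_doms_def ranges_def)
  qed (simp add: readout_def constants_def)
qed

lemma consistent_initial: "consistent (initial_assignment n d D)"
  by (auto simp: consistent_def initial_assignment_def)

lemma not_violate_initial: "(At Violate, False) \<in> unit_prop N (initial_assignment n d D)"
  by (rule unit_prop.start) (simp add: initial_assignment_def)

section \<open>From closed valuations to range consistent domains\<close>

definition possible_values :: "nat \<Rightarrow> valuation \<Rightarrow> doms" where
  "possible_values d T v = {i \<in> {1..d}. T (v, i, i) \<noteq> 2}"

context
  fixes n d :: nat and T :: valuation
  assumes d: "1 \<le> d" and closed: "closed_under (inferences n d) T" and bordered: "bordered n d T"
begin

text \<open>No inference joins two adjacent false ranges directly. The detour runs through the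
  remaining values: \<open>[1,l]\<close> and the single value \<open>l + 1\<close> false make the
  range above \<open>l + 1\<close> true, and this makes \<open>[1,l+1]\<close> false.\<close>

lemma false_below:
  assumes v: "v \<in> {1..n}" and "l \<le> d" and "\<And>i. i \<in> {1..l} \<Longrightarrow> T (v, i, i) = 2"
  shows "T (v, 1, l) = 2"
  using assms(2,3)
proof (induction l)
  case 0
  then show ?case using bordered_simps[OF bordered v d] by simp
next
  case (Suc l)
  have r: "(v, Suc l, Suc l) \<in> ranges n d" "(v, 1, Suc l) \<in> ranges n d"
    using v Suc.prems by (auto simp: ranges_def)
  have "T (v, 1, l) = 2" "T (v, Suc l, Suc l) = 2" using Suc by auto
  then have "T (v, Suc l + 1, d) = 1" using closed_range(1)[OF closed r(1)] by simp
  then show ?case using closed_range(7)[OF closed r(2)] by simp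
qed

lemma false_above:
  assumes v: "v \<in> {1..n}" and "1 \<le> l" and "l \<le> d + 1" and "\<And>i. i \<in> {l..d} \<Longrightarrow> T (v, i, i) = 2"
  shows "T (v, l, d) = 2"
  using assms(3,2,4)
proof (induction rule: inc_induct)
  case base
  then show ?case using bordered_simps[OF bordered v d] by simp
next
  case (step l)
  have r: "(v, l, l) \<in> ranges n d" "(v, l, d) \<in> ranges n d"
    using v step by (auto simp: ranges_def)
  have "T (v, l + 1, d) = 2" "T (v, l, l) = 2" using step by auto
  then have "T (v, 1, l - 1) = 1" using closed_range(2)[OF closed r(1)] by simp
  then show ?case using closed_range(5)[OF closed r(2)] by simp
qed

lemma true_if_possible_values_subset:
  assumes r: "(v, l, u) \<in> ranges n d" and sub: "possible_values d T v \<subseteq> {l..u}"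
  shows "T (v, l, u) = 1"
proof -
  have v: "v \<in> {1..n}" and lu: "1 \<le> l" "l \<le> u" "u \<le> d" using r by (auto simp: ranges_def)
  have out: "T (v, i, i) = 2" if "i \<in> {1..d}" "i \<notin> {l..u}" for i
    using sub that by (auto simp: possible_values_def)
  have "T (v, 1, l - 1) = 2" using lu by (intro false_below v out) auto
  moreover have "T (v, u + 1, d) = 2" using lu by (intro false_above v out) auto
  ultimately show ?thesis using closed_range(3)[OF closed r] by simp
qed

lemma possible_values_nonempty:
  assumes v: "v \<in> {1..n}"
  shows "possible_values d T v \<noteq> {}"
proof
  assume "possible_values d T v = {}"
  then have "T (v, i, i) = 2" if "i \<in> {1..d}" for i using that by (auto simp: possible_values_def)
  then have "T (v, 1, d) = 2" using false_below[OF v] by blast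
  then show False using closed_full_range[OF closed bordered v d] by simp
qed

text \<open>The \<open>\<bottom>\<close>-rules pass falsity on to the range shorter by one value.
  The left end is moved up to \<open>a\<close> and then the right end down to it.\<close>

lemma false_subrange:
  assumes r: "(v, l, u) \<in> ranges n d" and "T (v, l, u) = 2" and "a \<in> {l..u}"
  shows "T (v, a, a) = 2"
proof -
  have v: "v \<in> {1..n}" and lu: "1 \<le> l" "l \<le> u" "u \<le> d" using r by (auto simp: ranges_def)
  have "l \<le> a" "a \<le> u" using assms(3) by auto
  from \<open>l \<le> a\<close> have "a \<le> u \<Longrightarrow> T (v, a, u) = 2"
  proof (induction a rule: dec_induct)
    case base
    then show ?case using assms(2) by simp
  next
    case (step a)
    then have "(v, Suc a, u) \<in> ranges n d" using v lu by (auto simp: ranges_def)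
    from closed_range(9)[OF closed this] step show ?case by simp
  qed
  then have a: "T (v, a, u) = 2" using \<open>a \<le> u\<close> by simp
  show ?thesis
  proof (rule inc_induct[of a u "\<lambda>b. T (v, a, b) = 2"])
    fix b assume b: "a \<le> b" "b < u" "T (v, a, Suc b) = 2"
    then have "(v, a, b) \<in> ranges n d" using v lu \<open>l \<le> a\<close> by (auto simp: ranges_def)
    from closed_range(11)[OF closed this] b show "T (v, a, b) = 2" by simp
  qed fact+
qed

text \<open>A bound support for \<open>a\<close> is a matching in which variable \<open>i\<close>
  has the interval \<open>[a,a]\<close> and the others have their hulls. If too many of these
  intervals lay in \<open>[l,u]\<close>, a Hall inference would make the range false for one of the
  variables: for a variable other than \<open>i\<close> it is true, and for \<open>i\<close> its
  falsity would have removed \<open>a\<close>.\<close>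

lemma range_consistent_possible_values: "range_consistent n (all_different n d) (possible_values d T)"
  unfolding range_consistent_def
proof (intro ballI)
  let ?D = "possible_values d T"
  fix i a assume i: "i \<in> {1..n}" and a: "a \<in> ?D i"
  have fin: "finite (?D v)" for v by (simp add: possible_values_def)
  have nonempty: "?D v \<noteq> {}" if "v \<in> {1..n}" for v using possible_values_nonempty[OF that] .
  have a': "a \<in> {1..d}" "T (i, a, a) \<noteq> 2" using a by (auto simp: possible_values_def)
  define m where "m v = (if v = i then a else Min (?D v))" for v
  define M where "M v = (if v = i then a else Max (?D v))" for v
  have bounds: "?D v \<subseteq> {Min (?D v)..Max (?D v)}" for v using fin by auto
  have range: "1 \<le> m v" "m v \<le> M v" "M v \<le> d" if "v \<in> {1..n}" for v
    using fin[of v] nonempty[OF that] a' Min_in[OF fin nonempty[OF that]] Max_in[OF fin nonempty[OF that]]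
    by (auto simp: m_def M_def possible_values_def)
  have "card {v \<in> {1..n}. l \<le> m v \<and> M v \<le> u} \<le> Suc u - l" if lu: "1 \<le> l" "l \<le> u" "u \<le> d" for l u
  proof (rule ccontr)
    let ?J = "{v \<in> {1..n}. l \<le> m v \<and> M v \<le> u}"
    assume "\<not> card ?J \<le> Suc u - l"
    then have "u - l + 2 \<le> card ?J" using lu by simp
    then obtain J where J: "J \<subseteq> ?J" "card J = u - l + 2"
      by (rule obtain_subset_with_card_n) blast
    have true: "T (v, l, u) = 1" if "v \<in> J" "v \<noteq> i" for v
    proof (rule true_if_possible_values_subset)
      show "(v, l, u) \<in> ranges n d" using that(1) J(1) lu by (auto simp: ranges_def)
      show "?D v \<subseteq> {l..u}" using that J(1) bounds[of v] by (fastforce simp: m_def M_def)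
    qed
    have "J \<noteq> {}" using J(2) by auto
    \<comment> \<open>If \<open>i\<close> is in \<open>J\<close>, it must be the excluded variable:
      only its value \<open>a\<close> is known to lie in \<open>[l,u]\<close>, so its range need not
      be true.\<close>
    then obtain w where w: "w \<in> J" "i \<in> J \<longrightarrow> w = i" by blast
    have "T (w, l, u) = 2"
    proof (rule closed_hall[OF closed lu])
      show "card (J - {w}) = u - l + 1" using J(2) w(1) by simp
      show "w \<in> {1..n} - (J - {w})" "J - {w} \<subseteq> {1..n}" using w(1) J(1) by auto
      show "T (v, l, u) = 1" if "v \<in> J - {w}" for v using that true w(2) by blast
    qed
    moreover from this have "w = i" using true[OF w(1)] by fastforce
    moreover have "a \<in> {l..u}" using w(1) J(1) \<open>w = i\<close> by (auto simp: m_def M_def)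
    moreover have "(i, l, u) \<in> ranges n d" using i lu by (simp add: ranges_def)
    ultimately show False using false_subrange a'(2) by blast
  qed
  \<comment> \<open>The matching lemma quantifies over all bounds. Since every interval lies in
    \<open>[1,d]\<close>, clipping the bounds to \<open>[1,d]\<close> changes no count.\<close>
  then have hall: "card {v \<in> {1..n}. l \<le> m v \<and> M v \<le> u} \<le> Suc u - l" for l u
  proof (cases "max 1 l \<le> min u d")
    case True
    have "{v \<in> {1..n}. l \<le> m v \<and> M v \<le> u} = {v \<in> {1..n}. max 1 l \<le> m v \<and> M v \<le> min u d}"
      using range by auto
    also have "card \<dots> \<le> Suc (min u d) - max 1 l"
      using True \<open>\<And>l u. 1 \<le> l \<Longrightarrow> l \<le> u \<Longrightarrow> u \<le> d \<Longrightarrow> _\<close>[of "max 1 l" "min u d"] by simp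
    finally show ?thesis by linarith
  next
    case False
    then have "\<not> (l \<le> m v \<and> M v \<le> u)" if "v \<in> {1..n}" for v using range[OF that] by linarith
    then have "{v \<in> {1..n}. l \<le> m v \<and> M v \<le> u} = {}" by blast
    then show ?thesis by (simp only: card.empty)
  qed
  then obtain \<tau> where \<tau>: "inj_on \<tau> {1..n}" "\<forall>v\<in>{1..n}. m v \<le> \<tau> v \<and> \<tau> v \<le> M v"
    using interval_matching[of "{1..n}" m M] range(2) by blast
  have "bound_support n (all_different n d) ?D i a \<tau>"
    unfolding bound_support_def
  proof (intro conjI ballI impI)
    show "\<tau> \<in> all_different n d"
      using \<tau> range unfolding all_different_def by (fastforce dest: order_trans)
    show "\<tau> i = a" using bspec[OF \<tau>(2) i] by (simp add: m_def M_def)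
    show "\<tau> j \<in> hull (?D j)" if "j \<in> {1..n}" "j \<noteq> i" for j
      using bspec[OF \<tau>(2) that(1)] that(2) nonempty[OF that(1)] by (simp add: m_def M_def hull_def)
  qed
  then show "\<exists>\<tau>. bound_support n (all_different n d) ?D i a \<tau>" by blast
qed

end

text \<open>The values left by a conflict-free fixpoint are nonempty range consistent subdomains, so
  they lie in the largest such family and that family has no empty member. Conversely, the readout
  of a largest family without empty members contains the fixpoint, so none of its values is removed
  and no conflict arises.\<close>

theorem up_enforces_range_consistency_all_different:
  assumes "1 \<le> n" "1 \<le> d"
  shows "up_enforces_range_consistency n d (all_different n d) (all_different_prog n d)"
  unfolding up_enforces_range_consistency_def Let_def
proof (intro allI impI)
  fix D assume "initial_doms n d D"
  then have D: "D v \<noteq> {}" "D v \<subseteq> {1..d}" if "v \<in> {1..n}" for v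
    using that by (auto simp: initial_doms_def)
  let ?A = "initial_assignment n d D" and ?N = "nogoods (all_different_prog n d)"
  let ?U = "unit_prop ?N ?A"
  have "finite (D v)" if "v \<in> {1..n}" for v using D(2)[OF that] finite_subset by blast
  then obtain E where E: "enforced_rc n (all_different n d) D E" using enforced_rc_exists by blast
  then have sub: "E v \<subseteq> D v" if "v \<in> {1..n}" for v
    using that by (auto simp: enforced_rc_def subdomains_def)
  have sound: "?U \<subseteq> readout n d (valuation_of_doms n d E)" "\<not> conflict ?N ?U"
    if ne: "\<forall>v\<in>{1..n}. E v \<noteq> {}"
  proof -
    have "closed_under (inferences n d) (valuation_of_doms n d E)"
    proof (rule closed_valuation_of_doms[OF assms(2)])
      show "E v \<noteq> {} \<and> E v \<subseteq> {1..d}" if "v \<in> {1..n}" for v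
        using ne sub[OF that] D(2)[OF that] that by blast
      show "range_consistent n (all_different n d) E" using E by (simp add: enforced_rc_def)
    qed
    moreover have "?A \<subseteq> readout n d (valuation_of_doms n d E)"
      using ne sub by (intro initial_subset_readout) auto
    ultimately show "?U \<subseteq> readout n d (valuation_of_doms n d E)" "\<not> conflict ?N ?U"
      using unit_prop_subset_readout[OF _ bordered_valuation_of_doms assms] by blast+
  qed
  define S where "S v = {i \<in> {1..d}. (At (R v i i), False) \<notin> ?U}" for v
  have complete: "S v \<noteq> {} \<and>
      S v \<subseteq> E v"
    if noc: "\<not> conflict ?N ?U" and v: "v \<in> {1..n}" for v
  proof -
    interpret conflict_free_fixpoint n d ?N ?U ?A
      using assms noc consistent_initial not_violate_initial by unfold_locales auto
    note T = assms(2) closed_shown bordered_shown[of n d ?U]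
    have eq: "S v = possible_values d V v" if "v \<in> {1..n}" for v
      unfolding S_def using shown_iff[of v _ _ False] that by (auto simp: possible_values_def ranges_def)
    have "possible_values d V v \<subseteq> D v" if "v \<in> {1..n}" for v
    proof -
      have "(At (R v i i), False) \<in> ?U" if "i \<in> {1..d} - D v" for i
        using that \<open>v \<in> {1..n}\<close> by (intro unit_prop.start) (auto simp: initial_assignment_def)
      then show ?thesis using eq[OF that] unfolding S_def by blast
    qed
    then have "subdomains n (possible_values d V) D" by (simp add: subdomains_def)
    with range_consistent_possible_values[OF T] E have "subdomains n (possible_values d V) E"
      unfolding enforced_rc_def by blast
    then show ?thesis
      using possible_values_nonempty[OF T v] v unfolding eq[OF v] by (auto simp: subdomains_def)
  qed
  have ne: "\<forall>v\<in>{1..n}. E v \<noteq> {}" if "\<not> conflict ?N ?U"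
    using complete[OF that] by blast
  have "conflict ?N ?U \<longleftrightarrow> (\<exists>v\<in>{1..n}. E v = {})"
    using sound(2) ne by blast
  moreover have "\<forall>v\<in>{1..n}. S v = E v" if noc: "\<not> conflict ?N ?U"
  proof (intro ballI equalityI)
    fix v assume v: "v \<in> {1..n}"
    show "S v \<subseteq> E v" using complete[OF noc v] by blast
    show "E v \<subseteq> S v"
      unfolding S_def using sound(1)[OF ne[OF noc]] sub[OF v] D(2)[OF v] by (auto simp: valuation_of_doms_def ranges_def split: if_splits)
  qed
  ultimately show "\<exists>E. enforced_rc n (all_different n d) D E \<and>
      (conflict ?N ?U \<longleftrightarrow> (\<exists>v\<in>{1..n}. E v = {})) \<and>
      (\<not> conflict ?N ?U \<longrightarrow> (\<forall>v\<in>{1..n}. {i \<in> {1..d}. (At (R v i i), False) \<notin> ?U} = E v))"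
    using E unfolding S_def by blast
qed

section \<open>A propagator with a queue of unprocessed ranges\<close>

declare split_paired_All [simp del] split_paired_Ex [simp del]

type_synonym pstate = "valuation \<times> range list \<times> bool"

text \<open>A range enters the queue exactly when it receives its value. A clash raises the flag and
  keeps the old value, so posting never takes information away.\<close>

fun post :: "fact \<Rightarrow> pstate \<Rightarrow> pstate" where
  "post (r, b) (T, q, f) =
     (if T r = 0 then (T(r := b), q @ [r], f) else if T r = b then (T, q, f) else (T, q, True))"

fun fire :: "fact list \<times> fact \<Rightarrow> pstate \<Rightarrow> pstate" where
  "fire (as, c) (T, q, f) = (if \<forall>a\<in>set as. holds T a then post c (T, q, f) else (T, q, f))"

text \<open>The guard lets a visit name its neighbours uniformly, including those that fall outside
  the triangle.\<close>

definition check :: "nat \<Rightarrow> nat \<Rightarrow> nat \<Rightarrow> nat \<Rightarrow> pstate \<Rightarrow> pstate" where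
  "check d v l u \<sigma> =
     (if 1 \<le> l \<and> l \<le> u \<and> u \<le> d
      then fold (\<lambda>(as, c). fire (map (locate d (v, l, u)) as, locate d (v, l, u) c)) clauses \<sigma>
      else \<sigma>)"

definition exclude :: "nat \<Rightarrow> nat \<Rightarrow> nat \<Rightarrow> pstate \<Rightarrow> pstate" where
  "exclude l u w \<sigma> = (if fst \<sigma> (w, l, u) = 1 then \<sigma> else post ((w, l, u), 2) \<sigma>)"

definition inside :: "nat \<Rightarrow> nat \<Rightarrow> nat \<Rightarrow> valuation \<Rightarrow> nat set" where
  "inside n l u T = {w \<in> {1..n}. T (w, l, u) = 1}"

text \<open>With more than \<open>u - l + 1\<close> true ranges a Hall inference would contradict
  one of them, so the flag is raised without posting anything.\<close>

definition check_hall :: "nat \<Rightarrow> nat \<Rightarrow> nat \<Rightarrow> pstate \<Rightarrow> pstate" where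
  "check_hall n l u = (\<lambda>(T, q, f).
     let c = card (inside n l u T) in
     if u - l + 1 < c then (T, q, True)
     else if c = u - l + 1 then fold (exclude l u) [1..<n + 1] (T, q, f)
     else (T, q, f))"

text \<open>The ranges checked are those that can have \<open>[l,u]\<close> as a neighbour: itself,
  \<open>[l+1,u]\<close> with it on the left, \<open>[l,u-1]\<close> with it on the right, every
  \<open>[u+1,x]\<close> with it below and every \<open>[x,l-1]\<close> with it above. The last two
  kinds arise only for \<open>l = 1\<close> and \<open>u = d\<close>; further checks do no
  harm.\<close>

definition visit :: "nat \<Rightarrow> nat \<Rightarrow> range \<Rightarrow> pstate \<Rightarrow> pstate" where
  "visit n d = (\<lambda>(v, l, u) \<sigma>.
     check_hall n l u
       (fold (\<lambda>x \<sigma>. check d v x (l - 1) (check d v (u + 1) x \<sigma>)) [1..<d + 1]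
         (check d v l (u - 1) (check d v (l + 1) u (check d v l u \<sigma>)))))"

text \<open>Forgets the order and the organisation of the checks: every action of the propagator is
  a chain of posts of inferred facts, so an invariant has to be proved for a single post
  only.\<close>

inductive derives :: "(fact set \<times> fact) set \<Rightarrow> pstate \<Rightarrow> pstate \<Rightarrow> bool" for J \<sigma> where
  stop: "derives J \<sigma> \<sigma>"
| infer: "derives J \<sigma> (T, q, f) \<Longrightarrow> (X, c) \<in> J \<Longrightarrow> (\<And>a. a \<in> X \<Longrightarrow> holds T a) \<Longrightarrow>
    derives J \<sigma> (post c (T, q, f))"

lemma derives_trans: "derives J \<sigma>' \<sigma>'' \<Longrightarrow> derives J \<sigma> \<sigma>' \<Longrightarrow> derives J \<sigma> \<sigma>''"
  by (induction rule: derives.induct) (auto intro: derives.infer)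

section \<open>Invariants of states under derivations\<close>

definition well_formed :: "nat \<Rightarrow> nat \<Rightarrow> pstate \<Rightarrow> bool" where
  "well_formed n d = (\<lambda>(T, q, f). bordered n d T \<and> (\<forall>r. T r \<in> {0, 1, 2}) \<and>
     (\<forall>r\<in>set q. r \<in> ranges n d \<and> T r \<noteq> 0))"

text \<open>A fact may also concern the border, provided that a value stands there. Posting it can
  then only agree or clash, so nothing outside the triangle is ever assigned or queued.\<close>

definition admissible :: "nat \<Rightarrow> nat \<Rightarrow> fact \<Rightarrow> bool" where
  "admissible n d = (\<lambda>(r, b). b \<in> {1, 2} \<and> (r \<in> ranges n d \<or> border n d r \<noteq> 0))"

definition potential :: "nat \<Rightarrow> nat \<Rightarrow> pstate \<Rightarrow> nat" where
  "potential n d = (\<lambda>(T, q, f). card {r \<in> ranges n d. T r = 0} + length q)"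

definition extends :: "pstate \<Rightarrow> pstate \<Rightarrow> bool" where
  "extends = (\<lambda>(T, q, f) (T', q', f'). (\<forall>r. T r \<noteq> 0 \<longrightarrow> T' r = T r) \<and>
     (\<forall>r. T' r \<noteq> T r \<longrightarrow> r \<in> set q') \<and> set q \<subseteq> set q' \<and> (f \<longrightarrow> f'))"

text \<open>\<open>V\<close> is a target above the current valuation. With the values of a
  conflict-free fixpoint as target, soundness means that no wrong value is inferred and no false
  alarm raised.\<close>

definition sound :: "valuation \<Rightarrow> pstate \<Rightarrow> bool" where
  "sound V = (\<lambda>(T, q, f). \<not> f \<and> (\<forall>r. T r \<noteq> 0 \<longrightarrow> T r = V r))"

definition pending :: "range list \<Rightarrow> fact set \<times> fact \<Rightarrow> bool" where
  "pending q = (\<lambda>(X, c). \<exists>a\<in>insert c X. fst a \<in> set q)"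

text \<open>An inference may be violated while one of its ranges is queued. Once the queue is empty
  and no flag is raised, only the last alternative is left, and the valuation is closed.\<close>

definition settled :: "pstate \<Rightarrow> fact set \<times> fact \<Rightarrow> bool" where
  "settled = (\<lambda>(T, q, f) i. f \<or> pending q i \<or> ((\<forall>a\<in>fst i. holds T a) \<longrightarrow> holds T (snd i)))"

text \<open>No antecedent asks for a range to be unassigned; antecedents that hold therefore keep
  holding when the valuation is extended to its target.\<close>

definition proper_rules :: "nat \<Rightarrow> nat \<Rightarrow> (fact set \<times> fact) set \<Rightarrow> bool" where
  "proper_rules n d J \<longleftrightarrow> (\<forall>(X, c)\<in>J. admissible n d c \<and> (\<forall>a\<in>X. snd a \<noteq> 0))"

lemma finite_ranges [simp]: "finite (ranges n d)"
  by (rule finite_subset[of _ "{1..n} \<times> {1..d} \<times> {1..d}"]) (auto simp: ranges_def)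

lemma border_bound: "border n d r \<in> {0, 1, 2}"
  by (cases r) (simp add: border_def)

lemma border_ranges [simp]: "r \<in> ranges n d \<Longrightarrow> border n d r = 0"
  by (cases r) (auto simp: border_def ranges_def)

lemma post_facts:
  assumes "well_formed n d \<sigma>" "admissible n d c"
  shows "well_formed n d (post c \<sigma>)" "potential n d (post c \<sigma>) = potential n d \<sigma>"
proof -
  obtain T q f where \<sigma>: "\<sigma> = (T, q, f)" by (cases \<sigma>)
  obtain r b where c: "c = (r, b)" by (cases c)
  have r: "r \<in> ranges n d" if "T r = 0"
  proof (rule ccontr)
    assume "r \<notin> ranges n d"
    then have "T r = border n d r" "border n d r \<noteq> 0"
      using assms unfolding \<sigma> c well_formed_def admissible_def bordered_def
      by auto
    with that show False by simp
  qed
  then show "well_formed n d (post c \<sigma>)"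
    using assms unfolding \<sigma> c well_formed_def admissible_def bordered_def
    by (auto split: if_splits)
  have "card {r' \<in> ranges n d. T r' = 0} = Suc (card {r' \<in> ranges n d. (T(r := b)) r' = 0})"
    if "T r = 0"
  proof -
    have "{r' \<in> ranges n d. T r' = 0} = insert r {r' \<in> ranges n d. (T(r := b)) r' = 0}"
      using r[OF that] that by auto
    moreover have "(T(r := b)) r \<noteq> 0" using assms(2) by (auto simp: c admissible_def)
    ultimately show ?thesis by (simp only:) (subst card_insert_disjoint; simp)
  qed
  then show "potential n d (post c \<sigma>) = potential n d \<sigma>"
    by (auto simp: \<sigma> c potential_def)
qed

lemma extends_refl: "extends \<sigma> \<sigma>"
  by (cases \<sigma>) (simp add: extends_def)

lemma extends_trans:
  assumes "extends \<sigma> \<sigma>'" "extends \<sigma>' \<sigma>''"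
  shows "extends \<sigma> \<sigma>''"
proof -
  obtain T q f T' q' f' T'' q'' f'' where eq: "\<sigma> = (T, q, f)" "\<sigma>' = (T', q', f')" "\<sigma>'' = (T'', q'', f'')"
    by (cases \<sigma>; cases \<sigma>'; cases \<sigma>'') blast
  have 1: "T r \<noteq> 0 \<Longrightarrow> T' r = T r" "T' r \<noteq> T r \<Longrightarrow> r \<in> set q'" "set q \<subseteq> set q'" "f \<Longrightarrow> f'"
    and 2: "T' r \<noteq> 0 \<Longrightarrow> T'' r = T' r" "T'' r \<noteq> T' r \<Longrightarrow> r \<in> set q''" "set q' \<subseteq> set q''" "f' \<Longrightarrow> f''" for r
    using assms by (auto simp: eq extends_def)
  have "r \<in> set q''" if "T'' r \<noteq> T r" for r
    using 1(2)[of r] 2(2)[of r] 2(3) that by (cases "T' r = T r") auto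
  moreover have "T'' r = T r" if "T r \<noteq> 0" for r using 1(1) 2(1) that by simp
  ultimately show ?thesis using 1(3,4) 2(3,4) by (auto simp: eq extends_def)
qed

lemma extends_post: "extends \<sigma> (post c \<sigma>)"
  by (cases \<sigma>; cases c) (auto simp: extends_def)

lemma sound_post: "sound V \<sigma> \<Longrightarrow> holds V c \<Longrightarrow> sound V (post c \<sigma>)"
  by (cases \<sigma>; cases c) (auto simp: sound_def holds_def)

lemma derives_extends: "derives J \<sigma> \<sigma>' \<Longrightarrow> extends \<sigma> \<sigma>'"
  by (induction rule: derives.induct) (auto intro: extends_refl extends_trans extends_post)

lemma derives_facts:
  assumes "derives J \<sigma> \<sigma>'" "well_formed n d \<sigma>" "proper_rules n d J"
  shows "well_formed n d \<sigma>' \<and> potential n d \<sigma>' = potential n d \<sigma>"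
  using assms(1)
proof induction
  case (infer T q f X c)
  then have "admissible n d c" using assms(3) by (auto simp: proper_rules_def)
  with infer.IH show ?case using post_facts[of n d "(T, q, f)" c] by simp
qed (use assms(2) in simp)

lemma derives_sound:
  assumes "derives J \<sigma> \<sigma>'" "sound V \<sigma>" "closed_under J V" "proper_rules n d J"
  shows "sound V \<sigma>'"
  using assms(1)
proof induction
  case (infer T q f X c)
  have "holds V a" if "a \<in> X" for a
  proof -
    have "holds T a" using infer.hyps(3) that .
    moreover have "snd a \<noteq> 0" using assms(4) infer.hyps(2) that by (auto simp: proper_rules_def)
    ultimately show ?thesis using infer.IH infer.hyps(2) by (auto simp: sound_def holds_def)
  qed
  then have "holds V c" using closed_underD[OF assms(3) infer.hyps(2)] by simp
  then show ?case using sound_post[OF infer.IH] by simp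
qed (use assms(2) in simp)

text \<open>A new value for a range that the inference mentions makes the inference pending; a new
  value elsewhere does not affect it, and the other outcomes of a post change no value.\<close>

lemma settled_post: "settled \<sigma> i \<Longrightarrow> settled (post c \<sigma>) i"
proof -
  assume s: "settled \<sigma> i"
  obtain T q f r b X c' where eq: "\<sigma> = (T, q, f)" "c = (r, b)" "i = (X, c')"
    by (cases \<sigma>; cases c; cases i) blast
  show ?thesis
  proof (cases "T r = 0 \<and> \<not> pending (q @ [r]) i")
    case True
    then have "fst a \<noteq> r" if "a \<in> insert c' X" for a using that by (auto simp: eq pending_def)
    then have "holds (T(r := b)) a = holds T a" if "a \<in> insert c' X" for a
      using that by (simp add: holds_def)
    then show ?thesis using s True by (auto simp: eq settled_def pending_def)
  next
    case False
    then show ?thesis using s by (auto simp: eq settled_def)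
  qed
qed

lemma settled_derives: "derives J \<sigma> \<sigma>' \<Longrightarrow> settled \<sigma> i \<Longrightarrow> settled \<sigma>' i"
  by (induction rule: derives.induct) (auto intro: settled_post)

text \<open>Demanded from every state, so that it composes: a later action consists of derivations,
  and these preserve what an earlier one has settled.\<close>

definition settles :: "(fact set \<times> fact) set \<Rightarrow> (fact set \<times> fact) set \<Rightarrow> (pstate \<Rightarrow> pstate) \<Rightarrow> bool"
  where "settles J K g \<longleftrightarrow> (\<forall>\<sigma>. derives J \<sigma> (g \<sigma>) \<and> (\<forall>i\<in>K. settled (g \<sigma>) i))"

lemma settlesI:
  assumes "\<And>T q f. derives J (T, q, f) (g (T, q, f)) \<and> (\<forall>i\<in>K. settled (g (T, q, f)) i)"
  shows "settles J K g"
  unfolding settles_def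
proof
  fix \<sigma> :: pstate
  obtain T q f where "\<sigma> = (T, q, f)" by (cases \<sigma>)
  with assms show "derives J \<sigma> (g \<sigma>) \<and> (\<forall>i\<in>K. settled (g \<sigma>) i)" by simp
qed

lemma settles_comp:
  assumes "settles J K g" "settles J K' h"
  shows "settles J (K \<union> K') (\<lambda>\<sigma>. h (g \<sigma>))"
  using assms unfolding settles_def by (blast intro: derives_trans settled_derives)

lemma settles_fold:
  assumes "\<And>x. x \<in> set xs \<Longrightarrow> settles J (K x) (g x)"
  shows "settles J (\<Union>x\<in>set xs. K x) (fold g xs)"
  using assms
proof (induction xs)
  case Nil
  then show ?case by (simp add: settles_def derives.stop)
next
  case (Cons x xs)
  then have "settles J (K x \<union> (\<Union>x\<in>set xs. K x)) (\<lambda>\<sigma>. fold g xs (g x \<sigma>))"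
    by (intro settles_comp) auto
  then show ?case by simp
qed

lemma settles_mono: "settles J K g \<Longrightarrow> K' \<subseteq> K \<Longrightarrow> settles J K' g"
  by (auto simp: settles_def)

lemma derives_fact:
  assumes "({}, c) \<in> J"
  shows "derives J \<sigma> (post c \<sigma>)"
  using derives.infer[OF derives.stop assms, of "fst \<sigma>" "fst (snd \<sigma>)" "snd (snd \<sigma>)"] by simp

lemma fire_settles:
  assumes "(set as, c) \<in> J"
  shows "settles J {(set as, c)} (fire (as, c))"
proof -
  have "derives J (T, q, f) (fire (as, c) (T, q, f))" for T q f
    using derives.infer[OF derives.stop assms, of T q f] by (auto intro: derives.stop)
  moreover have "settled (fire (as, c) (T, q, f)) (set as, c)" for T q f
    by (cases c) (auto simp: settled_def holds_def)
  ultimately show ?thesis by (intro settlesI) simp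
qed

section \<open>The inferences settled by a visit\<close>

definition rules_at :: "nat \<Rightarrow> nat \<Rightarrow> range \<Rightarrow> (fact set \<times> fact) set" where
  "rules_at n d r = (if r \<in> ranges n d
     then {(locate d r ` set as, locate d r c) | as c. (as, c) \<in> set clauses} else {})"

lemma check_settles:
  assumes "inferences n d \<subseteq> J" "v \<in> {1..n}"
  shows "settles J (rules_at n d (v, l, u)) (check d v l u)"
proof (cases "(v, l, u) \<in> ranges n d")
  case True
  have fold: "settles J (\<Union>(as, c)\<in>set clauses. {(set (map (locate d (v, l, u)) as), locate d (v, l, u) c)})
    (fold (\<lambda>(as, c). fire (map (locate d (v, l, u)) as, locate d (v, l, u) c)) clauses)"
  proof (rule settles_fold)
    fix x assume x: "x \<in> set clauses"
    obtain as c where eq: "x = (as, c)" by (cases x)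
    have "(set (map (locate d (v, l, u)) as), locate d (v, l, u) c) \<in> J"
      using assms(1) x True unfolding inferences_def range_inferences_def eq by auto
    from fire_settles[OF this]
    show "settles J (case x of (as, c) \<Rightarrow> {(set (map (locate d (v, l, u)) as), locate d (v, l, u) c)})
        (case x of (as, c) \<Rightarrow> fire (map (locate d (v, l, u)) as, locate d (v, l, u) c))"
      by (simp add: eq)
  qed
  have eq: "check d v l u = fold (\<lambda>(as, c). fire (map (locate d (v, l, u)) as, locate d (v, l, u) c)) clauses"
    using True by (auto simp: check_def ranges_def)
  show ?thesis
    unfolding eq by (rule settles_mono[OF fold]) (use True in \<open>auto simp: rules_at_def\<close>)
next
  case False
  then have "\<not> (1 \<le> l \<and> l \<le> u \<and> u \<le> d)" using assms(2) by (simp add: ranges_def)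
  then show ?thesis using False by (auto simp: settles_def check_def rules_at_def intro: derives.stop)
qed

definition hall_rules_at :: "nat \<Rightarrow> nat \<Rightarrow> nat \<Rightarrow> (fact set \<times> fact) set" where
  "hall_rules_at n l u =
     {((\<lambda>v. ((v, l, u), 1)) ` S, ((w, l, u), 2)) | S w.
        S \<subseteq> {1..n} \<and> card S = u - l + 1 \<and> w \<in> {1..n} - S}"

lemma finite_inside: "finite (inside n l u T)"
  by (simp add: inside_def)

lemma hall_antecedents:
  assumes "\<forall>a\<in>(\<lambda>v. ((v, l, u), 1)) ` S. holds T a" "S \<subseteq> {1..n}"
  shows "S \<subseteq> inside n l u T"
  using assms by (auto simp: inside_def holds_def)

text \<open>The number of true ranges decides: below the size of the interval no Hall inference has
  its antecedents, above it there is a clash, and at equality the counted variables form the only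
  possible set of antecedents.\<close>

lemma check_hall_settles:
  assumes J: "inferences n d \<subseteq> J" and lu: "1 \<le> l" "l \<le> u" "u \<le> d"
  shows "settles J (hall_rules_at n l u) (check_hall n l u)"
proof -
  have rule: "((\<lambda>v. ((v, l, u), 1)) ` S, ((w, l, u), 2)) \<in> J"
    if "S \<subseteq> {1..n}" "card S = u - l + 1" "w \<in> {1..n} - S" for S w
    using J that lu unfolding inferences_def hall_inferences_def by blast
  have "derives J (T, q, f) (check_hall n l u (T, q, f)) \<and>
    (\<forall>i\<in>hall_rules_at n l u. settled (check_hall n l u (T, q, f)) i)" for T q f
  proof -
    let ?I = "inside n l u T"
    consider (many) "u - l + 1 < card ?I" | (full) "card ?I = u - l + 1" | (few) "card ?I < u - l + 1"
      by linarith
    then show ?thesis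
    proof cases
      case many
      then obtain S where S: "S \<subseteq> ?I" "card S = u - l + 1"
        by (metis less_imp_le obtain_subset_with_card_n)
      then obtain w where w: "w \<in> ?I - S" using many by (metis Diff_eq_empty_iff equals0I less_irrefl
          subset_antisym)
      \<comment> \<open>Raising the flag is justified as the post of a falsity for \<open>w\<close>,
        whose range is already true.\<close>
      have "derives J (T, q, f) (post ((w, l, u), 2) (T, q, f))"
      proof (rule derives.infer[OF derives.stop rule[of S w]])
        show "S \<subseteq> {1..n}" "w \<in> {1..n} - S" using S w by (auto simp: inside_def)
      qed (use S in \<open>auto simp: inside_def holds_def\<close>)
      moreover have "T (w, l, u) = 1" using w by (simp add: inside_def)
      ultimately show ?thesis using many by (simp add: check_hall_def settled_def)
    next
      case few
      have none: "\<not> (\<forall>a\<in>(\<lambda>v. ((v, l, u), 1)) ` S. holds T a)" if "S \<subseteq> {1..n}" "card S = u - l + 1" for S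
        using hall_antecedents[of l u S T n] that few card_mono[OF finite_inside, of S n l u T] by auto
      have "settled (T, q, f) i" if "i \<in> hall_rules_at n l u" for i
      proof -
        from that obtain S w where "i = ((\<lambda>v. ((v, l, u), 1)) ` S, ((w, l, u), 2))"
          "S \<subseteq> {1..n}" "card S = u - l + 1"
          unfolding hall_rules_at_def by blast
        with none[of S] show ?thesis unfolding settled_def by auto
      qed
      then show ?thesis using few by (simp add: check_hall_def derives.stop)
    next
      case full
      \<comment> \<open>Exclusions only make ranges false, so the set of true ranges counted
        beforehand stays valid as the antecedent of every exclusion in the loop.\<close>
      have fold: "derives J (T, q, f) (fold (exclude l u) ws (T, q, f)) \<and>
        inside n l u (fst (fold (exclude l u) ws (T, q, f))) = ?I \<and>
        (\<forall>w\<in>set ws. snd (snd (fold (exclude l u) ws (T, q, f))) \<or>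
           fst (fold (exclude l u) ws (T, q, f)) (w, l, u) \<in> {1, 2})"
        if "set ws \<subseteq> {1..n}" for ws
        using that
      proof (induction ws rule: rev_induct)
        case Nil
        show ?case by (simp add: derives.stop)
      next
        case (snoc w ws)
        obtain T' q' f' where eq: "fold (exclude l u) ws (T, q, f) = (T', q', f')"
          using prod_cases3 by blast
        have IH: "derives J (T, q, f) (T', q', f')" "inside n l u T' = ?I"
          "\<And>w. w \<in> set ws \<Longrightarrow> f' \<or> T' (w, l, u) \<in> {1, 2}" and w: "w \<in> {1..n}"
          using snoc unfolding eq by auto
        have step: "fold (exclude l u) (ws @ [w]) (T, q, f) = exclude l u w (T', q', f')"
          by (simp add: eq)
        show ?case
        proof (cases "T' (w, l, u) = 1")
          case True
          then have ex: "exclude l u w (T', q', f') = (T', q', f')" by (simp add: exclude_def)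
          show ?thesis unfolding step ex using IH True by auto
        next
          case False
          then have w': "w \<in> {1..n} - ?I" using w IH(2) by (auto simp: inside_def)
          have "derives J (T, q, f) (post ((w, l, u), 2) (T', q', f'))"
          proof (rule derives.infer[OF IH(1) rule[OF _ full w']])
            show "?I \<subseteq> {1..n}" by (auto simp: inside_def)
            fix a :: fact assume "a \<in> (\<lambda>v. ((v, l, u), 1)) ` ?I"
            then show "holds T' a" unfolding IH(2)[symmetric] by (auto simp: holds_def inside_def)
          qed
          moreover have "inside n l u (T'((w, l, u) := 2)) = ?I"
            using False IH(2) by (auto simp: inside_def)
          moreover have ex: "exclude l u w (T', q', f') = post ((w, l, u), 2) (T', q', f')"
            using False by (simp add: exclude_def)
          ultimately show ?thesis unfolding step ex using IH(2,3) by auto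
        qed
      qed
      define \<sigma> where "\<sigma> = fold (exclude l u) [1..<n + 1] (T, q, f)"
      obtain T' q' f' where eq: "\<sigma> = (T', q', f')" using prod_cases3 by blast
      have up: "set [1..<n + 1] = {1..n}" by auto
      have all: "derives J (T, q, f) (T', q', f')" "inside n l u T' = ?I"
          "\<And>w. w \<in> {1..n} \<Longrightarrow> f' \<or> T' (w, l, u) \<in> {1, 2}"
        using fold[of "[1..<n + 1]", folded \<sigma>_def, unfolded up eq fst_conv snd_conv, OF subset_refl]
        by blast+
      have "settled (T', q', f') i" if "i \<in> hall_rules_at n l u" for i
      proof -
        from that obtain S w where i: "i = ((\<lambda>v. ((v, l, u), 1)) ` S, ((w, l, u), 2))"
          and S: "S \<subseteq> {1..n}" "card S = u - l + 1" "w \<in> {1..n} - S"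
          unfolding hall_rules_at_def by blast
        have "f' \<or> T' (w, l, u) = 2" if "\<forall>a\<in>(\<lambda>v. ((v, l, u), 1)) ` S. holds T' a"
        proof -
          \<comment> \<open>Antecedents that hold have the same cardinality as the true ranges and
            so are all of them; \<open>w\<close> is then not among these and has been
            excluded.\<close>
          have "S \<subseteq> ?I" using hall_antecedents[OF that S(1)] all(2) by simp
          then have "S = ?I" using card_subset_eq[OF finite_inside] S(2) full by metis
          then have "T' (w, l, u) \<noteq> 1" using S(3) all(2) by (auto simp: inside_def)
          then show ?thesis using all(3)[of w] S(3) by auto
        qed
        then show ?thesis unfolding i by (auto simp: settled_def holds_def)
      qed
      moreover have "check_hall n l u (T, q, f) = \<sigma>" using full by (simp add: check_hall_def \<sigma>_def)
      ultimately show ?thesis using all(1) eq by simp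
    qed
  qed
  then show ?thesis by (rule settlesI)
qed

text \<open>Solves \<open>place\<close> for the range at which a clause is located. The cases
  \<open>Below\<close> and \<open>Above\<close> leave one end open, which is where the
  \<open>O(d)\<close> checks of a visit come from.\<close>

lemma place_touches:
  assumes "place d l u x = (p, q)" "1 \<le> l" "l \<le> u" "u \<le> d" "1 \<le> p" "p \<le> q" "q \<le> d"
  shows "(l, u) \<in> {(p, q), (p + 1, q), (p, q - 1)} \<union> {(q + 1, x) | x. x \<in> {1..d}} \<union>
    {(x, p - 1) | x. x \<in> {1..d}}"
  using assms by (cases x) auto

text \<open>When \<open>r\<close> leaves the queue, only inferences that mention \<open>r\<close>
  can lose their pending status. All of these are located at the ranges that the visit checks or
  belong to the interval of \<open>r\<close>.\<close>

lemma visit_settles: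
  assumes J: "inferences n d \<subseteq> J" and r: "r \<in> ranges n d"
  shows "settles J {i \<in> inferences n d. pending [r] i} (visit n d r)"
proof -
  obtain v p q where eq: "r = (v, p, q)" by (cases r)
  have v: "v \<in> {1..n}" and pq: "1 \<le> p" "p \<le> q" "q \<le> d" using r by (auto simp: eq ranges_def)
  note check = check_settles[OF J v]
  let ?K = "(((rules_at n d (v, p, q) \<union> rules_at n d (v, p + 1, q)) \<union> rules_at n d (v, p, q - 1)) \<union>
    (\<Union>x\<in>set [1..<d + 1]. rules_at n d (v, q + 1, x) \<union> rules_at n d (v, x, p - 1))) \<union>
    hall_rules_at n p q"
  have "settles J ?K (\<lambda>\<sigma>. check_hall n p q
       (fold (\<lambda>x \<sigma>. check d v x (p - 1) (check d v (q + 1) x \<sigma>)) [1..<d + 1]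
         (check d v p (q - 1) (check d v (p + 1) q (check d v p q \<sigma>)))))"
    by (intro settles_comp[where g = "\<lambda>\<sigma>. fold _ _ (_ \<sigma>)"] settles_comp[where h = "fold _ _"]
      settles_comp[where h = "check _ _ _ _"] settles_fold check check_hall_settles[OF J pq])
  moreover have "{i \<in> inferences n d. pending [r] i} \<subseteq> ?K"
  proof
    fix i assume i: "i \<in> {i \<in> inferences n d. pending [r] i}"
    obtain X c where Xc: "i = (X, c)" by (cases i)
    have inf: "(X, c) \<in> inferences n d" using i Xc by simp
    have "pending [r] (X, c)" using i by (simp add: Xc)
    then obtain a where "a \<in> insert c X" "fst a \<in> set [r]"
      unfolding pending_def case_prod_conv by blast
    then have a: "a \<in> insert c X" "fst a = r" by simp_all
    from inf show "i \<in> ?K"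
    proof (cases rule: inferences_cases)
      case (range v' l u as c')
      from a range(3,4) obtain y where "a = locate d (v', l, u) y" by blast
      then obtain x b where "a = locate d (v', l, u) (x, b)" by (cases y) blast
      then have "v' = v" "place d l u x = (p, q)" using a(2) by (auto simp: locate_def eq)
      moreover have "1 \<le> l" "l \<le> u" "u \<le> d" using range(1) by (auto simp: ranges_def)
      ultimately have lu: "(l, u) \<in> {(p, q), (p + 1, q), (p, q - 1)} \<union> {(q + 1, x) | x. x \<in> {1..d}} \<union>
        {(x, p - 1) | x. x \<in> {1..d}}" using place_touches[of d l u x p q] pq by blast
      have "i \<in> rules_at n d (v, l, u)"
        using range \<open>v' = v\<close> Xc by (auto simp: rules_at_def)
      moreover have "x \<in> set [1..<d + 1]" if "x \<in> {1..d}" for x using that by auto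
      ultimately show ?thesis using lu by blast
    next
      case (hall l u S w)
      then have "(l, u) = (p, q)" using a by (auto simp: eq)
      then have "i \<in> hall_rules_at n p q" using hall Xc unfolding hall_rules_at_def by blast
      then show ?thesis by blast
    qed
  qed
  ultimately show ?thesis unfolding visit_def eq case_prod_conv by (rule settles_mono)
qed

lemma clauses_proper: "(as, c) \<in> set clauses \<Longrightarrow> (\<forall>a\<in>set as. snd a \<noteq> 0) \<and> snd c \<in> {1, 2}"
  by (auto simp: clauses_def)

lemma place_admissible:
  assumes "(v, l, u) \<in> ranges n d"
  shows "(v, place d l u x) \<in> ranges n d \<or> border n d (v, place d l u x) \<noteq> 0"
proof -
  have v: "v \<in> {1..n}" and lu: "1 \<le> l" "l \<le> u" "u \<le> d" using assms by (auto simp: ranges_def)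
  then show ?thesis by (cases x; cases "l = 1"; cases "u = d") (auto simp: ranges_def border_def)
qed

lemma proper_inferences: "proper_rules n d (inferences n d)"
  unfolding proper_rules_def
proof clarify
  fix X r b assume "(X, r, b) \<in> inferences n d"
  then show "admissible n d (r, b) \<and> (\<forall>a\<in>X. snd a \<noteq> 0)"
  proof (cases rule: inferences_cases)
    case (range v l u as c)
    obtain x b' where c: "c = (x, b')" by (cases c)
    have "r = (v, place d l u x)" "b = b'" using range(4) by (simp_all add: locate_def c)
    then have "admissible n d (r, b)"
      using clauses_proper[OF range(2)] place_admissible[OF range(1), of x] by (simp add: admissible_def c)
    moreover have "\<forall>a\<in>X. snd a \<noteq> 0"
      using clauses_proper[OF range(2)] unfolding range(3) by (auto simp: locate_def split: prod.splits)
    ultimately show ?thesis ..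
  next
    case (hall l u S w)
    then show ?thesis by (auto simp: admissible_def ranges_def)
  qed
qed

text \<open>Every assigned range is queued, so an inference that fires on an antecedent inside the
  triangle is pending. Border values alone satisfy the antecedents of a clause only for the full
  range, whose rule has an empty body; hence the full ranges are queued from the start.\<close>

lemma settled_initially:
  assumes wf: "well_formed n d (T, q, f)" and "1 \<le> d"
    and fresh: "\<And>r. r \<in> ranges n d \<Longrightarrow> T r \<noteq> 0 \<Longrightarrow> r \<in> set q"
    and full: "\<And>v. v \<in> {1..n} \<Longrightarrow> (v, 1, d) \<in> set q"
    and i: "i \<in> inferences n d"
  shows "settled (T, q, f) i"
proof -
  obtain X c where Xc: "i = (X, c)" by (cases i)
  have inf: "(X, c) \<in> inferences n d" using i Xc by simp
  have "pending q (X, c)" if X: "\<forall>a\<in>X. holds T a"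
    using inf
  proof (cases rule: inferences_cases)
    case (range v l u as c')
    have v: "v \<in> {1..n}" and lu: "1 \<le> l" "l \<le> u" "u \<le> d" using range(1) by (auto simp: ranges_def)
    have rng: "1 < l \<Longrightarrow> (v, 1, l - 1) \<in> ranges n d" "1 < l \<Longrightarrow> (v, l - 1, u) \<in> ranges n d"
      "u < d \<Longrightarrow> (v, u + 1, d) \<in> ranges n d" "u < d \<Longrightarrow> (v, l, u + 1) \<in> ranges n d"
      using v lu by (auto simp: ranges_def)
    have bd: "T r = border n d r" if "r \<notin> ranges n d" for r
      using wf that by (auto simp: well_formed_def bordered_def)
    have ante: "T (v, place d l u x) = b" if "(x, b) \<in> set as" for x b
      using X that range(3) by (auto simp: holds_def locate_def)
    have pend: "pending q (X, c)" if "(x, b) \<in> set as" "(v, place d l u x) \<in> ranges n d" for x b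
    proof -
      have "b \<noteq> 0" using clauses_proper[OF range(2)] that(1) by force
      then have "(v, place d l u x) \<in> set q" using fresh[OF that(2)] ante[OF that(1)] by simp
      moreover have "((v, place d l u x), b) \<in> X" using range(3) that(1) by (force simp: locate_def)
      ultimately show ?thesis by (force simp: pending_def)
    qed
    have self: "pending q (X, c)" if "(Self, b) \<in> set as" for b
      using pend[OF that] range(1) by simp
    consider "(Self, 1) \<in> set as \<or> (Self, 2) \<in> set as" | "as = [(Below, 2), (Above, 2)]" "c' = (Self, 1)"
      | "as = [(Below, 1)]" | "as = [(Above, 1)]" | "as = [(Left, 2)]" | "as = [(Right, 2)]"
      using range(2) by (auto simp: clauses_def)
    then show ?thesis
    proof cases
      case 1
      then show ?thesis using self by blast
    next
      case 2
      consider "1 < l" | "u < d" | "l = 1" "u = d" using lu by linarith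
      then show ?thesis
      proof cases
        case 1
        then show ?thesis using pend[of Below 2] 2 rng by simp
      next
        case u: 2
        then show ?thesis using pend[of Above 2] 2 rng by simp
      next
        case 3
        then show ?thesis using full[OF v] 2 range(4) by (auto simp: pending_def locate_def)
      qed
    next
      case 3
      have "1 < l" using ante[of Below 1] 3 bd[of "(v, 1, 0)"] v lu
        by (cases "l = 1") (auto simp: ranges_def border_def)
      then show ?thesis using pend[of Below 1] 3 rng by simp
    next
      case 4
      have "u < d" using ante[of Above 1] 4 bd[of "(v, d + 1, d)"] v lu
        by (cases "u = d") (auto simp: ranges_def border_def)
      then show ?thesis using pend[of Above 1] 4 rng by simp
    next
      case 5
      have "1 < l" using ante[of Left 2] 5 bd[of "(v, 0, u)"] v lu
        by (cases "l = 1") (auto simp: ranges_def border_def)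
      then show ?thesis using pend[of Left 2] 5 rng by simp
    next
      case 6
      have "u < d" using ante[of Right 2] 6 bd[of "(v, l, d + 1)"] v lu
        by (cases "u = d") (auto simp: ranges_def border_def)
      then show ?thesis using pend[of Right 2] 6 rng by simp
    qed
  next
    case (hall l u S w)
    then have "S \<noteq> {}" by auto
    then obtain v where v: "v \<in> S" by blast
    have "(v, l, u) \<in> ranges n d" using v hall by (auto simp: ranges_def)
    moreover have "T (v, l, u) = 1" using X v hall(1) by (auto simp: holds_def)
    ultimately have "(v, l, u) \<in> set q" using fresh by simp
    moreover have "((v, l, u), 1) \<in> X" using v hall(1) by blast
    ultimately show ?thesis by (force simp: pending_def)
  qed
  then show ?thesis by (auto simp: Xc settled_def)
qed

section \<open>A finished propagation has reached the fixpoint\<close>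

lemma readout_mono:
  assumes "\<And>r. T r \<noteq> 0 \<Longrightarrow> T' r = T r"
  shows "readout n d T \<subseteq> readout n d T'"
proof -
  have "T' r = code b" if "T r = code b" for r b using assms[of r] that by (simp add: code_def)
  then show ?thesis unfolding readout_def by blast
qed

text \<open>Without the flag the final valuation is closed, so its readout contains the fixpoint and
  excludes a conflict; soundness bounds the valuation from the other side. With the flag there can
  be no sound target, hence no conflict-free fixpoint.\<close>

lemma propagator_correct:
  assumes nd: "1 \<le> n" "1 \<le> d" and A: "consistent A" "(At Violate, False) \<in> unit_prop N A"
    and N: "N = nogoods (all_different_prog n d)"
    and wf: "well_formed n d (T, q, f)"
    and snd: "\<not> conflict N (unit_prop N A) \<Longrightarrow> sound (shown n d (unit_prop N A)) (T, q, f)"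
    and fin: "f \<or> q = [] \<and> (\<forall>i\<in>inferences n d. settled (T, q, f) i) \<and> A \<subseteq> readout n d T"
  shows "conflict N (unit_prop N A) \<longleftrightarrow> f"
    and "\<not> f \<Longrightarrow> T = shown n d (unit_prop N A)" and "\<not> f \<Longrightarrow> unit_prop N A = readout n d T"
proof -
  let ?U = "unit_prop N A" and ?V = "shown n d (unit_prop N A)"
  have main: "\<not> conflict N ?U \<and> T = ?V \<and> ?U = readout n d T" if nf: "\<not> f"
  proof -
    have "closed_under (inferences n d) T"
      using fin nf by (auto simp: closed_under_def settled_def pending_def)
    moreover have bd: "bordered n d T" using wf by (simp add: well_formed_def)
    ultimately have sub: "?U \<subseteq> readout n d T" "\<not> conflict N ?U"
      using unit_prop_subset_readout[OF _ _ nd] fin nf N by blast+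
    interpret conflict_free_fixpoint n d N ?U A
      unfolding N using nd A sub(2) by unfold_locales (auto simp: N)
    have V: "T r = ?V r" if "T r \<noteq> 0" for r using snd[OF sub(2)] that by (simp add: sound_def)
    have "T r = ?V r" for r
    proof (cases "r \<in> ranges n d \<and> T r = 0")
      \<comment> \<open>Soundness says nothing about unassigned ranges. Here the readout, which
        contains the fixpoint, shows that the fixpoint leaves the atom open too.\<close>
      case True
      obtain v l u where r: "r = (v, l, u)" by (cases r)
      have "(At (R v l u), b) \<notin> readout n d T" for b using True by (cases b) (simp_all add: r)
      then have "(At (R v l u), b) \<notin> ?U" for b using sub(1) by blast
      then show ?thesis using True by (simp add: r shown_def truth_code_def)
    next
      case False
      then show ?thesis using V bd bordered_shown[of n d ?U] by (cases "r \<in> ranges n d") (auto simp: bordered_def)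
    qed
    then have "T = ?V" by blast
    then show ?thesis using sub readout_shown by auto
  qed
  have "conflict N ?U" if f using snd that by (auto simp: sound_def)
  with main show "conflict N ?U \<longleftrightarrow> f" by blast
  from main show "\<not> f \<Longrightarrow> T = ?V" "\<not> f \<Longrightarrow> ?U = readout n d T" by blast+
qed

section \<open>Executing programs within a time bound\<close>

fun loop_free :: "com \<Rightarrow> bool" where
  "loop_free (Seq p q) \<longleftrightarrow> loop_free p \<and> loop_free q"
| "loop_free (If b p q) \<longleftrightarrow> loop_free p \<and> loop_free q"
| "loop_free (While b p) \<longleftrightarrow> False"
| "loop_free _ \<longleftrightarrow> True"

fun effect :: "com \<Rightarrow> store \<Rightarrow> store" where
  "effect Skip s = s"
| "effect (Assign es e) s = s(map (\<lambda>e. eval e s) es := eval e s)"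
| "effect (Seq p q) s = effect q (effect p s)"
| "effect (If b p q) s = (if beval b s then effect p s else effect q s)"
| "effect (While b p) s = s"

fun worst :: "com \<Rightarrow> nat" where
  "worst Skip = 1"
| "worst (Assign es e) = 1 + sum_list (map ecost es) + ecost e"
| "worst (Seq p q) = 1 + worst p + worst q"
| "worst (If b p q) = 1 + bcost b + worst p + worst q"
| "worst (While b p) = 0"

lemma exec_loop_free: "loop_free p \<Longrightarrow> \<exists>t\<le>worst p. exec p s t (effect p s)"
proof (induction p arbitrary: s)
  case Skip
  then show ?case using exec.skip by auto
next
  case (Assign es e)
  show ?case using exec.assign[of es e s] by (intro exI[of _ "worst (Assign es e)"]) (simp add: fun_upd_def)
next
  case (Seq p q)
  then obtain t where t: "t \<le> worst p" "exec p s t (effect p s)" by (meson loop_free.simps(1))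
  from Seq obtain t' where t': "t' \<le> worst q" "exec q (effect p s) t' (effect q (effect p s))"
    by (meson loop_free.simps(1))
  show ?case using exec.seq[OF t(2) t'(2)] t(1) t'(1) by (intro exI[of _ "1 + t + t'"]) simp
next
  case (If b p q)
  then obtain t where t: "t \<le> worst p" "exec p s t (effect p s)" by (meson loop_free.simps(2))
  from If obtain t' where t': "t' \<le> worst q" "exec q s t' (effect q s)" by (meson loop_free.simps(2))
  show ?case
  proof (cases "beval b s")
    case True
    then show ?thesis using exec.if_true[OF True t(2)] t(1) by (intro exI[of _ "1 + bcost b + t"]) auto
  next
    case False
    then show ?thesis using exec.if_false[OF False t'(2)] t'(1) by (intro exI[of _ "1 + bcost b + t'"]) auto
  qed
qed simp

definition within :: "nat \<Rightarrow> com \<Rightarrow> store \<Rightarrow> (store \<Rightarrow> bool) \<Rightarrow> bool" where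
  "within c p s Q \<longleftrightarrow> (\<exists>t s'. exec p s t s' \<and> t \<le> c \<and> Q s')"

lemma within_loop_free: "loop_free p \<Longrightarrow> Q (effect p s) \<Longrightarrow> worst p \<le> c \<Longrightarrow> within c p s Q"
  using exec_loop_free[of p s] unfolding within_def by (meson order_trans)

lemma within_mono: "within c p s Q \<Longrightarrow> c \<le> c' \<Longrightarrow> (\<And>s'. Q s' \<Longrightarrow> Q' s') \<Longrightarrow> within c' p s Q'"
  unfolding within_def by (meson order_trans)

lemma within_seq:
  assumes "within c p s (\<lambda>s'. within c' q s' Q)"
  shows "within (1 + c + c') (Seq p q) s Q"
proof -
  from assms obtain t s' t' s'' where "exec p s t s'" "t \<le> c" "exec q s' t' s''" "t' \<le> c'" "Q s''"
    unfolding within_def by blast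
  then show ?thesis using exec.seq[of p s t s' q t' s''] unfolding within_def
    by (intro exI[of _ "1 + t + t'"] exI[of _ s'']) auto
qed

lemma within_if:
  assumes "beval b s \<Longrightarrow> within c p s Q" "\<not> beval b s \<Longrightarrow> within c q s Q"
  shows "within (1 + bcost b + c) (If b p q) s Q"
proof (cases "beval b s")
  case True
  then obtain t s' where "exec p s t s'" "t \<le> c" "Q s'" using assms unfolding within_def by blast
  then show ?thesis using exec.if_true[OF True] unfolding within_def
    by (intro exI[of _ "1 + bcost b + t"] exI[of _ s']) auto
next
  case False
  then obtain t s' where "exec q s t s'" "t \<le> c" "Q s'" using assms unfolding within_def by blast
  then show ?thesis using exec.if_false[OF False] unfolding within_def
    by (intro exI[of _ "1 + bcost b + t"] exI[of _ s']) auto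
qed

abbreviation reg :: "nat \<Rightarrow> exp" where
  "reg k \<equiv> Cell [Const k]"

definition for_upto :: "nat \<Rightarrow> nat \<Rightarrow> com \<Rightarrow> com" where
  "for_upto x y p = Seq (Assign [Const x] (Const 1))
     (While (Not (Less (reg y) (reg x))) (Seq p (Assign [Const x] (Succ (reg x)))))"

text \<open>A loop test costs 7, the increment with its sequencing 6 and the initialisation 4. The
  total \<open>11 + m * (c + 13)\<close> is rounded up to a single product, which makes bounds for
  nested loops easy to combine.\<close>

lemma within_for:
  assumes xy: "x \<noteq> y" "s [y] = m" and start: "I 1 (s([x] := 1))"
    and body: "\<And>i s. 1 \<le> i \<Longrightarrow> i \<le> m \<Longrightarrow> I i s \<Longrightarrow> s [x] = i \<Longrightarrow> s [y] = m \<Longrightarrow>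
      within c p s (\<lambda>s'. s' [x] = i \<and> s' [y] = m \<and> I (i + 1) (s'([x] := i + 1)))"
  shows "within ((c + 20) * (m + 1)) (for_upto x y p) s (I (m + 1))"
proof -
  let ?b = "Not (Less (reg y) (reg x))"
  let ?loop = "While ?b (Seq p (Assign [Const x] (Succ (reg x))))"
  have cost: "1 + bcost ?b = 7" by (simp add: eval_nat_numeral)
  have loop: "within (7 + k * (c + 13)) ?loop s (I (m + 1))"
    if "I i s" "s [x] = i" "s [y] = m" "1 \<le> i" "i + k = m + 1" for k i s
    using that
  proof (induction k arbitrary: i s)
    case 0
    then have "\<not> beval ?b s" by simp
    from exec.while_false[OF this] have "exec ?loop s 7 s" unfolding cost .
    then show ?case using 0 unfolding within_def by (intro exI[of _ 7] exI[of _ s]) simp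
  next
    case (Suc k)
    then have b: "beval ?b s" by simp
    have "within c p s (\<lambda>s'. s' [x] = i \<and> s' [y] = m \<and> I (i + 1) (s'([x] := i + 1)))"
      using Suc.prems by (intro body) auto
    then obtain t s' where t: "exec p s t s'" "t \<le> c" and s': "s' [x] = i" "s' [y] = m"
      "I (i + 1) (s'([x] := i + 1))" unfolding within_def by blast
    have "exec (Assign [Const x] (Succ (reg x))) s' 5 (s'([x] := i + 1))"
      using exec.assign[of "[Const x]" "Succ (reg x)" s'] s'(1) by (simp add: eval_nat_numeral)
    from exec.seq[OF t(1) this]
    have seq: "exec (Seq p (Assign [Const x] (Succ (reg x)))) s (t + 6) (s'([x] := i + 1))"
      by (simp add: eval_nat_numeral)
    have "within (7 + k * (c + 13)) ?loop (s'([x] := i + 1)) (I (m + 1))"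
    proof (rule Suc.IH[of "i + 1"])
      show "I (i + 1) (s'([x] := i + 1))" by fact
    qed (use Suc.prems s' xy(1) in auto)
    then obtain t' s'' where t': "exec ?loop (s'([x] := i + 1)) t' s''" "t' \<le> 7 + k * (c + 13)"
      "I (m + 1) s''" unfolding within_def by blast
    have "1 + bcost ?b + (t + 6) + t' = 13 + t + t'" using cost by linarith
    then have "exec ?loop s (13 + t + t') s''" using exec.while_true[OF b seq t'(1)] by metis
    then show ?case using t(2) t'(2,3) unfolding within_def
      by (intro exI[of _ "13 + t + t'"] exI[of _ s'']) auto
  qed
  have "within (1 + 3 + (7 + m * (c + 13))) (for_upto x y p) s (I (m + 1))"
    unfolding for_upto_def
  proof (rule within_seq, rule within_loop_free)
    have "effect (Assign [Const x] (Const 1)) s = s([x] := 1)" by simp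
    moreover have "within (7 + m * (c + 13)) ?loop (s([x] := 1)) (I (m + 1))"
      by (rule loop[of 1]) (use xy start in auto)
    ultimately show "within (7 + m * (c + 13)) ?loop (effect (Assign [Const x] (Const 1)) s) (I (m + 1))"
      by (simp only:)
  qed auto
  then show ?thesis by (rule within_mono) (auto simp: algebra_simps)
qed

text \<open>The loop is specified as a fold over an abstract state \<open>a\<close>. By
  \<open>stable\<close> the relation between store and state ignores the counter, so the invariant
  survives its increments.\<close>

lemma within_for_fold:
  assumes "x \<noteq> y" "s [y] = m" and "P s a"
    and stable: "\<And>s a k. P s a \<Longrightarrow> P (s([x] := k)) a"
    and body: "\<And>i s a. 1 \<le> i \<Longrightarrow> i \<le> m \<Longrightarrow> P s a \<Longrightarrow> s [x] = i \<Longrightarrow> s [y] = m \<Longrightarrow>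
      within c p s (\<lambda>s'. s' [x] = i \<and> s' [y] = m \<and> P s' (g i a))"
  shows "within ((c + 20) * (m + 1)) (for_upto x y p) s (\<lambda>s'. P s' (fold g [1..<m + 1] a))"
proof -
  let ?I = "\<lambda>i s. P s (fold g [1..<i] a)"
  have "within ((c + 20) * (m + 1)) (for_upto x y p) s (?I (m + 1))"
  proof (rule within_for[where I = ?I and s = s and m = m and x = x and y = y, OF assms(1,2)])
    have eq: "fold g [1..<1] a = a" by simp
    show "?I 1 (s([x] := 1))" unfolding eq by (rule stable[OF \<open>P s a\<close>])
    fix i s assume i: "1 \<le> i" "i \<le> m" "?I i s" "s [x] = i" "s [y] = m"
    have "[1..<i + 1] = [1..<i] @ [i]" using i(1) by simp
    then have eq: "fold g [1..<i + 1] a = g i (fold g [1..<i] a)" by simp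
    show "within c p s (\<lambda>s'. s' [x] = i \<and> s' [y] = m \<and> ?I (i + 1) (s'([x] := i + 1)))"
      unfolding eq by (rule within_mono[OF body[OF i]]) (blast intro: stable)+
  qed
  then show ?thesis .
qed

text \<open>Time is measured in multiples of a unit \<open>D\<close>, such as \<open>d + 1\<close>
  for a visit. As \<open>D\<close> is at least 1, it absorbs all constant costs, and the factors
  depend on the program text only.\<close>

lemma within_cheap_seq:
  assumes "within (K * D) p s (\<lambda>s'. within (K' * D) q s' Q)" "1 \<le> D"
  shows "within ((1 + K + K') * D) (Seq p q) s Q"
  by (rule within_mono[OF within_seq[OF assms(1)]]) (use assms(2) in \<open>auto simp: algebra_simps\<close>)

lemma within_cheap_if:
  assumes "beval b s \<Longrightarrow> within (K * D) p s Q" "\<not> beval b s \<Longrightarrow> within (K' * D) q s Q" "1 \<le> D"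
  shows "within ((1 + bcost b + K + K') * D) (If b p q) s Q"
proof -
  have "K * D \<le> (K + K') * D" "K' * D \<le> (K + K') * D" by simp_all
  then have "within (1 + bcost b + (K + K') * D) (If b p q) s Q"
    using assms(1,2) within_mono by (intro within_if) blast+
  moreover have "1 + bcost b + (K + K') * D \<le> (1 + bcost b + K + K') * D"
    using mult_le_mono2[OF assms(3), of "1 + bcost b"] by (simp add: algebra_simps)
  ultimately show ?thesis using within_mono by blast
qed

lemma within_cheap_loop_free:
  assumes "loop_free p" "Q (effect p s)" "1 \<le> D"
  shows "within (worst p * D) p s Q"
  using assms by (intro within_loop_free) auto

text \<open>A loop enlarges the unit by a bound \<open>M\<close> on its length, while its own
  overhead goes into the factor.\<close>

lemma within_cheap_for_fold:
  assumes "x \<noteq> y" "s [y] = m" "P s a" "m + 1 \<le> M" "1 \<le> D"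
    and "\<And>s a k. P s a \<Longrightarrow> P (s([x] := k)) a"
    and "\<And>i s a. 1 \<le> i \<Longrightarrow> i \<le> m \<Longrightarrow> P s a \<Longrightarrow> s [x] = i \<Longrightarrow> s [y] = m \<Longrightarrow>
      within (K * D) p s (\<lambda>s'. s' [x] = i \<and> s' [y] = m \<and> P s' (g i a))"
  shows "within ((K + 20) * (M * D)) (for_upto x y p) s (\<lambda>s'. P s' (fold g [1..<m + 1] a))"
proof -
  have "within ((K * D + 20) * (m + 1)) (for_upto x y p) s (\<lambda>s'. P s' (fold g [1..<m + 1] a))"
    using assms(1,2,3,6,7) by (rule within_for_fold)
  moreover have "(K * D + 20) * (m + 1) \<le> ((K + 20) * D) * M"
    using assms(4,5) by (intro mult_le_mono) (auto simp: algebra_simps)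
  ultimately show ?thesis by (auto elim!: within_mono simp: mult_ac)
qed


section \<open>The propagator as a program\<close>

text \<open>The bodies that are false along every conflict-free branch are written once at the root.
  The whole cube is filled, including triples that belong to no body, so that the loops need no
  comparison of \<open>l\<close> and \<open>u\<close>.\<close>

definition constant_cells :: "nat \<Rightarrow> nat \<Rightarrow> store \<Rightarrow> bool" where
  "constant_cells n d s \<longleftrightarrow>
     s [9, 1, 0, 0, 0] = 1 \<and> s [9, 2, 0, 0, 0] = 2 \<and> s [9, 3, 0, 0, 0] = 2 \<and> s [14] = 1 \<and> s [15] = 2 \<and>
     (\<forall>v\<in>{1..n}. \<forall>l\<in>{1..d}. \<forall>u\<in>{1..d}. s [11, v, l, u] = 2 \<and> s [12, v, l, u] = 2 \<and> s [13, l, u] = 2)"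

text \<open>Cell \<open>[16]\<close> is the length of the queue, \<open>[17, k]\<close> to \<open>[19, k]\<close> its entries. The truth value of
  the body of \<open>r(v,l,u)\<close> always equals that of \<open>r(v,l,u)\<close>.\<close>

definition represents :: "nat \<Rightarrow> nat \<Rightarrow> pstate \<Rightarrow> store \<Rightarrow> bool" where
  "represents n d = (\<lambda>(T, q, f) s.
     s [0] = n \<and> s [1] = d \<and> s [2] = (if f then 1 else 0) \<and>
     (\<forall>v l u. s [9, 0, v, l, u] = T (v, l, u)) \<and> (\<forall>v l u. s [10, v, l, u] = T (v, l, u)) \<and>
     s [16] = length q \<and> (\<forall>k<length q. (s [17, k], s [18, k], s [19, k]) = q ! k) \<and>
     constant_cells n d s)"

text \<open>The domain cells are included because the removals at the root still read them after
  earlier posts.\<close>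

definition frame :: "nat set \<Rightarrow> store \<Rightarrow> store \<Rightarrow> bool" where
  "frame K s s' \<longleftrightarrow> (\<forall>k. k \<notin> K \<longrightarrow> s' [k] = s [k]) \<and> (\<forall>v i. s' [8, v, i] = s [8, v, i])"

lemma frame_trans: "frame K s s' \<Longrightarrow> frame K s' s'' \<Longrightarrow> frame K s s''"
  by (simp add: frame_def)

lemma frame_refl: "frame K s s"
  by (simp add: frame_def)

lemma represents_reg:
  "k \<notin> {0, 1, 2, 14, 15, 16} \<Longrightarrow> represents n d \<sigma> (s([k] := x)) \<longleftrightarrow> represents n d \<sigma> s"
  by (cases \<sigma>) (simp add: represents_def constant_cells_def)

section \<open>Posting, firing and checking on the store\<close>

definition post_core :: "nat \<Rightarrow> com" where
  "post_core b =
     If (Eq (Cell [Const 9, Const 0, reg 25, reg 26, reg 27]) (Const 0))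
       (Seq (Assign [Const 9, Const 0, reg 25, reg 26, reg 27] (Const b))
       (Seq (Assign [Const 10, reg 25, reg 26, reg 27] (Const b))
       (Seq (Assign [Const 17, reg 16] (reg 25))
       (Seq (Assign [Const 18, reg 16] (reg 26))
       (Seq (Assign [Const 19, reg 16] (reg 27))
         (Assign [Const 16] (Succ (reg 16))))))))
       (If (Eq (Cell [Const 9, Const 0, reg 25, reg 26, reg 27]) (Const b)) Skip
         (Assign [Const 2] (Const 1)))"

definition post_com :: "exp \<Rightarrow> exp \<Rightarrow> exp \<Rightarrow> nat \<Rightarrow> com" where
  "post_com ve le ue b =
     Seq (Assign [Const 25] ve) (Seq (Assign [Const 26] le) (Seq (Assign [Const 27] ue) (post_core b)))"

text \<open>The arguments of a post are copied to cells 25 to 27 one after the other, so the later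
  expressions are evaluated when earlier copies have already been written.\<close>

definition clean :: "exp \<Rightarrow> bool" where
  "clean e \<longleftrightarrow> (\<forall>s x k. k \<in> {25, 26, 27} \<longrightarrow> eval e (s([k] := x)) = eval e s)"

lemma post_core_effect:
  assumes "represents n d \<sigma> s" "s [25] = v" "s [26] = l" "s [27] = u"
  shows "represents n d (post ((v, l, u), b) \<sigma>) (effect (post_core b) s)"
    and "frame {2, 16} s (effect (post_core b) s)"
proof -
  obtain T q f where \<sigma>: "\<sigma> = (T, q, f)" by (cases \<sigma>)
  note rep = assms(1)[unfolded \<sigma> represents_def prod.case]
  have T: "s [9, 0, v, l, u] = T (v, l, u)" using rep by blast
  consider (new) "T (v, l, u) = 0" | (same) "T (v, l, u) \<noteq> 0" "T (v, l, u) = b"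
    | (clash) "T (v, l, u) \<noteq> 0" "T (v, l, u) \<noteq> b" by blast
  then have "represents n d (post ((v, l, u), b) \<sigma>) (effect (post_core b) s) \<and>
    frame {2, 16} s (effect (post_core b) s)"
  proof cases
    case new
    let ?s' = "s([9, 0, v, l, u] := b, [10, v, l, u] := b, [17, length q] := v, [18, length q] := l,
      [19, length q] := u, [16] := length q + 1)"
    have eff: "effect (post_core b) s = ?s'"
      using new T assms(2-4) rep by (simp add: post_core_def)
    have queue: "(?s' [17, k], ?s' [18, k], ?s' [19, k]) = (q @ [(v, l, u)]) ! k"
      if k: "k < length (q @ [(v, l, u)])" for k
    proof -
      have "k < length q \<Longrightarrow> (s [17, k], s [18, k], s [19, k]) = q ! k" using rep by blast
      then show ?thesis using k by (cases "k = length q") (simp_all add: nth_append)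
    qed
    have "constant_cells n d ?s'" using rep by (simp add: constant_cells_def)
    moreover have "\<forall>v' l' u'. ?s' [9, 0, v', l', u'] = (T((v, l, u) := b)) (v', l', u')"
      "\<forall>v' l' u'. ?s' [10, v', l', u'] = (T((v, l, u) := b)) (v', l', u')"
      "?s' [0] = n" "?s' [1] = d" "?s' [2] = (if f then 1 else 0)" "?s' [16] = length (q @ [(v, l, u)])"
      using rep by simp_all
    ultimately have "represents n d (T((v, l, u) := b), q @ [(v, l, u)], f) ?s'"
      unfolding represents_def prod.case using queue by blast
    moreover have "frame {2, 16} s ?s'" by (simp add: frame_def)
    ultimately show ?thesis using new by (simp only: eff \<sigma> post.simps if_True simp_thms)
  next
    case same
    then have eff: "effect (post_core b) s = s" using T assms(2-4) by (simp add: post_core_def)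
    show ?thesis unfolding eff using same assms(1) by (simp add: \<sigma> frame_refl)
  next
    case clash
    then have eff: "effect (post_core b) s = s([2] := 1)" using T assms(2-4) by (simp add: post_core_def)
    have "represents n d (T, q, True) (s([2] := 1))"
      using rep unfolding represents_def prod.case by (simp add: constant_cells_def)
    then show ?thesis unfolding eff using clash by (simp add: \<sigma> frame_def)
  qed
  then show "represents n d (post ((v, l, u), b) \<sigma>) (effect (post_core b) s)"
    "frame {2, 16} s (effect (post_core b) s)" by blast+
qed

lemma post_com_effect:
  assumes rep: "represents n d \<sigma> s" and cl: "clean le" "clean ue"
  shows "represents n d (post ((eval ve s, eval le s, eval ue s), b) \<sigma>) (effect (post_com ve le ue b) s)"
    and "frame {2, 16, 25, 26, 27} s (effect (post_com ve le ue b) s)"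
proof -
  let ?s = "s([25] := eval ve s, [26] := eval le s, [27] := eval ue s)"
  have eff: "effect (post_com ve le ue b) s = effect (post_core b) ?s"
    using cl by (simp add: post_com_def clean_def)
  have rep': "represents n d \<sigma> ?s" using rep by (simp add: represents_reg)
  show "represents n d (post ((eval ve s, eval le s, eval ue s), b) \<sigma>) (effect (post_com ve le ue b) s)"
    unfolding eff by (rule post_core_effect(1)[OF rep']) simp_all
  have "frame {2, 16} ?s (effect (post_core b) ?s)" by (rule post_core_effect(2)[OF rep']) simp_all
  then show "frame {2, 16, 25, 26, 27} s (effect (post_com ve le ue b) s)"
    unfolding eff by (simp add: frame_def)
qed

lemma loop_free_post_com [simp]: "loop_free (post_com ve le ue b)"
  by (simp add: post_com_def post_core_def)

fun place_exp :: "pos \<Rightarrow> exp \<times> exp" where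
  "place_exp Self = (reg 23, reg 24)"
| "place_exp Below = (Const 1, Pred (reg 23))"
| "place_exp Above = (Succ (reg 24), reg 1)"
| "place_exp Left = (Pred (reg 23), reg 24)"
| "place_exp Right = (reg 23, Succ (reg 24))"

fun guard :: "(pos \<times> nat) list \<Rightarrow> bexp" where
  "guard [] = Eq (Const 0) (Const 0)"
| "guard ((x, b) # as) =
     And (Eq (Cell [Const 9, Const 0, reg 20, fst (place_exp x), snd (place_exp x)]) (Const b)) (guard as)"

fun fire_com :: "(pos \<times> nat) list \<times> pos \<times> nat \<Rightarrow> com" where
  "fire_com (as, x, b) = If (guard as) (post_com (reg 20) (fst (place_exp x)) (snd (place_exp x)) b) Skip"

fun seqs :: "com list \<Rightarrow> com" where
  "seqs [] = Skip"
| "seqs (p # ps) = Seq p (seqs ps)"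

text \<open>Cells 23 and 24 hold the range under examination, while cells 20 to 22 keep the variable
  and the range being visited.\<close>

definition check_com :: "exp \<Rightarrow> exp \<Rightarrow> com" where
  "check_com le ue = Seq (Assign [Const 23] le) (Seq (Assign [Const 24] ue)
     (If (And (Less (Const 0) (reg 23)) (And (Not (Less (reg 24) (reg 23))) (Not (Less (reg 1) (reg 24)))))
       (seqs (map fire_com clauses)) Skip))"

lemma place_exp_clean: "clean (fst (place_exp x))" "clean (snd (place_exp x))"
  by (cases x; simp add: clean_def)+

lemma place_exp_eval:
  assumes "s [23] = l" "s [24] = u" "s [1] = d"
  shows "(eval (fst (place_exp x)) s, eval (snd (place_exp x)) s) = place d l u x"
  using assms by (cases x) simp_all

lemma fire_com_effect:
  assumes rep: "represents n d \<sigma> s" and regs: "s [20] = v" "s [23] = l" "s [24] = u"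
  shows "represents n d (fire (map (locate d (v, l, u)) as, locate d (v, l, u) c) \<sigma>) (effect (fire_com (as, c)) s)
    \<and> frame {2, 16, 25, 26, 27} s (effect (fire_com (as, c)) s)"
proof -
  obtain T q f where \<sigma>: "\<sigma> = (T, q, f)" by (cases \<sigma>)
  obtain x b where c: "c = (x, b)" by (cases c)
  have d: "s [1] = d" and T: "\<And>v l u. s [9, 0, v, l, u] = T (v, l, u)"
    using rep by (simp_all add: \<sigma> represents_def)
  note place = place_exp_eval[OF regs(2,3) d]
  have guard: "beval (guard as) s \<longleftrightarrow> (\<forall>a\<in>set (map (locate d (v, l, u)) as). holds T a)"
  proof (induction as)
    case (Cons a as)
    obtain y b' where a: "a = (y, b')" by (cases a)
    have "T (v, place d l u y) = s [9, 0, v, eval (fst (place_exp y)) s, eval (snd (place_exp y)) s]"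
      unfolding T place[of y, symmetric] ..
    then show ?case using Cons by (simp add: a holds_def locate_def regs)
  qed simp
  have "eval (reg 20) s = v" using regs by simp
  then have pc: "((eval (reg 20) s, eval (fst (place_exp x)) s, eval (snd (place_exp x)) s), b) = locate d (v, l, u) c"
    using place[of x] by (simp add: c locate_def)
  show ?thesis
  proof (cases "beval (guard as) s")
    case True
    have "effect (fire_com (as, c)) s =
      effect (post_com (reg 20) (fst (place_exp x)) (snd (place_exp x)) b) s"
      using True by (simp add: c)
    moreover have "fire (map (locate d (v, l, u)) as, locate d (v, l, u) c) \<sigma> = post (locate d (v, l, u) c) \<sigma>"
      using True guard by (simp add: \<sigma>)
    ultimately show ?thesis
      using post_com_effect[OF rep place_exp_clean(1)[of x] place_exp_clean(2)[of x], of "reg 20" b] pc by simp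
  next
    case False
    then have "effect (fire_com (as, c)) s = s" by (simp add: c)
    moreover have "fire (map (locate d (v, l, u)) as, locate d (v, l, u) c) \<sigma> = \<sigma>"
      using False guard by (auto simp: \<sigma>)
    ultimately show ?thesis using rep frame_refl by simp
  qed
qed

lemma seqs_fire_effect:
  assumes "represents n d \<sigma> s" "s [20] = v" "s [23] = l" "s [24] = u"
  shows "represents n d (fold (\<lambda>(as, c). fire (map (locate d (v, l, u)) as, locate d (v, l, u) c)) cs \<sigma>)
      (effect (seqs (map fire_com cs)) s)
    \<and> frame {2, 16, 25, 26, 27} s (effect (seqs (map fire_com cs)) s)"
  using assms
proof (induction cs arbitrary: s \<sigma>)
  case Nil
  then show ?case by (simp add: frame_refl)
next
  case (Cons i cs)
  obtain as c where i: "i = (as, c)" by (cases i)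
  note f = fire_com_effect[OF Cons.prems, of as c]
  then have "effect (fire_com (as, c)) s [20] = v" "effect (fire_com (as, c)) s [23] = l"
    "effect (fire_com (as, c)) s [24] = u"
    using Cons.prems(2-4) by (simp_all add: frame_def)
  from Cons.IH[OF conjunct1[OF f] this] show ?case
    using f frame_trans unfolding i by (simp del: fire_com.simps) blast
qed

lemma loop_free_seqs: "(\<And>p. p \<in> set ps \<Longrightarrow> loop_free p) \<Longrightarrow> loop_free (seqs ps)"
  by (induction ps) auto

lemma loop_free_check_com [simp]: "loop_free (check_com le ue)"
  by (auto simp: check_com_def intro!: loop_free_seqs)

lemma check_com_effect:
  assumes rep: "represents n d \<sigma> s" and v: "s [20] = v"
    and ue: "\<And>x. eval ue (s([23] := x)) = eval ue s"
  shows "represents n d (check d v (eval le s) (eval ue s) \<sigma>) (effect (check_com le ue) s)"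
    and "frame {2, 16, 23, 24, 25, 26, 27} s (effect (check_com le ue) s)"
proof -
  let ?l = "eval le s" and ?u = "eval ue s"
  let ?s = "s([23] := ?l, [24] := ?u)"
  have d: "s [1] = d" using rep by (cases \<sigma>) (simp add: represents_def)
  have rep': "represents n d \<sigma> ?s" using rep by (simp add: represents_reg)
  have "effect (check_com le ue) s =
    (if 1 \<le> ?l \<and> ?l \<le> ?u \<and> ?u \<le> d then effect (seqs (map fire_com clauses)) ?s else ?s)"
    by (auto simp: check_com_def ue d[unfolded One_nat_def])
  moreover have "represents n d (fold (\<lambda>(as, c). fire (map (locate d (v, ?l, ?u)) as, locate d (v, ?l, ?u) c)) clauses \<sigma>)
      (effect (seqs (map fire_com clauses)) ?s)
    \<and> frame {2, 16, 25, 26, 27} ?s (effect (seqs (map fire_com clauses)) ?s)"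
    by (rule seqs_fire_effect[OF rep']) (use v in simp_all)
  ultimately show "represents n d (check d v ?l ?u \<sigma>) (effect (check_com le ue) s)"
    "frame {2, 16, 23, 24, 25, 26, 27} s (effect (check_com le ue) s)"
    using rep' by (auto simp: check_def frame_def)
qed

section \<open>Visiting a range in linear time\<close>

definition neighbours_com :: com where
  "neighbours_com = Seq (check_com (Succ (reg 22)) (reg 28)) (check_com (reg 28) (Pred (reg 21)))"

text \<open>Counting from \<open>l\<close> instead of \<open>0\<close> avoids a subtraction in the comparison with \<open>u - l + 1\<close>.\<close>

definition count_com :: com where
  "count_com = If (Eq (Cell [Const 9, Const 0, reg 28, reg 21, reg 22]) (Const 1))
     (Assign [Const 29] (Succ (reg 29))) Skip"

definition exclude_com :: com where
  "exclude_com = If (Eq (Cell [Const 9, Const 0, reg 28, reg 21, reg 22]) (Const 1)) Skip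
     (post_com (reg 28) (reg 21) (reg 22) 2)"

definition hall_com :: com where
  "hall_com = Seq (Assign [Const 29] (reg 21)) (Seq (for_upto 28 0 count_com)
     (If (Less (Succ (reg 22)) (reg 29)) (Assign [Const 2] (Const 1))
     (If (Eq (reg 29) (Succ (reg 22))) (for_upto 28 0 exclude_com) Skip)))"

definition visit_com :: com where
  "visit_com = Seq (check_com (reg 21) (reg 22)) (Seq (check_com (Succ (reg 21)) (reg 22))
     (Seq (check_com (reg 21) (Pred (reg 22))) (Seq (for_upto 28 1 neighbours_com) hall_com)))"

definition visiting :: "nat \<Rightarrow> nat \<Rightarrow> range \<Rightarrow> pstate \<Rightarrow> store \<Rightarrow> bool" where
  "visiting n d = (\<lambda>(v, l, u) \<sigma> s. represents n d \<sigma> s \<and> s [20] = v \<and> s [21] = l \<and> s [22] = u)"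

lemma represents_inputs: "represents n d \<sigma> s \<Longrightarrow> s [0] = n \<and> s [1] = d"
  by (cases \<sigma>) (simp add: represents_def)

lemma visiting_check:
  assumes "visiting n d (v, l, u) \<sigma> s" "\<And>x. eval ue (s([23] := x)) = eval ue s"
  shows "visiting n d (v, l, u) (check d v (eval le s) (eval ue s) \<sigma>) (effect (check_com le ue) s)"
    "effect (check_com le ue) s [28] = s [28]"
  using assms check_com_effect[of n d \<sigma> s v ue le] by (simp_all add: visiting_def frame_def)

lemma fold_count: "fold (\<lambda>w k. if w \<in> A then k + 1 else k) [1..<n + 1] (k::nat) = k + card {w \<in> {1..n}. w \<in> A}"
proof (induction n)
  case (Suc n)
  have "{w \<in> {1..Suc n}. w \<in> A} = (if Suc n \<in> A then insert (Suc n) {w \<in> {1..n}. w \<in> A} else {w \<in> {1..n}. w \<in> A})"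
    by (auto simp: le_Suc_eq)
  then show ?case using Suc by simp
qed simp

text \<open>This constant and the following ones have exactly the shape that the rules for
  sequences, conditionals and loops produce, so that those rules match after unfolding.\<close>

definition count_time :: nat where "count_time = worst count_com + 20"
definition exclude_time :: nat where "exclude_time = worst exclude_com + 20"

definition hall_time :: nat where
  "hall_time = 1 + worst (Assign [Const 29] (reg 21)) + (1 + count_time +
     (1 + bcost (Less (Succ (reg 22)) (reg 29)) + worst (Assign [Const 2] (Const 1)) +
       (1 + bcost (Eq (reg 29) (Succ (reg 22))) + exclude_time + worst Skip)))"

definition visit_time :: nat where
  "visit_time = 1 + worst (check_com (reg 21) (reg 22)) + (1 + worst (check_com (Succ (reg 21)) (reg 22)) +
     (1 + worst (check_com (reg 21) (Pred (reg 22))) + (1 + (worst neighbours_com + 20) + hall_time)))"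

text \<open>Both loops run over the variables, and \<open>n \<le> d\<close> brings their length
  below the unit \<open>d + 1\<close>.\<close>

lemma hall_com_correct:
  assumes vis: "visiting n d (v, l, u) \<sigma> s" and nd: "n \<le> d" and lu: "l \<le> u"
  shows "within (hall_time * (d + 1)) hall_com s (visiting n d (v, l, u) (check_hall n l u \<sigma>))"
proof -
  obtain T q f where \<sigma>: "\<sigma> = (T, q, f)" by (cases \<sigma>)
  define c where "c = card (inside n l u T)"
  have D: "1 \<le> d + 1" by simp
  let ?P = "\<lambda>s k. visiting n d (v, l, u) \<sigma> s \<and> s [29] = k"
  have count: "within (count_time * (d + 1)) (for_upto 28 0 count_com) s (\<lambda>s'. ?P s' (l + c))"
    if "?P s l" for s
  proof -
    have "within ((worst count_com + 20) * ((d + 1) * 1)) (for_upto 28 0 count_com) s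
      (\<lambda>s'. ?P s' (fold (\<lambda>w k. if w \<in> {w. T (w, l, u) = 1} then k + 1 else k) [1..<n + 1] l))"
    proof (rule within_cheap_for_fold[where P = ?P])
      show "s [0] = n" using that represents_inputs[of n d \<sigma> s] by (simp add: visiting_def)
      show "?P (s([28] := k)) a" if "?P s a" for s a k
        using that by (simp add: visiting_def represents_reg)
      fix i s a assume i: "1 \<le> i" "i \<le> n" and P: "?P s a" and "s [28] = i" "s [0] = n"
      have "s [9, 0, i, l, u] = T (i, l, u)" using P by (simp add: visiting_def represents_def \<sigma>)
      moreover have "represents n d \<sigma> (s([29] := x))" for x
        using P by (simp add: visiting_def represents_reg)
      ultimately show "within (worst count_com * 1) count_com s (\<lambda>s'. s' [28] = i \<and> s' [0] = n \<and>
          ?P s' (if i \<in> {w. T (w, l, u) = 1} then a + 1 else a))"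
        using P \<open>s [28] = i\<close> \<open>s [0] = n\<close>
        by (intro within_cheap_loop_free) (simp_all add: count_com_def visiting_def)
    qed (use that nd in auto)
    moreover have "{w \<in> {1..n}. w \<in> {w. T (w, l, u) = 1}} = inside n l u T" by (auto simp: inside_def)
    ultimately show ?thesis unfolding fold_count c_def count_time_def by (simp only: mult_1_right)
  qed
  have exclude: "within (exclude_time * (d + 1)) (for_upto 28 0 exclude_com) s
      (visiting n d (v, l, u) (fold (exclude l u) [1..<n + 1] \<sigma>))"
    if vis: "visiting n d (v, l, u) \<sigma> s" for s
  proof -
    let ?Q = "\<lambda>s \<sigma>. visiting n d (v, l, u) \<sigma> s"
    have "within ((worst exclude_com + 20) * ((d + 1) * 1)) (for_upto 28 0 exclude_com) s
      (\<lambda>s'. ?Q s' (fold (exclude l u) [1..<n + 1] \<sigma>))"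
    proof (rule within_cheap_for_fold[where P = ?Q])
      show "s [0] = n" using vis represents_inputs[of n d \<sigma> s] by (simp add: visiting_def)
      show "?Q (s([28] := k)) a" if "?Q s a" for s a k
        using that by (simp add: visiting_def represents_reg)
      fix i s \<sigma>' assume i: "1 \<le> i" "i \<le> n" and Q: "?Q s \<sigma>'" and s: "s [28] = i" "s [0] = n"
      have T': "s [9, 0, i, l, u] = fst \<sigma>' (i, l, u)"
        using Q by (cases \<sigma>') (simp add: visiting_def represents_def)
      have regs: "s [20] = v" "s [21] = l" "s [22] = u" using Q by (simp_all add: visiting_def)
      show "within (worst exclude_com * 1) exclude_com s (\<lambda>s'. s' [28] = i \<and> s' [0] = n \<and>
          ?Q s' (exclude l u i \<sigma>'))"
      proof (rule within_cheap_loop_free)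
        have cl: "clean (reg 21)" "clean (reg 22)" by (simp_all add: clean_def)
        have rep: "represents n d \<sigma>' s" using Q by (simp add: visiting_def)
        note pc = post_com_effect[OF rep cl, of "reg 28" 2]
        show "effect exclude_com s [28] = i \<and> effect exclude_com s [0] = n \<and>
          ?Q (effect exclude_com s) (exclude l u i \<sigma>')"
          using T' regs s pc rep by (simp add: exclude_com_def exclude_def visiting_def frame_def)
      qed (simp_all add: exclude_com_def)
    qed (use vis nd in auto)
    then show ?thesis by (simp add: exclude_time_def mult_ac)
  qed
  have rest: "within ((1 + bcost (Less (Succ (reg 22)) (reg 29)) + worst (Assign [Const 2] (Const 1)) +
       (1 + bcost (Eq (reg 29) (Succ (reg 22))) + exclude_time + worst Skip)) * (d + 1))
     (If (Less (Succ (reg 22)) (reg 29)) (Assign [Const 2] (Const 1))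
     (If (Eq (reg 29) (Succ (reg 22))) (for_upto 28 0 exclude_com) Skip)) s
     (visiting n d (v, l, u) (check_hall n l u \<sigma>))" if P: "?P s (l + c)" for s
  proof -
    have regs: "s [22] = u" "s [29] = l + c" using P by (simp_all add: visiting_def)
    show ?thesis
    proof (rule within_cheap_if[OF _ _ D])
      assume "beval (Less (Succ (reg 22)) (reg 29)) s"
      then have "u - l + 1 < c" using regs lu by simp
      then have ch: "check_hall n l u \<sigma> = (T, q, True)" by (simp add: \<sigma> check_hall_def c_def)
      have "represents n d (T, q, True) (s([2] := 1))"
        using P by (simp add: visiting_def represents_def \<sigma> constant_cells_def)
      then show "within (worst (Assign [Const 2] (Const 1)) * (d + 1)) (Assign [Const 2] (Const 1)) s
        (visiting n d (v, l, u) (check_hall n l u \<sigma>))"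
        unfolding ch using P by (intro within_cheap_loop_free) (simp_all add: visiting_def)
    next
      assume nb: "\<not> beval (Less (Succ (reg 22)) (reg 29)) s"
      show "within ((1 + bcost (Eq (reg 29) (Succ (reg 22))) + exclude_time + worst Skip) * (d + 1))
        (If (Eq (reg 29) (Succ (reg 22))) (for_upto 28 0 exclude_com) Skip) s
        (visiting n d (v, l, u) (check_hall n l u \<sigma>))"
      proof (rule within_cheap_if[OF _ _ D])
        assume "beval (Eq (reg 29) (Succ (reg 22))) s"
        then have "c = u - l + 1" using regs lu by simp
        then have ch: "check_hall n l u \<sigma> = fold (exclude l u) [1..<n + 1] \<sigma>"
          by (simp add: \<sigma> check_hall_def c_def)
        show "within (exclude_time * (d + 1)) (for_upto 28 0 exclude_com) s
          (visiting n d (v, l, u) (check_hall n l u \<sigma>))"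
          unfolding ch using P by (intro exclude) simp
      next
        assume "\<not> beval (Eq (reg 29) (Succ (reg 22))) s"
        then have "c < u - l + 1" using nb regs lu by simp
        then have ch: "check_hall n l u \<sigma> = \<sigma>" by (simp add: \<sigma> check_hall_def c_def)
        show "within (worst Skip * (d + 1)) Skip s (visiting n d (v, l, u) (check_hall n l u \<sigma>))"
          unfolding ch using P by (intro within_cheap_loop_free) simp_all
      qed
    qed
  qed
  show ?thesis
    unfolding hall_com_def hall_time_def
  proof (rule within_cheap_seq[OF within_cheap_loop_free[OF _ _ D] D])
    let ?s = "effect (Assign [Const 29] (reg 21)) s"
    have "?P ?s l" using vis by (simp add: visiting_def represents_reg)
    then show "within ((1 + count_time + (1 + bcost (Less (Succ (reg 22)) (reg 29)) + worst (Assign [Const 2] (Const 1)) +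
       (1 + bcost (Eq (reg 29) (Succ (reg 22))) + exclude_time + worst Skip))) * (d + 1))
      (Seq (for_upto 28 0 count_com) (If (Less (Succ (reg 22)) (reg 29)) (Assign [Const 2] (Const 1))
     (If (Eq (reg 29) (Succ (reg 22))) (for_upto 28 0 exclude_com) Skip))) ?s
      (visiting n d (v, l, u) (check_hall n l u \<sigma>))"
      by (intro within_cheap_seq[OF _ D] within_mono[OF count order_refl rest])
  qed simp
qed

lemma visit_com_correct:
  assumes vis: "visiting n d (v, l, u) \<sigma> s" and nd: "n \<le> d" and lu: "l \<le> u"
  shows "within (visit_time * (d + 1)) visit_com s (visiting n d (v, l, u) (visit n d (v, l, u) \<sigma>))"
proof -
  have D: "1 \<le> d + 1" by simp
  define \<sigma>1 where "\<sigma>1 = check d v l u \<sigma>"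
  define \<sigma>2 where "\<sigma>2 = check d v (l + 1) u \<sigma>1"
  define \<sigma>3 where "\<sigma>3 = check d v l (u - 1) \<sigma>2"
  let ?g = "\<lambda>x \<sigma>. check d v x (l - 1) (check d v (u + 1) x \<sigma>)"
  define \<sigma>4 where "\<sigma>4 = fold ?g [1..<d + 1] \<sigma>3"
  let ?vis = "visiting n d (v, l, u)"
  have eq: "visit n d (v, l, u) \<sigma> = check_hall n l u \<sigma>4"
    by (simp only: visit_def prod.case \<sigma>1_def \<sigma>2_def \<sigma>3_def \<sigma>4_def)
  have 1: "?vis \<sigma>1 (effect (check_com (reg 21) (reg 22)) s)" if "?vis \<sigma> s" for s
    using visiting_check(1)[OF that, of "reg 22" "reg 21"] that by (simp add: visiting_def \<sigma>1_def)
  have 2: "?vis \<sigma>2 (effect (check_com (Succ (reg 21)) (reg 22)) s)" if "?vis \<sigma>1 s" for s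
    using visiting_check(1)[OF that, of "reg 22" "Succ (reg 21)"] that by (simp add: visiting_def \<sigma>2_def)
  have 3: "?vis \<sigma>3 (effect (check_com (reg 21) (Pred (reg 22))) s)" if "?vis \<sigma>2 s" for s
    using visiting_check(1)[OF that, of "Pred (reg 22)" "reg 21"] that by (simp add: visiting_def \<sigma>3_def)
  let ?P = "\<lambda>s \<sigma>. ?vis \<sigma> s"
  have 4: "within ((worst neighbours_com + 20) * (d + 1)) (for_upto 28 1 neighbours_com) s (?vis \<sigma>4)"
    if vis: "?vis \<sigma>3 s" for s
  proof -
    have "within ((worst neighbours_com + 20) * ((d + 1) * 1)) (for_upto 28 1 neighbours_com) s
      (\<lambda>s'. ?P s' (fold ?g [1..<d + 1] \<sigma>3))"
    proof (rule within_cheap_for_fold[where P = ?P])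
      show "s [1] = d" using vis represents_inputs[of n d \<sigma>3 s] by (simp add: visiting_def)
      show "?P (s([28] := k)) a" if "?P s a" for s a k
        using that by (simp add: visiting_def represents_reg)
      fix i s a assume i: "1 \<le> i" "i \<le> d" and P: "?P s a" and s: "s [28] = i" "s [1] = d"
      let ?s1 = "effect (check_com (Succ (reg 22)) (reg 28)) s"
      have s1: "?vis (check d v (u + 1) i a) ?s1" "?s1 [28] = i"
        using visiting_check[OF P, of "reg 28" "Succ (reg 22)"] P s by (simp_all add: visiting_def)
      let ?s2 = "effect (check_com (reg 28) (Pred (reg 21))) ?s1"
      have s2: "?vis (?g i a) ?s2" "?s2 [28] = i"
        using visiting_check[OF s1(1), of "Pred (reg 21)" "reg 28"] s1 by (simp_all add: visiting_def)
      moreover have "?s2 [1] = d" using s2(1) represents_inputs[of n d "?g i a" ?s2] by (simp add: visiting_def)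
      moreover have "effect neighbours_com s = ?s2" by (simp add: neighbours_com_def)
      moreover have "loop_free neighbours_com" by (simp add: neighbours_com_def)
      ultimately show "within (worst neighbours_com * 1) neighbours_com s (\<lambda>s'. s' [28] = i \<and> s' [1] = d \<and>
          ?P s' (?g i a))"
        by (intro within_cheap_loop_free) simp_all
    qed (use vis in auto)
    then show ?thesis by (simp add: \<sigma>4_def mult_ac)
  qed
  show ?thesis
    unfolding visit_com_def visit_time_def eq
    by (intro within_cheap_seq[OF _ D] within_cheap_loop_free[OF _ _ D] loop_free_check_com
        within_mono[OF 4 order_refl hall_com_correct] 3 2 1 vis nd lu)
qed

section \<open>The propagation loop and its amortised cost\<close>

abbreviation queue :: "pstate \<Rightarrow> range list" where
  "queue \<sigma> \<equiv> fst (snd \<sigma>)"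

abbreviation failed :: "pstate \<Rightarrow> bool" where
  "failed \<sigma> \<equiv> snd (snd \<sigma>)"

text \<open>Entries are taken from the end at which they are added, so the length is the only
  pointer. The order of visits does not affect the result.\<close>

definition pop_com :: com where
  "pop_com = Seq (Assign [Const 16] (Pred (reg 16))) (Seq (Assign [Const 20] (Cell [Const 17, reg 16]))
     (Seq (Assign [Const 21] (Cell [Const 18, reg 16])) (Assign [Const 22] (Cell [Const 19, reg 16]))))"

definition loop_guard :: bexp where
  "loop_guard = And (Eq (reg 2) (Const 0)) (Less (Const 0) (reg 16))"

definition propagate_com :: com where
  "propagate_com = While loop_guard (Seq pop_com visit_com)"

definition guard_time :: nat where
  "guard_time = 1 + bcost loop_guard"

definition iteration_time :: nat where
  "iteration_time = guard_time + (1 + worst pop_com + visit_time)"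

lemma pop_com_effect:
  assumes rep: "represents n d (T, q @ [(v, l, u)], f) s"
  shows "visiting n d (v, l, u) (T, q, f) (effect pop_com s)"
proof -
  note r = rep[unfolded represents_def prod.case]
  have "(s [17, length q], s [18, length q], s [19, length q]) = (v, l, u)"
    using r by (metis length_append_singleton lessI nth_append_length)
  then have "s [17, length q] = v" "s [18, length q] = l" "s [19, length q] = u" by simp_all
  then have eff: "effect pop_com s = s([16] := length q, [20] := v, [21] := l, [22] := u)"
    using r by (simp add: pop_com_def)
  have "(s [17, k], s [18, k], s [19, k]) = q ! k" if "k < length q" for k
    using r that by (metis length_append_singleton less_SucI nth_append)
  moreover have "constant_cells n d (s([16] := length q, [20] := v, [21] := l, [22] := u))"
    using r by (simp add: constant_cells_def)
  ultimately show ?thesis using r unfolding eff visiting_def represents_def by simp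
qed

text \<open>The strict decrease in the last conjunct pays for the fixed overhead of a call: one unit
  of potential is lost whenever there was something to visit.\<close>

definition propagated :: "nat \<Rightarrow> nat \<Rightarrow> pstate \<Rightarrow> pstate \<Rightarrow> bool" where
  "propagated n d \<sigma> \<sigma>' \<longleftrightarrow> well_formed n d \<sigma>' \<and> (failed \<sigma>' \<or> queue \<sigma>' = []) \<and>
     (\<forall>i\<in>inferences n d. settled \<sigma>' i) \<and> (failed \<sigma> \<longrightarrow> failed \<sigma>') \<and>
     (\<forall>r. fst \<sigma> r \<noteq> 0 \<longrightarrow> fst \<sigma>' r = fst \<sigma> r) \<and>
     (\<forall>V. closed_under (inferences n d) V \<longrightarrow> sound V \<sigma> \<longrightarrow> sound V \<sigma>') \<and>
     (\<not> failed \<sigma> \<and> queue \<sigma> \<noteq> [] \<longrightarrow> potential n d \<sigma>' < potential n d \<sigma>)"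

text \<open>The pop removes one unit of potential and the visit, being a derivation, keeps the rest.
  Inferences that lose their pending status through the pop are settled again by the visit.\<close>

lemma visit_popped:
  assumes wf: "well_formed n d (T, q @ [r], f)" and set: "\<forall>i\<in>inferences n d. settled (T, q @ [r], f) i"
  defines "\<sigma>' \<equiv> visit n d r (T, q, f)"
  shows "well_formed n d \<sigma>'" "\<forall>i\<in>inferences n d. settled \<sigma>' i"
    "potential n d (T, q @ [r], f) = potential n d \<sigma>' + 1"
    "\<forall>r. T r \<noteq> 0 \<longrightarrow> fst \<sigma>' r = T r"
    "\<And>V. closed_under (inferences n d) V \<Longrightarrow> sound V (T, q @ [r], f) \<Longrightarrow> sound V \<sigma>'"
proof -
  have r: "r \<in> ranges n d" and wf': "well_formed n d (T, q, f)" using wf by (auto simp: well_formed_def)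
  have der: "derives (inferences n d) (T, q, f) \<sigma>'"
    and vis: "\<forall>i\<in>{i \<in> inferences n d. pending [r] i}. settled \<sigma>' i"
    using visit_settles[OF subset_refl r] unfolding settles_def \<sigma>'_def by blast+
  have facts: "well_formed n d \<sigma>'" "potential n d \<sigma>' = potential n d (T, q, f)"
    using derives_facts[OF der wf' proper_inferences] by blast+
  show "well_formed n d \<sigma>'" by fact
  show "potential n d (T, q @ [r], f) = potential n d \<sigma>' + 1"
    unfolding facts(2) by (simp add: potential_def)
  have "settled \<sigma>' i" if i: "i \<in> inferences n d" for i
  proof (cases "pending [r] i")
    case True
    then show ?thesis using vis i by blast
  next
    case False
    then have "settled (T, q, f) i" using set i by (auto simp: settled_def pending_def)
    then show ?thesis by (rule settled_derives[OF der])
  qed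
  then show "\<forall>i\<in>inferences n d. settled \<sigma>' i" by blast
  show "\<forall>r. T r \<noteq> 0 \<longrightarrow> fst \<sigma>' r = T r"
    using derives_extends[OF der] by (cases \<sigma>') (simp add: extends_def)
  show "sound V \<sigma>'" if "closed_under (inferences n d) V" "sound V (T, q @ [r], f)" for V
  proof (rule derives_sound[OF der _ that(1) proper_inferences])
    show "sound V (T, q, f)" using that(2) by (simp add: sound_def)
  qed
qed

text \<open>Each iteration is paid for by the unit of potential that it consumes, at a price of
  \<open>iteration_time * (d + 1)\<close>. The additional \<open>guard_time\<close> covers the final
  test.\<close>

lemma propagate_com_correct:
  assumes nd: "n \<le> d" and rep: "represents n d \<sigma> s" and wf: "well_formed n d \<sigma>"
    and set: "\<forall>i\<in>inferences n d. settled \<sigma> i"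
  shows "\<exists>t s' \<sigma>'. exec propagate_com s t s' \<and> represents n d \<sigma>' s' \<and> propagated n d \<sigma> \<sigma>' \<and>
    t + iteration_time * (d + 1) * potential n d \<sigma>' \<le> iteration_time * (d + 1) * potential n d \<sigma> + guard_time"
  using rep wf set
proof (induction "potential n d \<sigma>" arbitrary: \<sigma> s rule: less_induct)
  case less
  obtain T q f where \<sigma>: "\<sigma> = (T, q, f)" by (cases \<sigma>)
  note rep = less.prems(1) and wf = less.prems(2) and set = less.prems(3)
  have guard: "beval loop_guard s \<longleftrightarrow> \<not> f \<and> q \<noteq> []"
    using rep by (auto simp: \<sigma> represents_def loop_guard_def)
  show ?case
  proof (cases "\<not> f \<and> q \<noteq> []")
    case False
    then have "\<not> beval loop_guard s" using guard by blast
    from exec.while_false[OF this] have "exec propagate_com s guard_time s"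
      unfolding propagate_com_def guard_time_def .
    moreover have "propagated n d \<sigma> \<sigma>"
      using False wf set by (auto simp: propagated_def \<sigma>)
    ultimately show ?thesis using rep by (intro exI[of _ guard_time] exI[of _ s] exI[of _ \<sigma>]) simp
  next
    case True
    then obtain q' r where q: "q = q' @ [r]" by (metis rev_exhaust)
    obtain v l u where r: "r = (v, l, u)" by (cases r)
    define \<sigma>2 where "\<sigma>2 = visit n d r (T, q', f)"
    have rr: "r \<in> ranges n d" using wf by (auto simp: \<sigma> q well_formed_def)
    note vp = visit_popped[of n d T q' r f, folded \<sigma>2_def, OF wf[unfolded \<sigma> q] set[unfolded \<sigma> q]]
    have vis: "visiting n d r (T, q', f) (effect pop_com s)"
      using pop_com_effect rep unfolding \<sigma> q r by blast
    have "within ((1 + worst pop_com + visit_time) * (d + 1)) (Seq pop_com visit_com) s (visiting n d r \<sigma>2)"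
      unfolding \<sigma>2_def r
    proof (rule within_cheap_seq[OF within_cheap_loop_free])
      show "within (visit_time * (d + 1)) visit_com (effect pop_com s)
        (visiting n d (v, l, u) (visit n d (v, l, u) (T, q', f)))"
        using vis rr by (intro visit_com_correct nd) (auto simp: r ranges_def)
    qed (simp_all add: pop_com_def)
    then obtain t s2 where t: "exec (Seq pop_com visit_com) s t s2"
      "t \<le> (1 + worst pop_com + visit_time) * (d + 1)" and "visiting n d r \<sigma>2 s2"
      unfolding within_def by blast
    then have rep2: "represents n d \<sigma>2 s2" by (simp add: visiting_def r)
    have "potential n d \<sigma>2 < potential n d \<sigma>" using vp(3) by (simp add: \<sigma> q)
    from less.hyps[OF this rep2 vp(1,2)] obtain t' s' \<sigma>' where IH: "exec propagate_com s2 t' s'"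
      "represents n d \<sigma>' s'" "propagated n d \<sigma>2 \<sigma>'"
      "t' + iteration_time * (d + 1) * potential n d \<sigma>' \<le> iteration_time * (d + 1) * potential n d \<sigma>2 + guard_time"
      by blast
    have b: "beval loop_guard s" using True guard by blast
    have ex: "exec propagate_com s (1 + bcost loop_guard + t + t') s'"
      using exec.while_true[OF b t(1)] IH(1) unfolding propagate_com_def by blast
    have "1 + bcost loop_guard + t \<le> iteration_time * (d + 1)"
    proof -
      have "guard_time \<le> guard_time * (d + 1)" by simp
      then show ?thesis using t(2) unfolding iteration_time_def guard_time_def by (simp only: distrib_right)
    qed
    moreover have "iteration_time * (d + 1) * potential n d \<sigma> =
      iteration_time * (d + 1) * potential n d \<sigma>2 + iteration_time * (d + 1)"
      using vp(3) by (simp add: \<sigma> q)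
    ultimately have time: "1 + bcost loop_guard + t + t' + iteration_time * (d + 1) * potential n d \<sigma>'
      \<le> iteration_time * (d + 1) * potential n d \<sigma> + guard_time" using IH(4) by linarith
    have le: "potential n d \<sigma>' \<le> potential n d \<sigma>2"
    proof (cases "failed \<sigma>2 \<or> queue \<sigma>2 = []")
      case False
      then show ?thesis using IH(3) by (auto simp: propagated_def)
    next
      \<comment> \<open>With nothing left to visit, \<open>propagated\<close> makes no claim about
        the potential. The time inequality itself gives it: \<open>guard_time\<close> is less than
        the price of one unit.\<close>
      case True
      show ?thesis
      proof -
        have "iteration_time * (d + 1) * potential n d \<sigma>' < iteration_time * (d + 1) * (potential n d \<sigma>2 + 1)"
          using IH(4) \<open>1 + bcost loop_guard + t \<le> iteration_time * (d + 1)\<close>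
          by (simp add: guard_time_def iteration_time_def distrib_left distrib_right)
        then show ?thesis by (simp only: mult_less_cancel1) linarith
      qed
    qed
    have "propagated n d \<sigma> \<sigma>'"
      unfolding propagated_def
    proof (intro conjI allI impI)
      show "fst \<sigma>' r = fst \<sigma> r" if "fst \<sigma> r \<noteq> 0" for r
        using vp(4) IH(3) that by (simp add: propagated_def \<sigma>)
      show "sound V \<sigma>'" if "closed_under (inferences n d) V" "sound V \<sigma>" for V
        using vp(5)[OF that(1)] IH(3) that unfolding propagated_def \<sigma> q by blast
      show "potential n d \<sigma>' < potential n d \<sigma>" using le vp(3) by (simp add: \<sigma> q)
    qed (use IH(3) True in \<open>auto simp: propagated_def \<sigma>\<close>)
    with ex time IH(2) show ?thesis by blast
  qed
qed

section \<open>The programs for a decision and for the root\<close>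

definition decide_com :: com where
  "decide_com = If (Eq (reg 7) (Const 1)) (post_com (reg 4) (reg 5) (reg 6) 1) (post_com (reg 4) (reg 5) (reg 6) 2)"

definition step_com :: com where
  "step_com = Seq decide_com propagate_com"

definition put_com :: "exp \<Rightarrow> exp \<Rightarrow> exp \<Rightarrow> nat \<Rightarrow> com" where
  "put_com ve le ue b =
     Seq (Assign [Const 9, Const 0, ve, le, ue] (Const b)) (Assign [Const 10, ve, le, ue] (Const b))"

definition side_com :: com where
  "side_com = Seq (put_com (reg 20) (Const 0) (reg 21) 1) (put_com (reg 20) (reg 21) (Succ (reg 1)) 1)"

definition corners_com :: com where
  "corners_com = Seq (put_com (reg 20) (Const 1) (Const 0) 2) (put_com (reg 20) (Succ (reg 1)) (reg 1) 2)"

definition border_com :: com where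
  "border_com = for_upto 20 0 (Seq corners_com (for_upto 21 1 side_com))"

definition cells_com :: com where
  "cells_com = Seq (Assign [Const 11, reg 20, reg 21, reg 22] (Const 2))
     (Seq (Assign [Const 12, reg 20, reg 21, reg 22] (Const 2)) (Assign [Const 13, reg 21, reg 22] (Const 2)))"

definition bodies_com :: com where
  "bodies_com = for_upto 20 0 (for_upto 21 1 (for_upto 22 1 cells_com))"

definition constants_com :: com where
  "constants_com = Seq (Assign [Const 9, Const 1, Const 0, Const 0, Const 0] (Const 1))
     (Seq (Assign [Const 9, Const 2, Const 0, Const 0, Const 0] (Const 2))
     (Seq (Assign [Const 9, Const 3, Const 0, Const 0, Const 0] (Const 2))
     (Seq (Assign [Const 14] (Const 1)) (Assign [Const 15] (Const 2)))))"

definition remove_com :: com where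
  "remove_com = If (Eq (Cell [Const 8, reg 20, reg 21]) (Const 0)) (post_com (reg 20) (reg 21) (reg 21) 2) Skip"

definition facts_com :: com where
  "facts_com = for_upto 20 0 (Seq (post_com (reg 20) (Const 1) (reg 1) 1) (for_upto 21 1 remove_com))"

definition setup_com :: com where
  "setup_com = Seq border_com (Seq bodies_com (Seq constants_com facts_com))"

text \<open>With more variables than values the constraint fails at the root. Otherwise \<open>n \<le> d\<close>, so that a
  visit may spend time linear in \<open>n\<close>.\<close>

definition init_com :: com where
  "init_com = If (Less (reg 1) (reg 0)) (Assign [Const 2] (Const 1)) (Seq setup_com propagate_com)"

section \<open>Writing the border, the constant cells and the initial facts\<close>

definition paint_side :: "nat \<Rightarrow> nat \<Rightarrow> nat \<Rightarrow> valuation \<Rightarrow> valuation" where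
  "paint_side d v x T = T((v, 0, x) := 1, (v, x, d + 1) := 1)"

definition paint_row :: "nat \<Rightarrow> nat \<Rightarrow> valuation \<Rightarrow> valuation" where
  "paint_row d v T = fold (paint_side d v) [1..<d + 1] (T((v, 1, 0) := 2, (v, d + 1, d) := 2))"

lemma fold_paint_side:
  "fold (paint_side d v) [1..<k + 1] T (v', l, u) =
    (if v' = v \<and> (l = 0 \<and> u \<in> {1..k} \<or> l \<in> {1..k} \<and> u = d + 1) then 1 else T (v', l, u))"
  by (induction k) (auto simp: paint_side_def)

text \<open>After \<open>k\<close> rows the picture is the border for \<open>k\<close> variables, so
  the number of variables itself serves as the induction parameter.\<close>

lemma paint_border: "fold (paint_row d) [1..<k + 1] (\<lambda>_. 0) = border k d"
proof (induction k)
  case (Suc k)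
  have "fold (paint_row d) [1..<Suc k + 1] (\<lambda>_. 0) = paint_row d (Suc k) (border k d)"
    using Suc by simp
  moreover have "paint_row d (Suc k) (border k d) (v, l, u) = border (Suc k) d (v, l, u)" for v l u
    unfolding paint_row_def fold_paint_side by (auto simp: border_def)
  ultimately show ?case by (auto simp: fun_eq_iff)
qed (auto simp: border_def)

definition domain_cells :: "nat \<Rightarrow> doms \<Rightarrow> store \<Rightarrow> bool" where
  "domain_cells n D s \<longleftrightarrow> (\<forall>v\<in>{1..n}. \<forall>i. s [8, v, i] = (if i \<in> D v then 1 else 0))"

text \<open>A store with an empty queue and no conflict whose constant cells are not yet written;
  the domain cells are kept for the removals that follow.\<close>

definition canvas :: "nat \<Rightarrow> nat \<Rightarrow> doms \<Rightarrow> valuation \<Rightarrow> store \<Rightarrow> bool" where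
  "canvas n d D T s \<longleftrightarrow> s [0] = n \<and> s [1] = d \<and> s [2] = 0 \<and> s [16] = 0 \<and>
     (\<forall>v l u. s [9, 0, v, l, u] = T (v, l, u)) \<and> (\<forall>v l u. s [10, v, l, u] = T (v, l, u)) \<and>
     domain_cells n D s"

lemma canvas_input: "canvas n d D (\<lambda>_. 0) (input_store n d D)"
  by (auto simp: canvas_def input_store_def domain_cells_def)

lemma canvas_reg: "k \<notin> {0, 1, 2, 16} \<Longrightarrow> canvas n d D T s \<Longrightarrow> canvas n d D T (s([k] := x))"
  by (simp add: canvas_def domain_cells_def)

lemma put_com_effect:
  assumes "canvas n d D T s" "v = eval ve s" "l = eval le s" "u = eval ue s"
    and "\<And>x a b c e. eval ve (s([9, a, b, c, e] := x)) = eval ve s"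
    and "\<And>x a b c e. eval le (s([9, a, b, c, e] := x)) = eval le s"
    and "\<And>x a b c e. eval ue (s([9, a, b, c, e] := x)) = eval ue s"
  shows "canvas n d D (T((v, l, u) := b)) (effect (put_com ve le ue b) s)"
    and "\<forall>k. effect (put_com ve le ue b) s [k] = s [k]"
  using assms by (auto simp: put_com_def canvas_def domain_cells_def)

lemma loop_free_put_com [simp]: "loop_free (put_com ve le ue b)"
  by (simp add: put_com_def)

lemma side_com_effect:
  assumes "canvas n d D T s" "s [20] = v" "s [21] = i"
  shows "canvas n d D (paint_side d v i T) (effect side_com s) \<and> (\<forall>k. effect side_com s [k] = s [k])"
proof -
  have d: "s [1] = d" using assms(1) by (simp add: canvas_def)
  let ?s1 = "effect (put_com (reg 20) (Const 0) (reg 21) 1) s"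
  have 1: "canvas n d D (T((v, 0, i) := 1)) ?s1" "\<forall>k. ?s1 [k] = s [k]"
    using assms by (intro put_com_effect; simp)+
  let ?s2 = "effect (put_com (reg 20) (reg 21) (Succ (reg 1)) 1) ?s1"
  have "canvas n d D (T((v, 0, i) := 1, (v, i, d + 1) := 1)) ?s2" "\<forall>k. ?s2 [k] = ?s1 [k]"
    using 1 assms d[unfolded One_nat_def] by (intro put_com_effect; simp)+
  then show ?thesis using 1(2) by (simp add: side_com_def paint_side_def)
qed

lemma corners_com_effect:
  assumes "canvas n d D T s" "s [20] = v"
  shows "canvas n d D (T((v, 1, 0) := 2, (v, d + 1, d) := 2)) (effect corners_com s) \<and>
    (\<forall>k. effect corners_com s [k] = s [k])"
proof -
  have d: "s [1] = d" using assms(1) by (simp add: canvas_def)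
  let ?s1 = "effect (put_com (reg 20) (Const 1) (Const 0) 2) s"
  have 1: "canvas n d D (T((v, 1, 0) := 2)) ?s1" "\<forall>k. ?s1 [k] = s [k]"
    using assms by (intro put_com_effect; simp)+
  let ?s2 = "effect (put_com (reg 20) (Succ (reg 1)) (reg 1) 2) ?s1"
  have "canvas n d D (T((v, 1, 0) := 2, (v, d + 1, d) := 2)) ?s2" "\<forall>k. ?s2 [k] = ?s1 [k]"
    using 1 assms d[unfolded One_nat_def] by (intro put_com_effect; simp)+
  then show ?thesis using 1(2) by (simp add: corners_com_def)
qed

definition border_time :: nat where
  "border_time = 1 + worst corners_com + (worst side_com + 20) + 20"

lemma border_com_correct:
  assumes "canvas n d D (\<lambda>_. 0) s"
  shows "within (border_time * ((n + 1) * ((d + 1) * 1))) border_com s (canvas n d D (border n d))"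
proof -
  let ?P = "\<lambda>s T. canvas n d D T s"
  have D: "1 \<le> (d + 1) * 1" by simp
  have "within ((1 + worst corners_com + (worst side_com + 20) + 20) * ((n + 1) * ((d + 1) * 1))) border_com s
    (\<lambda>s'. ?P s' (fold (paint_row d) [1..<n + 1] (\<lambda>_. 0)))"
    unfolding border_com_def
  proof (rule within_cheap_for_fold[where P = ?P])
    show "s [0] = n" using assms by (simp add: canvas_def)
    show "?P (s([20] := k)) a" if "?P s a" for s a k using that by (simp add: canvas_reg)
    fix v s T assume v: "1 \<le> v" "v \<le> n" and P: "?P s T" and s: "s [20] = v" "s [0] = n"
    let ?T = "T((v, 1, 0) := 2, (v, d + 1, d) := 2)"
    let ?Q = "\<lambda>s T. canvas n d D T s \<and> s [20] = v"
    have "within ((1 + worst corners_com + (worst side_com + 20)) * ((d + 1) * 1))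
      (Seq corners_com (for_upto 21 1 side_com)) s (\<lambda>s'. ?Q s' (paint_row d v T))"
    proof (rule within_cheap_seq[OF within_cheap_loop_free[OF _ _ D] D])
      let ?s = "effect corners_com s"
      have Q: "?Q ?s ?T" using corners_com_effect[OF P s(1)] s by simp
      show "within ((worst side_com + 20) * ((d + 1) * 1)) (for_upto 21 1 side_com) ?s
        (\<lambda>s'. ?Q s' (paint_row d v T))"
        unfolding paint_row_def
      proof (rule within_cheap_for_fold[where P = ?Q])
        show "?s [1] = d" using Q by (simp add: canvas_def)
        show "?Q (s([21] := k)) a" if "?Q s a" for s a k using that by (simp add: canvas_reg)
        fix i s T assume i: "1 \<le> i" "i \<le> d" and Q: "?Q s T" and s: "s [21] = i" "s [1] = d"
        show "within (worst side_com * 1) side_com s (\<lambda>s'. s' [21] = i \<and> s' [1] = d \<and> ?Q s' (paint_side d v i T))"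
          using side_com_effect[of n d D T s v i] Q s
          by (intro within_cheap_loop_free) (simp_all add: side_com_def[THEN arg_cong[where f = loop_free]])
      qed (use Q in auto)
    qed (simp add: corners_com_def)
    then show "within ((1 + worst corners_com + (worst side_com + 20)) * ((d + 1) * 1))
      (Seq corners_com (for_upto 21 1 side_com)) s (\<lambda>s'. s' [20] = v \<and> s' [0] = n \<and> ?P s' (paint_row d v T))"
      by (rule within_mono) (auto simp: canvas_def)
  qed (use assms in auto)
  then show ?thesis unfolding paint_border border_time_def .
qed

definition filled :: "range set \<Rightarrow> store \<Rightarrow> bool" where
  "filled A s \<longleftrightarrow> (\<forall>(v, l, u)\<in>A. s [11, v, l, u] = 2 \<and> s [12, v, l, u] = 2 \<and> s [13, l, u] = 2)"

lemma filled_mono: "A \<subseteq> B \<Longrightarrow> filled B s \<Longrightarrow> filled A s"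
  unfolding filled_def by blast

lemma filled_reg: "filled A s \<Longrightarrow> filled A (s([k] := x))"
  by (auto simp: filled_def)

text \<open>For loops whose abstract state is the set of cells already written: what one iteration
  adds is kept by all later ones.\<close>

lemma fold_extensive:
  assumes "\<And>x A. A \<subseteq> g x A" "x \<in> set xs" "\<And>A. y \<in> g x A"
  shows "y \<in> fold g xs A"
proof -
  have sub: "A \<subseteq> fold g xs A" for xs A
  proof (induction xs arbitrary: A)
    case (Cons x xs)
    have "g x A \<subseteq> fold g xs (g x A)" by (rule Cons)
    then show ?case using assms(1)[of A x] by auto
  qed simp
  show ?thesis
    using assms(2)
  proof (induction xs arbitrary: A)
    case (Cons z zs)
    show ?case
    proof (cases "z = x")
      case True
      then show ?thesis using sub[of "g x A" zs] assms(3)[of A] by auto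
    qed (use Cons in auto)
  qed simp
qed

lemma fold_subset: "(\<And>x A. A \<subseteq> g x A) \<Longrightarrow> A \<subseteq> fold g xs A"
proof (induction xs arbitrary: A)
  case (Cons x xs)
  have "g x A \<subseteq> fold g xs (g x A)" by (rule Cons.IH[OF Cons.prems])
  then show ?case using Cons.prems[of A x] by auto
qed simp

definition bodies_time :: nat where
  "bodies_time = worst cells_com + 20 + 20 + 20"

lemma bodies_com_correct:
  assumes "canvas n d D T s"
  shows "within (bodies_time * ((n + 1) * ((d + 1) * ((d + 1) * 1)))) bodies_com s
    (\<lambda>s'. canvas n d D T s' \<and> filled ({1..n} \<times> {1..d} \<times> {1..d}) s')"
proof -
  let ?g3 = "\<lambda>v l u. insert (v, l, u) :: range set \<Rightarrow> range set"
  let ?g2 = "\<lambda>v l. fold (?g3 v l) [1..<d + 1]"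
  let ?g1 = "\<lambda>v. fold (?g2 v) [1..<d + 1]"
  let ?P = "\<lambda>s A. canvas n d D T s \<and> filled A s"
  have one: "1 \<le> (1::nat)" "1 \<le> (d + 1) * 1" "1 \<le> (d + 1) * ((d + 1) * 1)" by simp_all
  have "within (bodies_time * ((n + 1) * ((d + 1) * ((d + 1) * 1)))) bodies_com s
    (\<lambda>s'. ?P s' (fold ?g1 [1..<n + 1] {}))"
    unfolding bodies_com_def bodies_time_def
  proof (rule within_cheap_for_fold[where P = ?P, OF _ _ _ _ one(3)])
    show "s [0] = n" using assms by (simp add: canvas_def)
    show "?P s {}" using assms by (simp add: filled_def)
    show "?P (s([20] := k)) a" if "?P s a" for s a k using that by (simp add: canvas_reg filled_reg)
    fix v s A assume P: "?P s A" and s: "s [20] = v" "s [0] = n"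
    let ?Q = "\<lambda>s A. canvas n d D T s \<and> filled A s \<and> s [20] = v"
    have "within ((worst cells_com + 20 + 20) * ((d + 1) * ((d + 1) * 1))) (for_upto 21 1 (for_upto 22 1 cells_com)) s
      (\<lambda>s'. ?Q s' (?g1 v A))"
    proof (rule within_cheap_for_fold[where P = ?Q, OF _ _ _ _ one(2)])
      show "s [1] = d" using P by (simp add: canvas_def)
      show "?Q s A" using P s by simp
      show "?Q (s([21] := k)) a" if "?Q s a" for s a k using that by (simp add: canvas_reg filled_reg)
      fix l s A assume Q: "?Q s A" and s: "s [21] = l" "s [1] = d"
      let ?R = "\<lambda>s A. canvas n d D T s \<and> filled A s \<and> s [20] = v \<and> s [21] = l"
      have "within ((worst cells_com + 20) * ((d + 1) * 1)) (for_upto 22 1 cells_com) s (\<lambda>s'. ?R s' (?g2 v l A))"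
      proof (rule within_cheap_for_fold[where P = ?R, OF _ _ _ _ one(1)])
        show "s [1] = d" using Q by (simp add: canvas_def)
        show "?R s A" using Q s by simp
        show "?R (s([22] := k)) a" if "?R s a" for s a k using that by (simp add: canvas_reg filled_reg)
        fix u s A assume R: "?R s A" and s: "s [22] = u" "s [1] = d"
        let ?s = "s([11, v, l, u] := 2, [12, v, l, u] := 2, [13, l, u] := 2)"
        have eff: "effect cells_com s = ?s" using R s by (simp add: cells_com_def)
        have "canvas n d D T ?s" using R by (simp add: canvas_def domain_cells_def)
        moreover have "filled (insert (v, l, u) A) ?s" using R by (auto simp: filled_def)
        ultimately show "within (worst cells_com * 1) cells_com s
          (\<lambda>s'. s' [22] = u \<and> s' [1] = d \<and> ?R s' (?g3 v l u A))"
          using R s eff by (intro within_cheap_loop_free) (simp_all add: cells_com_def)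
      qed auto
      then show "within ((worst cells_com + 20) * ((d + 1) * 1)) (for_upto 22 1 cells_com) s
        (\<lambda>s'. s' [21] = l \<and> s' [1] = d \<and> ?Q s' (?g2 v l A))"
        by (rule within_mono) (auto simp: canvas_def)
    qed auto
    then show "within ((worst cells_com + 20 + 20) * ((d + 1) * ((d + 1) * 1))) (for_upto 21 1 (for_upto 22 1 cells_com)) s
      (\<lambda>s'. s' [20] = v \<and> s' [0] = n \<and> ?P s' (?g1 v A))"
      by (rule within_mono) (auto simp: canvas_def)
  qed auto
  note loops = this
  have all: "{1..n} \<times> {1..d} \<times> {1..d} \<subseteq> fold ?g1 [1..<n + 1] {}"
  proof
    fix r assume "r \<in> {1..n} \<times> {1..d} \<times> {1..d}"
    then obtain v l u where r: "r = (v, l, u)" "v \<in> {1..n}" "l \<in> {1..d}" "u \<in> {1..d}" by blast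
    have e3: "A \<subseteq> ?g3 v l u A" for v l u A by blast
    have e2: "A \<subseteq> ?g2 v l A" for v l A by (rule fold_subset[OF e3])
    have e1: "A \<subseteq> ?g1 v A" for v A by (rule fold_subset[OF e2])
    have "r \<in> ?g2 v l A" for A by (rule fold_extensive[OF e3, of u]) (use r in auto)
    then have "r \<in> ?g1 v A" for A by (intro fold_extensive[OF e2, of l]) (use r in auto)
    then show "r \<in> fold ?g1 [1..<n + 1] {}" by (intro fold_extensive[OF e1, of v]) (use r in auto)
  qed
  show ?thesis
    by (rule within_mono[OF loops order_refl]) (use filled_mono[OF all] in blast)
qed

lemma constants_com_effect:
  assumes "canvas n d D T s" "filled ({1..n} \<times> {1..d} \<times> {1..d}) s"
  shows "represents n d (T, [], False) (effect constants_com s) \<and> domain_cells n D (effect constants_com s)"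
  using assms unfolding represents_def constants_com_def canvas_def constant_cells_def domain_cells_def filled_def
  by (simp add: split_beta)

definition remove :: "doms \<Rightarrow> nat \<Rightarrow> nat \<Rightarrow> pstate \<Rightarrow> pstate" where
  "remove D v i \<sigma> = (if i \<in> D v then \<sigma> else post ((v, i, i), 2) \<sigma>)"

text \<open>The full range is posted although the initial assignment does not contain it: it follows
  from an empty body, so no visit of another range would trigger it.\<close>

definition start_row :: "nat \<Rightarrow> doms \<Rightarrow> nat \<Rightarrow> pstate \<Rightarrow> pstate" where
  "start_row d D v \<sigma> = fold (remove D v) [1..<d + 1] (post ((v, 1, d), 1) \<sigma>)"

definition start_state :: "nat \<Rightarrow> nat \<Rightarrow> doms \<Rightarrow> pstate" where
  "start_state n d D = fold (start_row d D) [1..<n + 1] (border n d, [], False)"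

definition facts_time :: nat where
  "facts_time = 1 + worst (post_com (reg 20) (Const 1) (reg 1) 1) + (worst remove_com + 20) + 20"

lemma facts_com_correct:
  assumes "represents n d (border n d, [], False) s" "domain_cells n D s"
  shows "within (facts_time * ((n + 1) * ((d + 1) * 1))) facts_com s (represents n d (start_state n d D))"
proof -
  let ?P = "\<lambda>s \<sigma>. represents n d \<sigma> s \<and> domain_cells n D s"
  have D: "1 \<le> (d + 1) * 1" by simp
  have dom: "domain_cells n D s'" if "domain_cells n D s" "frame K s s'" for s s' K
    using that by (simp add: domain_cells_def frame_def)
  have dom_reg: "domain_cells n D (s([k] := x))" if "domain_cells n D s" for s k x
    using that by (simp add: domain_cells_def)
  have "within ((1 + worst (post_com (reg 20) (Const 1) (reg 1) 1) + (worst remove_com + 20) + 20) *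
      ((n + 1) * ((d + 1) * 1))) facts_com s (\<lambda>s'. ?P s' (start_state n d D))"
    unfolding facts_com_def start_state_def
  proof (rule within_cheap_for_fold[where P = ?P])
    show "s [0] = n" using represents_inputs[OF assms(1)] by simp
    show "?P (s([20] := k)) a" if "?P s a" for s a k using that by (simp add: represents_reg dom_reg)
    fix v s \<sigma> assume v: "1 \<le> v" "v \<le> n" and P: "?P s \<sigma>" and s: "s [20] = v" "s [0] = n"
    have s1: "s [1] = d" using represents_inputs[of n d \<sigma> s] P by simp
    let ?p = "post_com (reg 20) (Const 1) (reg 1) 1"
    let ?Q = "\<lambda>s \<sigma>. represents n d \<sigma> s \<and> domain_cells n D s \<and> s [20] = v"
    have "within ((1 + worst ?p + (worst remove_com + 20)) * ((d + 1) * 1)) (Seq ?p (for_upto 21 1 remove_com)) s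
      (\<lambda>s'. ?Q s' (start_row d D v \<sigma>))"
    proof (rule within_cheap_seq[OF within_cheap_loop_free[OF _ _ D] D])
      let ?s = "effect ?p s"
      have "clean (Const 1)" "clean (reg 1)" by (simp_all add: clean_def)
      note pc = post_com_effect[OF conjunct1[OF P] this, of "reg 20" 1]
      have Q: "?Q ?s (post ((v, 1, d), 1) \<sigma>)"
        using pc dom[OF conjunct2[OF P] pc(2)] s s1[unfolded One_nat_def] by (simp add: frame_def)
      show "within ((worst remove_com + 20) * ((d + 1) * 1)) (for_upto 21 1 remove_com) ?s
        (\<lambda>s'. ?Q s' (start_row d D v \<sigma>))"
        unfolding start_row_def
      proof (rule within_cheap_for_fold[where P = ?Q])
        show "?s [1] = d" using represents_inputs[OF conjunct1[OF Q]] by simp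
        show "?Q (s([21] := k)) a" if "?Q s a" for s a k using that by (simp add: represents_reg dom_reg)
        fix i s \<sigma> assume i: "1 \<le> i" "i \<le> d" and Q: "?Q s \<sigma>" and s: "s [21] = i" "s [1] = d"
        have cell: "s [8, v, i] = (if i \<in> D v then 1 else 0)" using Q v by (simp add: domain_cells_def)
        have "clean (reg 21)" by (simp add: clean_def)
        note pc = post_com_effect[OF conjunct1[OF Q] this this, of "reg 20" 2]
        show "within (worst remove_com * 1) remove_com s
          (\<lambda>s'. s' [21] = i \<and> s' [1] = d \<and> ?Q s' (remove D v i \<sigma>))"
        proof (rule within_cheap_loop_free)
          show "effect remove_com s [21] = i \<and> effect remove_com s [1] = d \<and>
            ?Q (effect remove_com s) (remove D v i \<sigma>)"
            using pc dom[OF _ pc(2)] Q s cell by (simp add: remove_com_def remove_def frame_def)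
        qed (simp_all add: remove_com_def)
      qed (use Q in auto)
    qed simp
    then show "within ((1 + worst ?p + (worst remove_com + 20)) * ((d + 1) * 1)) (Seq ?p (for_upto 21 1 remove_com)) s
      (\<lambda>s'. s' [20] = v \<and> s' [0] = n \<and> ?P s' (start_row d D v \<sigma>))"
      by (rule within_mono) (use represents_inputs[of n d "start_row d D v \<sigma>"] in auto)
  qed (use assms in auto)
  then show ?thesis unfolding facts_time_def by (rule within_mono) auto
qed

definition setup_time :: nat where
  "setup_time = 1 + border_time + (1 + bodies_time + (1 + worst constants_com + facts_time))"

lemma setup_com_correct:
  "within (setup_time * ((n + 1) * ((d + 1) * (d + 1)))) setup_com (input_store n d D)
    (represents n d (start_state n d D))"
proof -
  let ?E = "(n + 1) * ((d + 1) * (d + 1))"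
  have "(n + 1) * ((d + 1) * 1) \<le> ?E" by (intro mult_le_mono order_refl) simp
  then have E: "1 \<le> ?E" "(n + 1) * ((d + 1) * 1) \<le> ?E" "(n + 1) * ((d + 1) * ((d + 1) * 1)) \<le> ?E"
    by simp_all
  have border: "within (border_time * ?E) border_com s (canvas n d D (border n d))"
    if "canvas n d D (\<lambda>_. 0) s" for s
    by (rule within_mono[OF border_com_correct[OF that]]) (use E in auto)
  have bodies: "within (bodies_time * ?E) bodies_com s
    (\<lambda>s'. canvas n d D (border n d) s' \<and> filled ({1..n} \<times> {1..d} \<times> {1..d}) s')"
    if "canvas n d D (border n d) s" for s
    by (rule within_mono[OF bodies_com_correct[OF that]]) (use E in auto)
  have facts: "within (facts_time * ?E) facts_com s (represents n d (start_state n d D))"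
    if "represents n d (border n d, [], False) s \<and> domain_cells n D s" for s
    by (rule within_mono[OF facts_com_correct[OF conjunct1[OF that] conjunct2[OF that]]]) (use E in auto)
  have const_facts: "within ((1 + worst constants_com + facts_time) * ?E) (Seq constants_com facts_com) s
      (represents n d (start_state n d D))"
    if "canvas n d D (border n d) s \<and> filled ({1..n} \<times> {1..d} \<times> {1..d}) s" for s
  proof (rule within_cheap_seq[OF _ E(1)], rule within_cheap_loop_free[OF _ _ E(1)])
    show "loop_free constants_com" by (simp add: constants_com_def)
    show "within (facts_time * ?E) facts_com (effect constants_com s) (represents n d (start_state n d D))"
      by (rule facts) (use constants_com_effect that in blast)
  qed
  have rest: "within ((1 + bodies_time + (1 + worst constants_com + facts_time)) * ?E)
      (Seq bodies_com (Seq constants_com facts_com)) s (represents n d (start_state n d D))"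
    if "canvas n d D (border n d) s" for s
    by (rule within_cheap_seq[OF _ E(1)], rule within_mono[OF bodies[OF that] order_refl], rule const_facts)
  show ?thesis
    unfolding setup_com_def setup_time_def
    by (rule within_cheap_seq[OF _ E(1)], rule within_mono[OF border[OF canvas_input] order_refl], rule rest)
qed


section \<open>The initial state\<close>

definition start_facts :: "nat \<Rightarrow> nat \<Rightarrow> doms \<Rightarrow> fact set" where
  "start_facts n d D = {((v, 1, d), 1) | v. v \<in> {1..n}} \<union>
     {((v, i, i), 2) | v i. v \<in> {1..n} \<and> i \<in> {1..d} - D v}"

definition established :: "pstate \<Rightarrow> fact \<Rightarrow> bool" where
  "established \<sigma> c \<longleftrightarrow> failed \<sigma> \<or> holds (fst \<sigma>) c"

lemma established_extends:
  assumes "extends \<sigma> \<sigma>'" "snd c \<noteq> 0" "established \<sigma> c"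
  shows "established \<sigma>' c"
  using assms by (cases \<sigma>; cases \<sigma>') (auto simp: extends_def established_def holds_def)

lemma established_post: "established (post c \<sigma>) c"
  by (cases c; cases \<sigma>) (simp add: established_def holds_def)

lemma fold_establishes:
  assumes der: "\<And>x \<sigma>. x \<in> set xs \<Longrightarrow> derives J \<sigma> (g x \<sigma>)"
    and est: "\<And>x c \<sigma>. x \<in> set xs \<Longrightarrow> c \<in> F x \<Longrightarrow> established (g x \<sigma>) c \<and> snd c \<noteq> 0"
  shows "derives J \<sigma> (fold g xs \<sigma>) \<and> (\<forall>x\<in>set xs. \<forall>c\<in>F x. established (fold g xs \<sigma>) c)"
  using assms
proof (induction xs arbitrary: \<sigma>)
  case Nil
  then show ?case by (simp add: derives.stop)
next
  case (Cons x xs)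
  have IH: "derives J (g x \<sigma>) (fold g xs (g x \<sigma>)) \<and>
    (\<forall>x'\<in>set xs. \<forall>c\<in>F x'. established (fold g xs (g x \<sigma>)) c)"
  proof (rule Cons.IH)
    fix y \<sigma>' assume y: "y \<in> set xs"
    show "derives J \<sigma>' (g y \<sigma>')" by (rule Cons.prems(1)) (use y in simp)
    show "established (g y \<sigma>') c \<and> snd c \<noteq> 0" if "c \<in> F y" for c
      by (rule Cons.prems(2)) (use y that in simp_all)
  qed
  have "established (fold g xs (g x \<sigma>)) c" if c: "c \<in> F x" for c
  proof -
    have "established (g x \<sigma>) c \<and> snd c \<noteq> 0" by (rule Cons.prems(2)) (use c in simp_all)
    then show ?thesis using established_extends[OF derives_extends[OF conjunct1[OF IH]]] by blast
  qed
  moreover have "derives J \<sigma> (g x \<sigma>)" by (rule Cons.prems(1)) simp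
  then have "derives J \<sigma> (fold g xs (g x \<sigma>))" by (rule derives_trans[OF conjunct1[OF IH]])
  ultimately show ?case using conjunct2[OF IH] by simp
qed

text \<open>The initial facts are treated as inferences without antecedents, which makes all results
  about derivations available for the start state.\<close>

lemma start_state_derived:
  fixes n d :: nat and D :: doms
  assumes "1 \<le> d"
  defines "J \<equiv> {({}, c) | c. c \<in> start_facts n d D}"
  shows "derives J (border n d, [], False) (start_state n d D)"
    and "\<And>c. c \<in> start_facts n d D \<Longrightarrow> established (start_state n d D) c"
proof -
  define row where "row v = {((v, i, i), 2 :: nat) | i. i \<in> {1..d} - D v}" for v
  have set: "set [1..<k + 1] = {1..k}" for k by auto
  have fact: "({}, ((v, 1, d), 1)) \<in> J" if "v \<in> {1..n}" for v
    using that by (auto simp: J_def start_facts_def)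
  have fact': "({}, ((v, i, i), 2)) \<in> J" if "v \<in> {1..n}" "i \<in> {1..d} - D v" for v i
    using that by (auto simp: J_def start_facts_def)
  have row: "derives J \<sigma> (start_row d D v \<sigma>)" "established (start_row d D v \<sigma>) ((v, 1, d), 1)"
    "\<forall>c\<in>row v. established (start_row d D v \<sigma>) c" if v: "v \<in> {1..n}" for v \<sigma>
  proof -
    let ?\<sigma> = "post ((v, 1, d), 1) \<sigma>"
    have f: "derives J ?\<sigma> (fold (remove D v) [1..<d + 1] ?\<sigma>) \<and> (\<forall>i\<in>set [1..<d + 1].
        \<forall>c\<in>(if i \<in> D v then {} else {((v, i, i), 2)}). established (fold (remove D v) [1..<d + 1] ?\<sigma>) c)"
    proof (rule fold_establishes)
      fix i \<sigma> assume "i \<in> set [1..<d + 1]"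
      then have "i \<in> {1..d}" unfolding set .
      then show "derives J \<sigma> (remove D v i \<sigma>)"
        using derives_fact[OF fact'[OF v], of i] by (simp add: remove_def derives.stop)
      fix c assume "c \<in> (if i \<in> D v then {} else {((v, i, i), 2 :: nat)})"
      then show "established (remove D v i \<sigma>) c \<and> snd c \<noteq> 0"
        using established_post[of c \<sigma>] by (cases "i \<in> D v") (simp_all add: remove_def)
    qed
    then show "derives J \<sigma> (start_row d D v \<sigma>)"
      unfolding start_row_def using derives_trans derives_fact[OF fact[OF v]] by blast
    show "established (start_row d D v \<sigma>) ((v, 1, d), 1)"
      unfolding start_row_def
      by (rule established_extends[OF derives_extends[OF conjunct1[OF f]]]) (simp_all add: established_post)
    show "\<forall>c\<in>row v. established (start_row d D v \<sigma>) c"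
    proof
      fix c assume "c \<in> row v"
      then obtain i where i: "c = ((v, i, i), 2)" "i \<in> set [1..<d + 1]" "i \<notin> D v"
        unfolding row_def set by blast
      have "\<forall>c\<in>(if i \<in> D v then {} else {((v, i, i), 2)}). established (start_row d D v \<sigma>) c"
        unfolding start_row_def using conjunct2[OF f] i(2) by (rule bspec)
      then show "established (start_row d D v \<sigma>) c" using i(1,3) by simp
    qed
  qed
  have all: "derives J (border n d, [], False) (start_state n d D) \<and>
    (\<forall>v\<in>set [1..<n + 1]. \<forall>c\<in>insert ((v, 1, d), 1) (row v). established (start_state n d D) c)"
    unfolding start_state_def
  proof (rule fold_establishes)
    fix v \<sigma> assume v: "v \<in> set [1..<n + 1]"
    then show "derives J \<sigma> (start_row d D v \<sigma>)" using row(1) unfolding set by blast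
    fix c assume "c \<in> insert ((v, 1, d), 1) (row v)"
    then have "c = ((v, 1, d), 1) \<or> c \<in> row v \<and> snd c = 2" by (auto simp: row_def)
    then show "established (start_row d D v \<sigma>) c \<and> snd c \<noteq> 0"
      using row(2,3)[of v \<sigma>] v unfolding set by fastforce
  qed
  then show "derives J (border n d, [], False) (start_state n d D)" by blast
  show "established (start_state n d D) c" if "c \<in> start_facts n d D" for c
  proof -
    from that obtain v where "v \<in> {1..n}" "c \<in> insert ((v, 1, d), 1) (row v)"
      unfolding start_facts_def row_def by blast
    then show ?thesis using all unfolding set by blast
  qed
qed

lemma start_state_facts:
  assumes d: "1 \<le> d"
  shows "well_formed n d (start_state n d D)" "potential n d (start_state n d D) = card (ranges n d)"
    "\<forall>i\<in>inferences n d. settled (start_state n d D) i"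
    "\<And>V. bordered n d V \<Longrightarrow> (\<And>c. c \<in> start_facts n d D \<Longrightarrow> holds V c) \<Longrightarrow> sound V (start_state n d D)"
proof -
  let ?J = "{({}, c) | c. c \<in> start_facts n d D}" and ?\<sigma>0 = "(border n d, [], False)"
  note der = start_state_derived(1)[OF d, of n D] and est = start_state_derived(2)[OF d, of _ n D]
  have proper: "proper_rules n d ?J"
    using d by (auto simp: proper_rules_def start_facts_def admissible_def ranges_def)
  have wf0: "well_formed n d ?\<sigma>0"
    using border_bound by (simp add: well_formed_def bordered_def)
  have "{r \<in> ranges n d. border n d r = 0} = ranges n d" by auto
  then have pot0: "potential n d ?\<sigma>0 = card (ranges n d)" by (simp add: potential_def)
  show wf: "well_formed n d (start_state n d D)" "potential n d (start_state n d D) = card (ranges n d)"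
    using derives_facts[OF der wf0 proper] pot0 by simp_all
  obtain T q f where \<sigma>: "start_state n d D = (T, q, f)" by (cases "start_state n d D")
  have ext: "extends ?\<sigma>0 (T, q, f)" using derives_extends[OF der] by (simp only: \<sigma>)
  have fresh: "r \<in> set q" if "r \<in> ranges n d" "T r \<noteq> 0" for r
    using ext that by (auto simp: extends_def)
  show "\<forall>i\<in>inferences n d. settled (start_state n d D) i"
  proof (cases f)
    case True
    then show ?thesis by (simp add: \<sigma> settled_def)
  next
    case False
    have "(v, 1, d) \<in> set q" if v: "v \<in> {1..n}" for v
    proof (rule fresh)
      show "(v, 1, d) \<in> ranges n d" using v d by (simp add: ranges_def)
      have "((v, 1, d), 1) \<in> start_facts n d D" using v by (auto simp: start_facts_def)
      from est[OF this] show "T (v, 1, d) \<noteq> 0" using False by (simp add: \<sigma> established_def holds_def)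
    qed
    then show ?thesis using settled_initially[of n d T q f] wf(1) d fresh by (simp add: \<sigma>)
  qed
  show "sound V (start_state n d D)" if V: "bordered n d V" "\<And>c. c \<in> start_facts n d D \<Longrightarrow> holds V c" for V
  proof (rule derives_sound[OF der _ _ proper])
    have "border n d r = V r" if "border n d r \<noteq> 0" for r
      using V(1) that by (cases "r \<in> ranges n d") (auto simp: bordered_def)
    then show "sound V ?\<sigma>0" by (simp add: sound_def)
    show "closed_under ?J V" using V(2) by (auto simp: closed_under_def)
  qed
qed


section \<open>Running the propagator along a branch\<close>

lemma truth_code_eq: "consistent A \<Longrightarrow> (x, b) \<in> A \<Longrightarrow> truth_code A x = code b"
  by (cases b) (auto simp: truth_code_def consistent_def)

lemma constants_atoms:
  "(At Bot, False) \<in> constants n d" "(At Violate, False) \<in> constants n d" "(At Sat, True) \<in> constants n d"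
  "(Bd (Conj {Neg Violate}), True) \<in> constants n d" "(Bd (Conj {Neg Sat}), False) \<in> constants n d"
  unfolding constants_def by blast+

text \<open>Range atoms and their bodies are read off \<open>T\<close>; every other displayed cell
  belongs to a constant. The value of a full-range body, shared by all variables, is correct because
  all full ranges are true.\<close>

lemma represents_displays:
  assumes rep: "represents n d (T, q, False) s" and wf: "well_formed n d (T, q, False)"
    and A: "A = readout n d T" "T = shown n d A" and full: "\<And>v. v \<in> {1..n} \<Longrightarrow> T (v, 1, d) = 1"
    and noc: "\<not> conflict (nogoods (all_different_prog n d)) A" and "1 \<le> n"
  shows "displays n d A s"
proof -
  note r = rep[unfolded represents_def prod.case]
  have con: "consistent A" unfolding A(1) using full by (rule consistent_readout)
  have const: "truth_code A x = code b" if "(x, b) \<in> constants n d" for x b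
    by (rule truth_code_eq[OF con]) (use that in \<open>simp add: A(1) readout_def\<close>)
  have cc: "constant_cells n d s" using r by blast
  have cells: "s a = truth_code A x" if "(a, x) \<in> all_different_cells n d" for a x
    using that unfolding all_different_cells_def
  proof (elim UnE)
    assume "(a, x) \<in> {([9, k, v, l, u], At a) | k v l u a.
        a \<in> insert Bot (atoms_of (all_different_prog n d)) \<and> atom_code a = (k, v, l, u)}"
    then obtain k v l u at where ax: "a = [9, k, v, l, u]" "x = At at" "atom_code at = (k, v, l, u)"
      and at: "at = Bot \<or> at \<in> atoms_of (all_different_prog n d)" by blast
    have "at = Bot \<or> at = Sat \<or> at = Violate \<or> (\<exists>v l u. at = R v l u \<and> (v, l, u) \<in> ranges n d)"
      using at by (auto elim: atoms_of_prog)
    then consider "at = Bot" | "at = Sat" | "at = Violate" | "at = R v l u" "(v, l, u) \<in> ranges n d"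
      using ax(3) by auto
    then show ?thesis
    proof cases
      case 1
      then show ?thesis using ax cc const[OF constants_atoms(1)] by (auto simp: constant_cells_def)
    next
      case 2
      then show ?thesis using ax cc const[OF constants_atoms(3)] by (auto simp: constant_cells_def)
    next
      case 3
      then show ?thesis using ax cc const[OF constants_atoms(2)] by (auto simp: constant_cells_def)
    next
      case 4
      have "s a = T (v, l, u)" using ax 4 r by simp
      also have "\<dots> = truth_code A x" using 4 ax by (subst A(2)) (simp add: shown_def)
      finally show ?thesis .
    qed
  next
    assume "(a, x) \<in> {([10, v, l, u], Bd (range_body d v l u)) | v l u.
       v \<in> {1..n} \<and> 1 \<le> l \<and> l \<le> u \<and> u \<le> d}"
    then obtain v l u where ax: "a = [10, v, l, u]" "x = Bd (range_body d v l u)" and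
      vlu: "(v, l, u) \<in> ranges n d" by (auto simp: ranges_def)
    have "(x, b) \<in> A \<longleftrightarrow> T (v, l, u) = code b" for b
      unfolding A(1) ax(2) using full vlu by (rule readout_range_body)
    moreover have "T (v, l, u) \<in> {0, 1, 2}" using wf by (simp add: well_formed_def)
    ultimately have "truth_code A x = T (v, l, u)" by (auto simp: truth_code_def)
    then show ?thesis using ax r by simp
  next
    assume "(a, x) \<in> {([11, v, l, u], Bd (left_body v l u)) | v l u. v \<in> {1..n} \<and> 1 < l \<and> l \<le> u \<and> u \<le> d}"
    then obtain v l u where ax: "a = [11, v, l, u]" "x = Bd (left_body v l u)" and
      vlu: "(v, l, u) \<in> ranges n d" "1 < l" by (auto simp: ranges_def)
    have "s a = 2" using cc vlu(1) by (auto simp: constant_cells_def ax ranges_def)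
    then show ?thesis using const[OF constants_bodies(1)[OF vlu]] ax by simp
  next
    assume "(a, x) \<in> {([12, v, l, u], Bd (right_body v l u)) | v l u. v \<in> {1..n} \<and> 1 \<le> l \<and> l \<le> u \<and> u < d}"
    then obtain v l u where ax: "a = [12, v, l, u]" "x = Bd (right_body v l u)" and
      vlu: "(v, l, u) \<in> ranges n d" "u < d" by (auto simp: ranges_def)
    have "s a = 2" using cc vlu(1) by (auto simp: constant_cells_def ax ranges_def)
    then show ?thesis using const[OF constants_bodies(2)[OF vlu]] ax by simp
  next
    assume "(a, x) \<in> {([13, l, u], Bd (hall_body n l u)) | l u. 1 \<le> l \<and> l \<le> u \<and> u \<le> d}"
    then obtain l u where ax: "a = [13, l, u]" "x = Bd (hall_body n l u)" and
      lu: "1 \<le> l" "l \<le> u" "u \<le> d" by blast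
    \<comment> \<open>The cell of a Hall body carries no variable, whereas the cells were filled
      once per variable; variable 1 serves as the instance.\<close>
    have "1 \<in> {1..n}" "l \<in> {1..d}" "u \<in> {1..d}" using lu \<open>1 \<le> n\<close> by auto
    then have "s a = 2" using cc unfolding constant_cells_def ax by blast
    then show ?thesis using const[OF constants_bodies(3)[OF lu, of n]] ax by simp
  next
    assume "(a, x) \<in> {([14], Bd (Conj {Neg Violate})), ([15], Bd (Conj {Neg Sat}))}"
    then show ?thesis using cc const[OF constants_atoms(4)] const[OF constants_atoms(5)]
      by (auto simp: constant_cells_def)
  qed
  then show ?thesis using noc r by (auto simp: displays_def)
qed

section \<open>Correctness and amortised time along a branch\<close>

definition step_time :: nat where
  "step_time = 1 + worst decide_com + guard_time"

definition init_time :: nat where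
  "init_time = 2 + bcost (Less (reg 1) (reg 0)) + guard_time"

text \<open>The price of one unit of potential: an iteration of the loop and the overhead of one
  call. Each decision consumes a unit, so the calls are paid for as well.\<close>

definition credit :: "nat \<Rightarrow> nat" where
  "credit d = iteration_time * (d + 1) + step_time"

definition budget :: "nat \<Rightarrow> nat \<Rightarrow> nat" where
  "budget n d = init_time + setup_time * ((n + 1) * ((d + 1) * (d + 1))) + credit d * card (ranges n d)"

definition tracks :: "nat \<Rightarrow> nat \<Rightarrow> slit set \<Rightarrow> pstate \<Rightarrow> bool" where
  "tracks n d A \<sigma> \<longleftrightarrow> well_formed n d \<sigma> \<and> (failed \<sigma> \<or> queue \<sigma> = []) \<and>
     (\<forall>i\<in>inferences n d. settled \<sigma> i) \<and>
     (conflict (nogoods (all_different_prog n d)) A \<longleftrightarrow> failed \<sigma>) \<and>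
     (\<not> failed \<sigma> \<longrightarrow> fst \<sigma> = shown n d A \<and> A = readout n d (fst \<sigma>))"

lemma tracks_full:
  assumes "tracks n d A \<sigma>" "\<not> failed \<sigma>" "1 \<le> d" "v \<in> {1..n}"
  shows "fst \<sigma> (v, 1, d) = 1"
proof -
  obtain T q f where \<sigma>: "\<sigma> = (T, q, f)" by (cases \<sigma>)
  note tr = assms(1)[unfolded tracks_def \<sigma> fst_conv snd_conv]
  have "\<forall>i\<in>inferences n d. settled (T, [], False) i" and wf: "well_formed n d (T, q, f)"
    using tr assms(2)[unfolded \<sigma> snd_conv] by (metis (full_types))+
  then have "closed_under (inferences n d) T"
    by (auto simp: closed_under_def settled_def pending_def)
  moreover have "bordered n d T" using wf by (simp add: well_formed_def)
  ultimately show ?thesis using closed_full_range assms(3,4) unfolding \<sigma> fst_conv by blast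
qed

lemma tracks_displays:
  assumes "represents n d \<sigma> s" "tracks n d A \<sigma>" "1 \<le> n" "1 \<le> d"
  shows "displays n d A s"
proof (cases "failed \<sigma>")
  case True
  then have "s [2] = 1" using assms(1) by (cases \<sigma>) (simp add: represents_def)
  then show ?thesis using True assms(2) by (simp add: displays_def tracks_def)
next
  case False
  obtain T q f where \<sigma>: "\<sigma> = (T, q, f)" by (cases \<sigma>)
  note tr = assms(2)[unfolded tracks_def \<sigma> fst_conv snd_conv]
  have f: "f = False" using False by (simp add: \<sigma>)
  have full: "T (v, 1, d) = 1" if "v \<in> {1..n}" for v
    using tracks_full[OF assms(2) False assms(4) that] by (simp add: \<sigma>)
  show ?thesis
  proof (rule represents_displays[of n d T q])
    show "represents n d (T, q, False) s" using assms(1) unfolding \<sigma> f .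
    show "well_formed n d (T, q, False)" "A = readout n d T" "T = shown n d A"
      "\<not> conflict (nogoods (all_different_prog n d)) A" using tr unfolding f by blast+
  qed (use full assms(3) in auto)
qed

text \<open>The new start is the old fixpoint with the decided literal. A conflict-free fixpoint
  above it shows all the values of the posted state, so it is a sound target; and since no value is
  lost, the final readout contains the new start.\<close>

lemma tracks_decide:
  assumes nd: "1 \<le> n" "1 \<le> d" and tr: "tracks n d A (T, q, f)" and nf: "\<not> f"
    and r: "(v, l, u) \<in> ranges n d" and new: "T (v, l, u) = 0"
    and pgt: "propagated n d (T((v, l, u) := code b), [(v, l, u)], False) \<sigma>'"
  shows "tracks n d (unit_prop (nogoods (all_different_prog n d)) (insert (At (R v l u), b) A)) \<sigma>'"
proof -
  let ?N = "nogoods (all_different_prog n d)" and ?x = "(At (R v l u), b)"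
  let ?A = "insert ?x A" and ?T = "T((v, l, u) := code b)"
  let ?U = "unit_prop ?N ?A"
  obtain T' q' f' where \<sigma>': "\<sigma>' = (T', q', f')" by (cases \<sigma>')
  note tr' = tr[unfolded tracks_def fst_conv snd_conv]
  have A: "A = readout n d T" and wfT: "well_formed n d (T, q, f)" using tr' nf by blast+
  then have bd: "bordered n d T" and vals: "\<And>r. T r \<in> {0, 1, 2}" by (simp_all add: well_formed_def)
  have con: "consistent A"
    unfolding A using tracks_full[OF tr _ nd(2)] nf by (intro consistent_readout) simp
  have free: "(At (R v l u), b') \<notin> A" for b' using new unfolding A by (cases b') simp_all
  have conA: "consistent ?A" using con free by (auto simp: consistent_def)
  have sub: "?A \<subseteq> ?U" by (rule start_subset_unit_prop)
  have viol: "(At Violate, False) \<in> ?U" using sub constants_atoms(2)[of n d] unfolding A readout_def by blast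
  have keep: "T' r' = ?T r'" if "?T r' \<noteq> 0" for r' using pgt that by (simp add: propagated_def \<sigma>')
  have sound: "sound (shown n d ?U) (T', q', f')" if noc: "\<not> conflict ?N ?U"
  proof -
    interpret conflict_free_fixpoint n d ?N ?U ?A
      using nd conA viol noc by unfold_locales auto
    have "?T r' = V r'" if "?T r' \<noteq> 0" for r'
    proof (cases "r' \<in> ranges n d")
      case False
      then have "r' \<noteq> (v, l, u)" using r by blast
      then show ?thesis using bd bordered_shown[of n d ?U] False by (simp add: bordered_def)
    next
      case True
      obtain v' l' u' where r': "r' = (v', l', u')" by (cases r')
      have "\<exists>b'. ?T r' = code b'"
      proof (cases "r' = (v, l, u)")
        case False
        moreover have "T r' \<in> {0, 1, 2}" by (rule vals)
        ultimately show ?thesis using that by (metis code_simps empty_iff fun_upd_other insert_iff)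
      qed auto
      then obtain b' where b': "?T r' = code b'" by blast
      have "(At (R v' l' u'), b') \<in> ?A"
      proof (cases "r' = (v, l, u)")
        case False
        then have "T r' = code b'" using b' by simp
        then have "(At (R v' l' u'), b') \<in> A" using True unfolding A r' by simp
        then show ?thesis by blast
      next
        case same: True
        then have "code b = code b'" using b' by simp
        then show ?thesis using same by (simp add: r')
      qed
      then have "V r' = code b'" using sub shown_iff[of v' l' u' b'] True r' by blast
      then show ?thesis using b' by simp
    qed
    then have "sound V (?T, [(v, l, u)], False)" by (simp add: sound_def)
    then show ?thesis using pgt closed_shown by (simp add: propagated_def \<sigma>')
  qed
  have read: "?A \<subseteq> readout n d T'" 
  proof -
    have "T' r' = T r'" if "T r' \<noteq> 0" for r' using keep[of r'] that new by (cases "r' = (v, l, u)") auto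
    then have "A \<subseteq> readout n d T'" unfolding A by (rule readout_mono)
    moreover have "?T (v, l, u) \<noteq> 0" by (simp add: code_def)
    then have "?x \<in> readout n d T'" using keep[of "(v, l, u)"] r by simp
    ultimately show ?thesis by blast
  qed
  have wf: "well_formed n d (T', q', f')" and fin: "f' \<or> q' = [] \<and> (\<forall>i\<in>inferences n d. settled (T', q', f') i) \<and> ?A \<subseteq> readout n d T'"
    using pgt read by (auto simp: propagated_def \<sigma>')
  note pc = propagator_correct[OF nd conA viol refl wf sound fin]
  show ?thesis
    unfolding tracks_def \<sigma>' fst_conv snd_conv
    using pc pgt[unfolded propagated_def \<sigma>' fst_conv snd_conv] by blast
qed

text \<open>The posted full ranges are not part of the initial assignment. They are sound
  nevertheless, because they hold in every closed valuation with the right border.\<close>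

lemma root_tracks:
  assumes nd: "1 \<le> n" "1 \<le> d" and pgt: "propagated n d (start_state n d D) \<sigma>'"
  shows "tracks n d (unit_prop (nogoods (all_different_prog n d)) (initial_assignment n d D)) \<sigma>'"
proof -
  let ?N = "nogoods (all_different_prog n d)" and ?A = "initial_assignment n d D"
  let ?U = "unit_prop ?N ?A"
  obtain T' q' f' where \<sigma>': "\<sigma>' = (T', q', f')" by (cases \<sigma>')
  have sound: "sound (shown n d ?U) (T', q', f')" if noc: "\<not> conflict ?N ?U"
  proof -
    interpret conflict_free_fixpoint n d ?N ?U ?A
      using nd consistent_initial not_violate_initial noc by unfold_locales auto
    have "holds V c" if "c \<in> start_facts n d D" for c
    proof -
      from that consider v where "c = ((v, 1, d), 1)" "v \<in> {1..n}"
        | v i where "c = ((v, i, i), 2)" "v \<in> {1..n}" "i \<in> {1..d} - D v"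
        unfolding start_facts_def by blast
      then show ?thesis
      proof cases
        case 1
        then show ?thesis
          using closed_full_range[OF closed_shown bordered_shown _ nd(2)] by (simp add: holds_def)
      next
        case 2
        have "(At (R v i i), False) \<in> ?A" using 2 by (auto simp: initial_assignment_def)
        then have "(At (R v i i), False) \<in> ?U" by (rule unit_prop.start)
        then show ?thesis using shown_iff[of v i i False] 2 by (auto simp: holds_def ranges_def)
      qed
    qed
    then have "sound V (start_state n d D)" using start_state_facts(4)[OF nd(2) bordered_shown] by blast
    then show ?thesis using pgt closed_shown by (simp add: propagated_def \<sigma>')
  qed
  have read: "?A \<subseteq> readout n d T'" if nf: "\<not> f'"
  proof
    fix \<sigma> assume "\<sigma> \<in> ?A"
    then consider "\<sigma> = (At Violate, False)"
      | v i where "\<sigma> = (At (R v i i), False)" "v \<in> {1..n}" "i \<in> {1..d} - D v"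
      by (auto simp: initial_assignment_def)
    then show "\<sigma> \<in> readout n d T'"
    proof cases
      case 1
      then show ?thesis using constants_atoms(2) unfolding readout_def by blast
    next
      case 2
      then have "((v, i, i), 2) \<in> start_facts n d D" unfolding start_facts_def by blast
      from start_state_derived(2)[OF nd(2) this] have "fst (start_state n d D) (v, i, i) = 2"
        using nf pgt by (auto simp: established_def holds_def propagated_def \<sigma>')
      then have "T' (v, i, i) = 2" using pgt by (auto simp: propagated_def \<sigma>')
      then show ?thesis using 2 by (simp add: ranges_def)
    qed
  qed
  have wf: "well_formed n d (T', q', f')" and fin: "f' \<or> q' = [] \<and> (\<forall>i\<in>inferences n d. settled (T', q', f') i) \<and> ?A \<subseteq> readout n d T'"
    using pgt read by (auto simp: propagated_def \<sigma>')
  note pc = propagator_correct[OF nd consistent_initial not_violate_initial refl wf sound fin]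
  show ?thesis
    unfolding tracks_def \<sigma>' fst_conv snd_conv
    using pc pgt[unfolded propagated_def \<sigma>' fst_conv snd_conv] by blast
qed

text \<open>A decision turns an unassigned range into a queue entry and leaves the potential as it
  is. Visiting the entry lowers the potential, and the \<open>step_time\<close> in the credit for
  this unit covers the overhead of the call.\<close>

lemma step_com_correct:
  assumes nd: "n \<le> d" and rep: "represents n d (T, [], False) s" and wf: "well_formed n d (T, [], False)"
    and set: "\<forall>i\<in>inferences n d. settled (T, [], False) i"
    and r: "(v, l, u) \<in> ranges n d" and new: "T (v, l, u) = 0"
  shows "\<exists>t s' \<sigma>'. exec step_com (post_decision (R v l u, b) s) t s' \<and> represents n d \<sigma>' s' \<and>
    propagated n d (T((v, l, u) := code b), [(v, l, u)], False) \<sigma>' \<and>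
    t + credit d * potential n d \<sigma>' \<le> credit d * potential n d (T, [], False)"
proof -
  let ?s = "post_decision (R v l u, b) s" and ?\<sigma> = "(T((v, l, u) := code b), [(v, l, u)], False)"
  have s: "?s = s([3] := 0, [4] := v, [5] := l, [6] := u, [7] := code b)" by (simp add: code_def)
  have rep': "represents n d (T, [], False) ?s" unfolding s using rep by (simp add: represents_reg)
  have eq: "post ((v, l, u), code b) (T, [], False) = ?\<sigma>" using new by simp
  have "admissible n d ((v, l, u), code b)" using r by (simp add: admissible_def code_def)
  note pf = post_facts[OF wf this, unfolded eq]
  have set': "\<forall>i\<in>inferences n d. settled ?\<sigma> i" using settled_post set unfolding eq[symmetric] by blast
  have "clean (reg 5)" "clean (reg 6)" by (simp_all add: clean_def)
  note pc = post_com_effect(1)[OF rep' this, of "reg 4"]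
  have "effect decide_com ?s = effect (post_com (reg 4) (reg 5) (reg 6) (code b)) ?s"
    unfolding decide_com_def s by (cases b) simp_all
  then have "represents n d ?\<sigma> (effect decide_com ?s)" using pc[of "code b"] eq unfolding s by simp
  from propagate_com_correct[OF nd this pf(1) set'] obtain t s' \<sigma>' where
    main: "exec propagate_com (effect decide_com ?s) t s'" "represents n d \<sigma>' s'" "propagated n d ?\<sigma> \<sigma>'"
    "t + iteration_time * (d + 1) * potential n d \<sigma>' \<le> iteration_time * (d + 1) * potential n d ?\<sigma> + guard_time"
    by blast
  have "loop_free decide_com" by (simp add: decide_com_def)
  then obtain t0 where t0: "t0 \<le> worst decide_com" "exec decide_com ?s t0 (effect decide_com ?s)"
    using exec_loop_free by blast
  have ex: "exec step_com ?s (1 + t0 + t) s'"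
    unfolding step_com_def by (rule exec.seq[OF t0(2) main(1)])
  have "potential n d \<sigma>' + 1 \<le> potential n d ?\<sigma>" using main(3) by (simp add: propagated_def)
  then have "step_time * (potential n d \<sigma>' + 1) \<le> step_time * potential n d ?\<sigma>" by (rule mult_le_mono2)
  moreover have "1 + t0 + guard_time \<le> step_time" using t0(1) by (simp add: step_time_def)
  ultimately have "1 + t0 + t + credit d * potential n d \<sigma>' \<le> credit d * potential n d ?\<sigma>"
    using main(4) unfolding credit_def add_mult_distrib add_mult_distrib2 by linarith
  then show ?thesis using ex main(2,3) unfolding pf(2) by blast
qed

lemma init_com_correct:
  assumes nd: "n \<le> d" "1 \<le> d"
  shows "\<exists>t s' \<sigma>'. exec init_com (input_store n d D) t s' \<and> represents n d \<sigma>' s' \<and>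
    propagated n d (start_state n d D) \<sigma>' \<and> t + credit d * potential n d \<sigma>' \<le> budget n d"
proof -
  let ?s = "input_store n d D" and ?b = "Less (reg 1) (reg 0)"
  obtain t1 s1 where prepared: "exec setup_com ?s t1 s1" "t1 \<le> setup_time * ((n + 1) * ((d + 1) * (d + 1)))"
    "represents n d (start_state n d D) s1"
    using setup_com_correct[of n d D] unfolding within_def by blast
  note st = start_state_facts(1-3)[OF nd(2), of n D]
  from propagate_com_correct[OF nd(1) prepared(3) st(1,3)] obtain t s' \<sigma>' where
    main: "exec propagate_com s1 t s'" "represents n d \<sigma>' s'" "propagated n d (start_state n d D) \<sigma>'"
    "t + iteration_time * (d + 1) * potential n d \<sigma>' \<le>
      iteration_time * (d + 1) * potential n d (start_state n d D) + guard_time"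
    by blast
  have "?s [0] = n" "?s [1] = d" using canvas_input[of n d D] by (simp_all add: canvas_def)
  then have nb: "\<not> beval ?b ?s" using nd by simp
  have ex: "exec init_com ?s (1 + bcost ?b + (1 + t1 + t)) s'"
    unfolding init_com_def by (rule exec.if_false[OF nb exec.seq[OF prepared(1) main(1)]])
  have "potential n d \<sigma>' \<le> potential n d (start_state n d D)"
  proof (cases "failed (start_state n d D) \<or> queue (start_state n d D) = []")
    \<comment> \<open>Again the time inequality bounds the potential, as \<open>guard_time\<close>
      is below the price of one unit.\<close>
    case True
    have "potential n d \<sigma>' * (iteration_time * (d + 1)) < (potential n d (start_state n d D) + 1) * (iteration_time * (d + 1))"
    proof -
      have "guard_time < iteration_time * (d + 1)" by (simp add: iteration_time_def)
      then show ?thesis using main(4) unfolding add_mult_distrib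
        by (simp only: mult.commute[of _ "iteration_time * (d + 1)"] mult_1_left; linarith)
    qed
    then show ?thesis by (simp only: mult_less_cancel2; linarith)
  next
    case False
    then show ?thesis using main(3) by (auto simp: propagated_def)
  qed
  then have "step_time * potential n d \<sigma>' \<le> step_time * potential n d (start_state n d D)" by (rule mult_le_mono2)
  then have "1 + bcost ?b + (1 + t1 + t) + credit d * potential n d \<sigma>' \<le> budget n d"
    using main(4) prepared(2) unfolding credit_def budget_def init_time_def add_mult_distrib st(2)[symmetric] by linarith
  then show ?thesis using ex main(2,3) by blast
qed

text \<open>The time spent so far plus the credit for the remaining potential never exceeds the
  budget fixed at the root. This bound is independent of the number of decisions.\<close>

lemma branch_run:
  assumes nd: "1 \<le> n" "n \<le> d" "1 \<le> d"
    and "branch (all_different_prog n d) (initial_assignment n d D) ds A"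
  shows "\<exists>s t \<sigma>. run init_com step_com (input_store n d D) ds s t \<and> represents n d \<sigma> s \<and> tracks n d A \<sigma> \<and>
    t + credit d * potential n d \<sigma> \<le> budget n d"
  using assms(4)
proof induction
  case root
  from init_com_correct[OF nd(2,3), of D] obtain t s' \<sigma>' where i: "exec init_com (input_store n d D) t s'"
    "represents n d \<sigma>' s'" "propagated n d (start_state n d D) \<sigma>'" "t + credit d * potential n d \<sigma>' \<le> budget n d"
    by blast
  show ?case using run.root[OF i(1)] i(2,4) root_tracks[OF nd(1,3) i(3)] by blast
next
  case (decide ds A a b)
  then obtain s t \<sigma> where IH: "run init_com step_com (input_store n d D) ds s t" "represents n d \<sigma> s"
    "tracks n d A \<sigma>" "t + credit d * potential n d \<sigma> \<le> budget n d" by blast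
  obtain T q f where \<sigma>: "\<sigma> = (T, q, f)" by (cases \<sigma>)
  note tr = IH(3)[unfolded tracks_def \<sigma> fst_conv snd_conv]
  have f: "f = False" using tr decide.hyps(2) by blast
  then have q: "q = []" and A: "A = readout n d T" and wf: "well_formed n d (T, [], False)"
    and set: "\<forall>i\<in>inferences n d. settled (T, [], False) i" using tr by blast+
  \<comment> \<open>The other atoms are constants and already assigned, so only a range atom can be
    decided.\<close>
  have fixed: "(At x, b) \<in> A \<Longrightarrow> a \<noteq> x" for x b using decide.hyps(4,5) by (cases b) auto
  have "constants n d \<subseteq> A" unfolding A readout_def by blast
  then have "a \<noteq> Bot" "a \<noteq> Violate" "a \<noteq> Sat" using fixed constants_atoms(1-3)[of n d] by blast+
  with decide.hyps(3) obtain v l u where r: "(v, l, u) \<in> ranges n d" and a: "a = R v l u"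
    by (auto elim: atoms_of_prog)
  have "T (v, l, u) \<noteq> code b'" for b' using decide.hyps(4,5) r by (cases b') (simp_all add: A a)
  moreover have "T (v, l, u) \<in> {0, 1, 2}" using wf by (simp add: well_formed_def)
  ultimately have new: "T (v, l, u) = 0" by (metis code_simps empty_iff insert_iff)
  from step_com_correct[OF nd(2) IH(2)[unfolded \<sigma> q f] wf set r new, of b] obtain t' s' \<sigma>' where
    st: "exec step_com (post_decision (R v l u, b) s) t' s'" "represents n d \<sigma>' s'"
    "propagated n d (T((v, l, u) := code b), [(v, l, u)], False) \<sigma>'"
    "t' + credit d * potential n d \<sigma>' \<le> credit d * potential n d (T, [], False)" by blast
  have "run init_com step_com (input_store n d D) (ds @ [(a, b)]) s' (t + t')"
    using run.decide[OF IH(1), of "(a, b)"] st(1) by (simp add: a)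
  moreover have "tracks n d (unit_prop (nogoods (all_different_prog n d)) (insert (At a, b) A)) \<sigma>'"
    unfolding a using f by (intro tracks_decide[OF nd(1,3) IH(3)[unfolded \<sigma>] _ r new st(3)]) simp
  moreover have "t + t' + credit d * potential n d \<sigma>' \<le> budget n d"
    using st(4) IH(4) unfolding \<sigma> q f by linarith
  ultimately show ?case using st(2) by blast
qed

text \<open>The pigeonhole principle as the program sees it: the full ranges of all variables are
  true, \<open>d\<close> of them fill \<open>[1,d]\<close>, and that of variable
  \<open>d + 1\<close> would have to be false as well.\<close>

lemma conflict_if_too_many:
  assumes nd: "1 \<le> d" "d < n"
  shows "conflict (nogoods (all_different_prog n d))
    (unit_prop (nogoods (all_different_prog n d)) (initial_assignment n d D))"
proof (rule ccontr)
  let ?N = "nogoods (all_different_prog n d)" and ?A = "initial_assignment n d D"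
  assume noc: "\<not> conflict ?N (unit_prop ?N ?A)"
  interpret conflict_free_fixpoint n d ?N "unit_prop ?N ?A" ?A
    using nd consistent_initial not_violate_initial noc by unfold_locales auto
  have full: "V (v, 1, d) = 1" if "v \<in> {1..n}" for v
    using closed_full_range[OF closed_shown bordered_shown that nd(1)] .
  have "V (d + 1, 1, d) = 2"
    by (rule closed_hall[OF closed_shown, of 1 d "{1..d}"]) (use nd full in auto)
  then show False using full[of "d + 1"] nd by simp
qed

text \<open>The dominant term is \<open>O(d)\<close> credit for each of at most
  \<open>n * d * d\<close> ranges; the setup is smaller by a factor \<open>d\<close>.\<close>

lemma budget_bound: "\<exists>C. \<forall>n d. 1 \<le> n \<longrightarrow> 1 \<le> d \<longrightarrow> budget n d \<le> C * (n * d ^ 3)"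
proof (intro exI allI impI)
  fix n d :: nat assume nd: "1 \<le> n" "1 \<le> d"
  let ?X = "n * d ^ 3"
  have cube: "d ^ 3 = d * (d * d)" by (simp add: power3_eq_cube)
  have X: "1 \<le> ?X" using nd by simp
  have "d * d \<le> d ^ 3" using nd unfolding cube by simp
  then have small: "n * (d * d) \<le> ?X" by simp
  have "(n + 1) * ((d + 1) * (d + 1)) \<le> (2 * n) * ((2 * d) * (2 * d))"
    using nd by (intro mult_le_mono) auto
  also have "\<dots> = 8 * (n * (d * d))" by simp
  also have "\<dots> \<le> 8 * ?X" using small by simp
  finally have prepared: "setup_time * ((n + 1) * ((d + 1) * (d + 1))) \<le> setup_time * (8 * ?X)"
    by (rule mult_le_mono2)
  have "ranges n d \<subseteq> {1..n} \<times> {1..d} \<times> {1..d}" by (auto simp: ranges_def)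
  then have "card (ranges n d) \<le> card ({1..n} \<times> {1..d} \<times> {1..d})" by (rule card_mono[rotated]) simp
  then have card: "card (ranges n d) \<le> n * (d * d)" by simp
  have "credit d \<le> (2 * iteration_time + step_time) * d"
  proof -
    have "iteration_time * (d + 1) \<le> iteration_time * (2 * d)" using nd by (intro mult_le_mono2) simp
    moreover have "step_time \<le> step_time * d" using nd by simp
    ultimately have "credit d \<le> iteration_time * (2 * d) + step_time * d"
      unfolding credit_def by (rule add_mono)
    also have "\<dots> = (2 * iteration_time + step_time) * d" by (simp add: algebra_simps)
    finally show ?thesis .
  qed
  then have "credit d * card (ranges n d) \<le> ((2 * iteration_time + step_time) * d) * (n * (d * d))"
    using card by (rule mult_le_mono)
  also have "\<dots> = (2 * iteration_time + step_time) * ?X" by (simp add: cube)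
  finally have branch: "credit d * card (ranges n d) \<le> (2 * iteration_time + step_time) * ?X" .
  have "init_time \<le> init_time * ?X" using mult_le_mono2[OF X, of init_time] by (simp only: mult_1_right)
  then have "budget n d \<le> init_time * ?X + setup_time * (8 * ?X) + (2 * iteration_time + step_time) * ?X"
    unfolding budget_def by (intro add_mono prepared branch)
  also have "\<dots> = (init_time + 8 * setup_time + (2 * iteration_time + step_time)) * ?X"
    by (simp add: algebra_simps)
  finally show "budget n d \<le> (init_time + 8 * setup_time + (2 * iteration_time + step_time)) * ?X" .
qed

theorem all_different_up_time_cubic: "all_different_up_time (\<lambda>n d. n * d ^ 3)"
proof -
  obtain C where C: "\<And>n d. 1 \<le> n \<Longrightarrow> 1 \<le> d \<Longrightarrow> budget n d \<le> C * (n * d ^ 3)"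
    using budget_bound by blast
  \<comment> \<open>Rounded up, the cost of the root call for \<open>d < n\<close>: one comparison
    and the setting of the flag.\<close>
  let ?c = "1 + bcost (Less (reg 1) (reg 0)) + 4"
  show ?thesis
    unfolding all_different_up_time_def
  proof (rule exI[of _ init_com], rule exI[of _ step_com], rule exI[of _ "C + ?c"], intro allI impI, elim conjE)
    fix n d D ds A
    assume nd: "1 \<le> n" "1 \<le> d"
      and br: "branch (all_different_prog n d) (initial_assignment n d D) ds A"
    show "\<exists>s t. run init_com step_com (input_store n d D) ds s t \<and> displays n d A s \<and> t \<le> (C + ?c) * (n * d ^ 3)"
    proof (cases "n \<le> d")
      case True
      from branch_run[OF nd(1) True nd(2) br] obtain s t \<sigma> where
        run: "run init_com step_com (input_store n d D) ds s t" "represents n d \<sigma> s" "tracks n d A \<sigma>"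
        "t + credit d * potential n d \<sigma> \<le> budget n d" by blast
      have "t \<le> C * (n * d ^ 3)" using run(4) C[OF nd] by linarith
      also have "\<dots> \<le> (C + ?c) * (n * d ^ 3)" by (rule mult_le_mono1) simp
      finally show ?thesis using run(1) tracks_displays[OF run(2,3) nd] by blast
    next
      case False
      let ?U = "unit_prop (nogoods (all_different_prog n d)) (initial_assignment n d D)"
      have conf: "conflict (nogoods (all_different_prog n d)) ?U"
        using conflict_if_too_many[OF nd(2)] False by simp
      \<comment> \<open>A branch is not extended past a conflict, so only the root remains.\<close>
      from br have root: "ds = [] \<and> A = ?U"
        by induction (use conf in auto)
      let ?s = "input_store n d D"
      have "?s [0] = n" "?s [1] = d" using canvas_input[of n d D] by (simp_all add: canvas_def)
      then have b: "beval (Less (reg 1) (reg 0)) ?s" using False by simp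
      have "exec (Assign [Const 2] (Const 1)) ?s 3 (?s([2] := 1))"
        using exec.assign[of "[Const 2]" "Const 1" ?s] by (simp add: eval_nat_numeral)
      from exec.if_true[OF b this] have "exec init_com ?s (1 + bcost (Less (reg 1) (reg 0)) + 3) (?s([2] := 1))"
        unfolding init_com_def .
      from run.root[OF this]
      have "run init_com step_com ?s ds (?s([2] := 1)) (1 + bcost (Less (reg 1) (reg 0)) + 3)"
        using root by blast
      moreover have "displays n d A (?s([2] := 1))" using root conf by (simp add: displays_def)
      moreover have "1 + bcost (Less (reg 1) (reg 0)) + 3 \<le> (C + ?c) * (n * d ^ 3)"
      proof -
        have "1 + bcost (Less (reg 1) (reg 0)) + 3 \<le> (C + ?c) * 1" by simp
        also have "\<dots> \<le> (C + ?c) * (n * d ^ 3)" using nd by (intro mult_le_mono2) simp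
        finally show ?thesis .
      qed
      ultimately show ?thesis by blast
    qed
  qed
qed

theorem corollary2:
  "(\<forall>n d. 1 \<le> n \<and> 1 \<le> d \<longrightarrow>
      up_enforces_range_consistency n d (all_different n d) (all_different_prog n d)) \<and>
   all_different_up_time (\<lambda>n d. n * d ^ 3)"
  using up_enforces_range_consistency_all_different all_different_up_time_cubic by blast

end
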